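(* Let $k\ge 1$ and $d>k$ be integers. Let $S$ be the set of $1$-dimensional $(\mathbb{C}^* )^2$-orbits in the Hilbert scheme of points $(\mathbb{A}^2)^{[dk]}$ over $\mathbb{C}$ whose limit points are the two fixed points $(x^k,y^d)$ and $(x^d,y^k)$. Then $S$ is a finite set, in natural bijection with the set of binary necklaces with $k$ black and $d-k$ white beads. (In particular, $(x^k,y^d)$ and $(x^d,y^k)$ are connected by an edge in the $T$-graph of $(\mathbb{A}^2)^{[dk]}$.)
   Context: $(\mathbb{A}^2)^{[n]}$ is the Hilbert scheme parametrizing ideals $I\subseteq\mathbb{C}[x,y]$ with $\dim_{\mathbb{C}}\mathbb{C}[x,y]/I=n$. The torus $T=(\mathbb{C}^* )^2$ acts on it by scaling the variables $x,y$; the fixed points are the monomial ideals of colength $n$. A $1$-dimensional $T$-orbit $O$ has the two fixed points $p\neq q$ as its limit points if the closure of $O$ in $(\mathbb{A}^2)^{[n]}$ is $O\cup\{p,q\}$. The $T$-graph of $(\mathbb{A}^2)^{[n]}$ is the graph whose vertices are the $T$-fixed points, with an edge between two fixed points if they are the two limit points of some $1$-dimensional $T$-orbit. A binary necklace with $k$ black and $d-k$ white beads is a $k$-element subset of $\mathbb{Z}/d\mathbb{Z}$ (the positions of the black beads) up to rotation, i.e. up to translation by $\mathbb{Z}/d\mathbb{Z}$ (reflections are not identified). *)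

theory Defs
  imports "HOL-Analysis.Analysis" "HOL-Computational_Algebra.Polynomial"
    "HOL-Library.Extended_Nat"
begin

text \<open>
  The ring $\mathbb{C}[x,y]$ is rendered as \<^typ>\<open>complex poly poly\<close>, i.e. as $\mathbb{C}[x][y]$.
\<close>

type_synonym cxy = "complex poly poly"

definition varX :: cxy where
  "varX = [:[:0, 1:]:]"

definition varY :: cxy where
  "varY = [:0, 1:]"

definition Const :: "complex \<Rightarrow> cxy" where
  "Const c = [:[:c:]:]"

lemma module_mult: "module ((*) :: 'a::comm_ring_1 \<Rightarrow> 'a \<Rightarrow> 'a)"
  by unfold_locales (simp_all add: algebra_simps)

text \<open>Ideals are the submodules of the ring regarded as a module over itself.\<close>

abbreviation is_ideal :: "'a::comm_ring_1 set \<Rightarrow> bool" where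
  "is_ideal \<equiv> module.subspace (*)"

abbreviation ideal_gen :: "'a::comm_ring_1 set \<Rightarrow> 'a set" where
  "ideal_gen \<equiv> module.span (*)"


section \<open>The Hilbert scheme of points of the affine plane\<close>

text \<open>
  \<open>represents B I f c\<close>: in the quotient by \<open>I\<close>, the class of \<open>f\<close> is the linear combination of the
  classes of the elements of \<open>B\<close> with coefficients \<open>c\<close>.
\<close>

definition represents :: "cxy set \<Rightarrow> cxy set \<Rightarrow> cxy \<Rightarrow> (cxy \<Rightarrow> complex) \<Rightarrow> bool" where
  "represents B I f c \<longleftrightarrow>
     (\<forall>b. b \<notin> B \<longrightarrow> c b = 0) \<and> f - (\<Sum>b\<in>B. Const (c b) * b) \<in> I"

text \<open>
  The classes of the elements of the finite set \<open>B\<close> are pairwise distinct and form a basis of the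
  complex vector space $\mathbb{C}[x,y]/I$.
\<close>

definition basis_mod :: "cxy set \<Rightarrow> cxy set \<Rightarrow> bool" where
  "basis_mod B I \<longleftrightarrow> finite B \<and> (\<forall>f. \<exists>!c. represents B I f c)"

definition Hilb :: "nat \<Rightarrow> cxy set set" where
  "Hilb n = {I. is_ideal I \<and> (\<exists>B. card B = n \<and> basis_mod B I)}"

definition coord :: "cxy set \<Rightarrow> cxy \<Rightarrow> cxy \<Rightarrow> cxy set \<Rightarrow> complex" where
  "coord B f b I = (THE c. represents B I f c) b"

text \<open>
  For a finite set \<open>B\<close> of monomials, the ideals \<open>I\<close> such that \<open>B\<close> is a basis of $\mathbb{C}[x,y]/I$
  form an affine open subscheme of the Hilbert scheme.  Its coordinate ring is generated by the
  functions sending \<open>I\<close> to the coefficients of the expansions of polynomials modulo \<open>I\<close> in the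
  basis \<open>B\<close>.
\<close>

inductive_set chart_functions :: "cxy set \<Rightarrow> (cxy set \<Rightarrow> complex) set" for B where
  const: "(\<lambda>I. a) \<in> chart_functions B"
| coord: "b \<in> B \<Longrightarrow> coord B f b \<in> chart_functions B"
| add: "\<phi> \<in> chart_functions B \<Longrightarrow> \<psi> \<in> chart_functions B \<Longrightarrow> (\<lambda>I. \<phi> I + \<psi> I) \<in> chart_functions B"
| mult: "\<phi> \<in> chart_functions B \<Longrightarrow> \<psi> \<in> chart_functions B \<Longrightarrow> (\<lambda>I. \<phi> I * \<psi> I) \<in> chart_functions B"

definition monomials :: "cxy set" where
  "monomials = {varX ^ i * varY ^ j | i j. True}"

text \<open>
  The Zariski topology on the closed points of the Hilbert scheme: it is generated by the principal
  open subsets of the above affine charts, which cover the Hilbert scheme.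
\<close>

definition hilb_zariski :: "nat \<Rightarrow> cxy set topology" where
  "hilb_zariski n = topology_generated_by
     {{I \<in> Hilb n. basis_mod B I \<and> \<phi> I \<noteq> 0} | B \<phi>.
        B \<subseteq> monomials \<and> \<phi> \<in> chart_functions B}"


section \<open>Dimension\<close>

definition irreducible_closed :: "'a topology \<Rightarrow> 'a set \<Rightarrow> bool" where
  "irreducible_closed X S \<longleftrightarrow> closedin X S \<and> S \<noteq> {} \<and>
     (\<forall>C D. closedin X C \<and> closedin X D \<and> S = C \<union> D \<longrightarrow> S = C \<or> S = D)"

text \<open>Krull dimension of a topological space (with value \<open>0\<close> for the empty space).\<close>

definition krull_dim :: "'a topology \<Rightarrow> enat" where
  "krull_dim X = Sup {enat n | n. \<exists>Z :: nat \<Rightarrow> 'a set.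
     (\<forall>i\<le>n. irreducible_closed X (Z i)) \<and> (\<forall>i<n. Z i \<subset> Z (Suc i))}"


section \<open>The torus action and the T-graph\<close>

text \<open>The polynomial $f(sx, ty)$.\<close>

definition scale_vars :: "complex \<Rightarrow> complex \<Rightarrow> cxy \<Rightarrow> cxy" where
  "scale_vars s t f = pcompose (map_poly (\<lambda>p. pcompose p [:0, s:]) f) [:0, [:t:]:]"

definition torus_act :: "complex \<Rightarrow> complex \<Rightarrow> cxy set \<Rightarrow> cxy set" where
  "torus_act s t I = scale_vars s t ` I"

definition torus_orbit :: "cxy set \<Rightarrow> cxy set set" where
  "torus_orbit I = {torus_act s t I | s t. s \<noteq> 0 \<and> t \<noteq> 0}"

definition torus_fixed_points :: "nat \<Rightarrow> cxy set set" where
  "torus_fixed_points n = {I \<in> Hilb n. \<forall>s t. s \<noteq> 0 \<and> t \<noteq> 0 \<longrightarrow> torus_act s t I = I}"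

definition one_dim_orbits :: "nat \<Rightarrow> cxy set set set" where
  "one_dim_orbits n =
     {Orb. \<exists>I\<in>Hilb n. Orb = torus_orbit I \<and> krull_dim (subtopology (hilb_zariski n) Orb) = 1}"

definition has_limit_points :: "nat \<Rightarrow> cxy set set \<Rightarrow> cxy set \<Rightarrow> cxy set \<Rightarrow> bool" where
  "has_limit_points n Orb p q \<longleftrightarrow>
     p \<in> torus_fixed_points n \<and> q \<in> torus_fixed_points n \<and> p \<noteq> q \<and>
     hilb_zariski n closure_of Orb = Orb \<union> {p, q}"

definition orbits_between :: "nat \<Rightarrow> cxy set \<Rightarrow> cxy set \<Rightarrow> cxy set set set" where
  "orbits_between n p q = {Orb \<in> one_dim_orbits n. has_limit_points n Orb p q}"

text \<open>The vertices of the T-graph are \<open>torus_fixed_points n\<close>; these are its edges.\<close>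

definition T_graph_edges :: "nat \<Rightarrow> cxy set set set" where
  "T_graph_edges n = {{p, q} | p q. \<exists>Orb \<in> one_dim_orbits n. has_limit_points n Orb p q}"


section \<open>Binary necklaces\<close>

text \<open>$\mathbb{Z}/d\mathbb{Z}$ is represented by \<open>{..<d}\<close> with addition modulo \<open>d\<close>.\<close>

definition rotate_beads :: "nat \<Rightarrow> nat \<Rightarrow> nat set \<Rightarrow> nat set" where
  "rotate_beads d r A = (\<lambda>a. (a + r) mod d) ` A"

definition bead_sets :: "nat \<Rightarrow> nat \<Rightarrow> nat set set" where
  "bead_sets k d = {A. A \<subseteq> {..<d} \<and> card A = k}"

definition necklaces :: "nat \<Rightarrow> nat \<Rightarrow> nat set set set" where
  "necklaces k d = bead_sets k d //
     {(A, B). A \<in> bead_sets k d \<and> B \<in> bead_sets k d \<and> (\<exists>r<d. B = rotate_beads d r A)}"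

text \<open>
  A set \<open>A\<close> of black beads is a set of \<open>d\<close>-th roots of unity $\zeta^a$, i.e. a factor
  $f_A = \prod_{a \in A} (x - \zeta^a y)$ of $x^d - y^d$, where $\zeta = e^{2\pi i/d}$.  It gives the
  ideal $(f_A, x^d, y^d)$.  Rotating \<open>A\<close> amounts to rescaling \<open>y\<close> by a power of $\zeta$, so a
  necklace gives a torus orbit: the union below is over the sets \<open>A\<close> in one rotation class, all of
  which contribute the same orbit.
\<close>

definition bead_ideal :: "nat \<Rightarrow> nat set \<Rightarrow> cxy set" where
  "bead_ideal d A =
     ideal_gen {\<Prod>a\<in>A. (varX - Const (cis (2 * pi * real a / real d)) * varY), varX ^ d, varY ^ d}"

definition necklace_orbit :: "nat \<Rightarrow> nat set set \<Rightarrow> cxy set set" where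
  "necklace_orbit d N = (\<Union>A\<in>N. torus_orbit (bead_ideal d A))"

end

theory Submission
  imports Defs "HOL-Computational_Algebra.Fundamental_Theorem_Algebra"
begin

text \<open>
  In the chart of a monomial basis, the torus scales the coordinate expressing a monomial \<open>m\<close> in terms
  of a basis monomial \<open>b\<close> by the character \<open>b / m\<close>.  An orbit whose dimension is 1 has all its weights on
  a line.  If its closure contains both corner ideals \<open>(x\<^sup>k, y\<^sup>d)\<close> and \<open>(x\<^sup>d, y\<^sup>k)\<close>, then both rectangles
  of standard monomials are bases for its points, and comparing the sums of their degrees shows that
  this line is the antidiagonal: the ideals in the orbit are homogeneous.  The position of the limit
  points then forces \<open>x\<^sup>d\<close> and \<open>y\<^sup>d\<close> into the ideal, together with a form \<open>f\<close> of degree \<open>k\<close> that involves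
  both \<open>x\<^sup>k\<close> and \<open>y\<^sup>k\<close>, and division with remainder shows that \<open>f\<close> divides \<open>x\<^sup>d - c y\<^sup>d\<close> for some
  \<open>c \<noteq> 0\<close>.  After rescaling, \<open>f\<close> is the product of \<open>k\<close> of the \<open>d\<close> linear factors of \<open>x\<^sup>d - y\<^sup>d\<close>.
  Conversely, the orbit of such an ideal is a curve, whose boundary consists of the initial ideals for
  the two orders of the variables.
\<close>

section \<open>Monomials\<close>

text \<open>The topology is given by generators, so closures and irreducibility have to be tested on
  principal opens of charts. Everything is therefore pulled back to one complex parameter: along a
  rational curve every chart function is a rational function of the parameter, and the preimage of
  an open set is empty or cofinite. This yields irreducibility of orbits, the dimension bounds and
  the limit points. In the other direction, a point of the closure is constrained by the equations
  between chart functions that hold on the orbit, so boundary points are found by evaluating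
  products of coordinates there. The antidiagonal comes from a count: for weights (\<alpha>,
  \<beta>) the degree sums of the two rectangles differ by \<alpha> - \<beta> times a number that is
  nonzero because k \<noteq> d. Forms of degree k become one-variable polynomials on setting y = 1.
  Then c \<noteq> 0 because f has a nonzero coefficient at y^k, and the d distinct roots of z^d = c
  leave no room for a repeated factor of f.\<close>

definition mon :: "nat \<Rightarrow> nat \<Rightarrow> cxy" where
  "mon i j = varX ^ i * varY ^ j"

lemma varX_power: "varX ^ i = [:monom 1 i:]"
  by (induction i) (simp_all add: varX_def monom_Suc one_pCons)

lemma varY_power: "varY ^ j = monom 1 j"
proof -
  have "varY = monom 1 1"
    by (simp add: varY_def monom_Suc monom_0)
  then show ?thesis
    using monom_power[of "1 :: complex poly" 1 j] by (metis mult_1 power_one)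
qed

lemma mon_eq: "mon i j = monom (monom 1 i) j"
  by (simp add: mon_def varX_power varY_power smult_monom)

lemma coeff_mon: "coeff (coeff (mon i j) b) a = (if a = i \<and> b = j then 1 else 0)"
  by (simp add: mon_eq)

lemma mon_eq_iff [simp]: "mon i j = mon i' j' \<longleftrightarrow> i = i' \<and> j = j'"
  by (metis coeff_mon zero_neq_one)

lemma mon_mult: "mon i j * mon i' j' = mon (i + i') (j + j')"
  by (simp add: mon_def power_add)

lemma mon_0_0 [simp]: "mon 0 0 = 1"
  by (simp add: mon_def)

lemma monomials_eq: "monomials = {mon i j | i j. True}"
  by (simp add: monomials_def mon_def)

lemma mon_in_monomials [simp]: "mon i j \<in> monomials"
  by (auto simp: monomials_eq)

text \<open>Bases are sets of polynomials, so the exponents of their members must be read back.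
  Meaningful on monomials only, where \<open>mon_xdeg_ydeg\<close> recovers the monomial.\<close>

definition xdeg :: "cxy \<Rightarrow> nat" where "xdeg b = degree (lead_coeff b)"

definition ydeg :: "cxy \<Rightarrow> nat" where "ydeg b = degree b"

lemma xdeg_mon [simp]: "xdeg (mon i j) = i" and ydeg_mon [simp]: "ydeg (mon i j) = j"
  by (simp_all add: xdeg_def ydeg_def mon_eq degree_monom_eq)

lemma mon_xdeg_ydeg: "m \<in> monomials \<Longrightarrow> mon (xdeg m) (ydeg m) = m"
  by (auto simp: monomials_eq)

lemma Const_0 [simp]: "Const 0 = 0"
  and Const_1 [simp]: "Const 1 = 1"
  and Const_add: "Const (a + b) = Const a + Const b"
  and Const_mult: "Const (a * b) = Const a * Const b"
  and Const_minus: "Const (- a) = - Const a"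
  and Const_diff: "Const (a - b) = Const a - Const b"
  by (simp_all add: Const_def one_pCons)

lemma coeff_Const_mult: "coeff (coeff (Const c * f) j) i = c * coeff (coeff f j) i"
  by (simp add: Const_def)

lemma cxy_eqI: "(\<And>i j. coeff (coeff f j) i = coeff (coeff g j) i) \<Longrightarrow> f = (g :: cxy)"
  by (intro poly_eqI) auto

text \<open>Coordinates, normal forms and scalings are additive and commute with constants, so
  claims about them need checking only on scaled monomials.\<close>

lemma cxy_induct [case_names mon add]:
  assumes m: "\<And>c i j. P (Const c * mon i j)" and a: "\<And>f g. P f \<Longrightarrow> P g \<Longrightarrow> P (f + g)"
  shows "P f"
proof -
  have P0: "P 0"
    using m[of 0] by simp
  have sum: "P (sum h A)" if "finite A" "\<And>x. x \<in> A \<Longrightarrow> P (h x)" for h and A :: "nat set"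
    using that by (induction A) (auto intro: a P0)
  have "P (monom p j)" for p j
  proof -
    have "monom p j = (\<Sum>i\<le>degree p. Const (coeff p i) * mon i j)"
      by (intro cxy_eqI) (simp add: coeff_sum coeff_Const_mult coeff_mon if_distrib cong: if_cong,
        auto simp: coeff_eq_0 sum.delta' intro!: sum.neutral)
    then show ?thesis
      using sum m by simp
  qed
  then have "P (\<Sum>j\<le>degree f. monom (coeff f j) j)"
    by (intro sum) auto
  then show ?thesis
    by (simp add: poly_as_sum_of_monoms)
qed

text \<open>The binary form y^n p(x/y). Coefficients of p above n are dropped, which is why
  multiplicativity needs degree bounds. Forms are handled through p, where roots and division with
  remainder are available.\<close>

definition hom_poly :: "nat \<Rightarrow> complex poly \<Rightarrow> cxy" where
  "hom_poly n p = (\<Sum>i\<le>n. Const (coeff p i) * mon i (n - i))"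

lemma coeff_hom_poly: "coeff (coeff (hom_poly n p) j) i = (if i + j = n then coeff p i else 0)"
proof -
  have "coeff (coeff (hom_poly n p) j) i = (\<Sum>l\<le>n. coeff p l * (if i = l \<and> j = n - l then 1 else 0))"
    by (simp add: hom_poly_def coeff_sum coeff_Const_mult coeff_mon)
  also have "\<dots> = (\<Sum>l\<le>n. if l = i then (if i + j = n then coeff p i else 0) else 0)"
    by (intro sum.cong) auto
  finally show ?thesis
    by (auto simp: sum.delta)
qed

lemma hom_poly_diff: "hom_poly n (p - q) = hom_poly n p - hom_poly n q"
  by (intro cxy_eqI) (auto simp: coeff_hom_poly)

lemma hom_poly_sum: "hom_poly n (sum h A) = (\<Sum>a\<in>A. hom_poly n (h a))"
  by (intro cxy_eqI) (auto simp: coeff_hom_poly coeff_sum)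

lemma hom_poly_monom: "i \<le> n \<Longrightarrow> hom_poly n (monom c i) = Const c * mon i (n - i)"
  by (intro cxy_eqI) (auto simp: coeff_hom_poly coeff_Const_mult coeff_mon)

lemma hom_poly_mult:
  assumes p: "degree p \<le> n" and q: "degree q \<le> m"
  shows "hom_poly (n + m) (p * q) = hom_poly n p * hom_poly m q"
proof -
  have "p * q = (\<Sum>i\<le>n. monom (coeff p i) i) * (\<Sum>j\<le>m. monom (coeff q j) j)"
    using p q by (simp add: poly_as_sum_of_monoms')
  also have "\<dots> = (\<Sum>i\<le>n. \<Sum>j\<le>m. monom (coeff p i * coeff q j) (i + j))"
    by (simp add: sum_product mult_monom)
  finally have "hom_poly (n + m) (p * q) =
      (\<Sum>i\<le>n. \<Sum>j\<le>m. hom_poly (n + m) (monom (coeff p i * coeff q j) (i + j)))"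
    by (simp add: hom_poly_sum)
  also have "\<dots> = (\<Sum>i\<le>n. \<Sum>j\<le>m. (Const (coeff p i) * mon i (n - i)) * (Const (coeff q j) * mon j (m - j)))"
  proof (intro sum.cong refl)
    fix i j assume "i \<in> {..n}" "j \<in> {..m}"
    then have "hom_poly (n + m) (monom (coeff p i * coeff q j) (i + j)) =
        Const (coeff p i * coeff q j) * mon (i + j) ((n - i) + (m - j))"
      by (subst hom_poly_monom) auto
    then show "hom_poly (n + m) (monom (coeff p i * coeff q j) (i + j)) =
        (Const (coeff p i) * mon i (n - i)) * (Const (coeff q j) * mon j (m - j))"
      by (simp add: mon_mult[symmetric] Const_mult mult_ac)
  qed
  finally show ?thesis
    by (simp add: hom_poly_def sum_product)
qed

lemma degree_linear_prod: "degree (\<Prod>r\<in>R. [:- r, 1:] :: complex poly) = card R"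
  by (cases "finite R") (simp_all add: degree_prod_sum_eq)

lemma lead_coeff_linear_prod: "coeff (\<Prod>r\<in>R. [:- r, 1:] :: complex poly) (card R) = 1"
proof -
  have "lead_coeff (\<Prod>r\<in>R. [:- r, 1:] :: complex poly) = 1"
    by (simp add: lead_coeff_prod)
  then show ?thesis
    by (simp add: degree_linear_prod)
qed

lemma coeff_0_linear_prod: "0 \<notin> R \<Longrightarrow> finite R \<Longrightarrow> coeff (\<Prod>r\<in>R. [:- r, 1:] :: complex poly) 0 \<noteq> 0"
  by (auto simp flip: poly_0_coeff_0 simp: poly_prod)

lemma poly_linear_prod_0: "finite R \<Longrightarrow> poly (\<Prod>r\<in>R. [:- r, 1:]) z = 0 \<longleftrightarrow> (z :: complex) \<in> R"
  by (auto simp: poly_prod)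

lemma hom_poly_linear_prod:
  assumes "finite R"
  shows "(\<Prod>r\<in>R. varX - Const r * varY) = hom_poly (card R) (\<Prod>r\<in>R. [:- r, 1:])"
  using assms
proof (induction R)
  case empty
  then show ?case
    by (simp add: hom_poly_def)
next
  case (insert r R)
  have "hom_poly 1 [:- r, 1:] = varX - Const r * varY"
    by (simp add: hom_poly_def mon_def Const_minus)
  moreover have "hom_poly (1 + card R) ([:- r, 1:] * (\<Prod>r\<in>R. [:- r, 1:])) =
      hom_poly 1 [:- r, 1:] * hom_poly (card R) (\<Prod>r\<in>R. [:- r, 1:])"
    by (rule hom_poly_mult) (simp_all add: degree_linear_prod)
  ultimately show ?case
    using insert by simp
qed

section \<open>Ideals and bases of quotients\<close>

lemma is_ideal_iff:
  "is_ideal I \<longleftrightarrow> 0 \<in> I \<and> (\<forall>x\<in>I. \<forall>y\<in>I. x + y \<in> I) \<and> (\<forall>c. \<forall>x\<in>I. c * x \<in> I)"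
  by (rule module.subspace_def[OF module_mult])

lemma ideal_0: "is_ideal I \<Longrightarrow> 0 \<in> I"
  and ideal_add: "is_ideal I \<Longrightarrow> x \<in> I \<Longrightarrow> y \<in> I \<Longrightarrow> x + y \<in> I"
  and ideal_mult: "is_ideal I \<Longrightarrow> x \<in> I \<Longrightarrow> c * x \<in> I"
  by (auto simp: is_ideal_iff)

lemma ideal_uminus: "is_ideal I \<Longrightarrow> x \<in> I \<Longrightarrow> - x \<in> I" for x :: "'a::comm_ring_1"
  using ideal_mult[of I x "-1"] by simp

lemma ideal_diff: "is_ideal I \<Longrightarrow> x \<in> I \<Longrightarrow> y \<in> I \<Longrightarrow> x - y \<in> I" for x :: "'a::comm_ring_1"
  using ideal_add[of I x "- y"] ideal_uminus[of I y] by simp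

lemma is_ideal_ideal_gen: "is_ideal (ideal_gen S)"
  by (rule module.subspace_span[OF module_mult])

lemma ideal_gen_superset: "x \<in> S \<Longrightarrow> x \<in> ideal_gen S"
  by (rule module.span_base[OF module_mult])

lemma ideal_gen_minimal: "S \<subseteq> I \<Longrightarrow> is_ideal I \<Longrightarrow> ideal_gen S \<subseteq> I"
  by (rule module.span_minimal[OF module_mult])

lemma ideal_gen_2:
  assumes "h \<in> ideal_gen {f, g}"
  obtains a b where "h = a * f + b * g"
proof -
  have "h \<in> {h. \<exists>k. h - k * f \<in> ideal_gen {g}}"
    using assms by (simp add: module.span_insert[OF module_mult])
  then obtain a where "h - a * f \<in> ideal_gen {g}"
    by blast
  then obtain b where "h - a * f = b * g"
    by (auto simp: module.span_singleton[OF module_mult])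
  then have "h = a * f + b * g"
    by (simp add: algebra_simps)
  then show thesis
    by (rule that)
qed

section \<open>Expansions modulo an ideal\<close>

definition lin :: "cxy set \<Rightarrow> (cxy \<Rightarrow> complex) \<Rightarrow> cxy" where
  "lin B c = (\<Sum>b\<in>B. Const (c b) * b)"

lemma lin_add: "lin B (\<lambda>b. c b + c' b) = lin B c + lin B c'"
  by (simp add: lin_def Const_add algebra_simps sum.distrib)

lemma lin_diff: "lin B (\<lambda>b. c b - c' b) = lin B c - lin B c'"
  by (simp add: lin_def Const_diff algebra_simps sum_subtractf)

lemma lin_scale: "lin B (\<lambda>b. a * c b) = Const a * lin B c"
  by (simp add: lin_def Const_mult sum_distrib_left mult_ac)

lemma lin_single: "finite B \<Longrightarrow> b \<in> B \<Longrightarrow> lin B (\<lambda>b'. if b' = b then a else 0) = Const a * b"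
  unfolding lin_def by (subst sum.mono_neutral_right[of B "{b}"]) auto

lemma represents_iff: "represents B I f c \<longleftrightarrow> (\<forall>b. b \<notin> B \<longrightarrow> c b = 0) \<and> f - lin B c \<in> I"
  by (simp add: represents_def lin_def)

lemma representsI: "(\<And>b. b \<notin> B \<Longrightarrow> c b = 0) \<Longrightarrow> f - lin B c \<in> I \<Longrightarrow> represents B I f c"
  by (simp add: represents_iff)

lemma represents_add:
  assumes "is_ideal I" "represents B I f c" "represents B I g c'"
  shows "represents B I (f + g) (\<lambda>b. c b + c' b)"
  using assms ideal_add[of I "f - lin B c" "g - lin B c'"]
  by (auto simp: represents_iff lin_add algebra_simps)

lemma represents_scale:
  assumes "is_ideal I" "represents B I f c"
  shows "represents B I (Const a * f) (\<lambda>b. a * c b)"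
  using assms ideal_mult[of I "f - lin B c" "Const a"]
  by (auto simp: represents_iff lin_scale algebra_simps)

text \<open>Having an expansion is closed under linear combinations, so existence on monomials
  suffices. Two expansions differ by a combination lying in \<open>I\<close>, so independence gives
  uniqueness.\<close>

lemma basis_modI:
  assumes I: "is_ideal I" and fin: "finite B"
    and ex: "\<And>i j. \<exists>c. represents B I (mon i j) c"
    and ind: "\<And>c. lin B c \<in> I \<Longrightarrow> \<forall>b\<in>B. c b = 0"
  shows "basis_mod B I"
  unfolding basis_mod_def
proof (intro conjI allI ex_ex1I)
  fix f
  show "\<exists>c. represents B I f c"
  proof (induction f rule: cxy_induct)
    case (mon c i j)
    then show ?case
      using ex[of i j] represents_scale[OF I] by blast
  next
    case (add f g)
    then show ?case
      using represents_add[OF I] by blast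
  qed
next
  fix f c c' assume c: "represents B I f c" and c': "represents B I f c'"
  have "lin B (\<lambda>b. c b - c' b) = (f - lin B c') - (f - lin B c)"
    by (simp add: lin_diff)
  also have "\<dots> \<in> I"
    using c c' ideal_diff[OF I, of "f - lin B c'" "f - lin B c"] by (auto simp: represents_iff)
  finally have "\<forall>b\<in>B. c b = c' b"
    using ind[of "\<lambda>b. c b - c' b"] by simp
  then show "c = c'"
    using c c' by (metis represents_iff ext)
qed (rule fin)

lemma basis_mod_finite: "basis_mod B I \<Longrightarrow> finite B"
  by (simp add: basis_mod_def)

lemma represents_coord:
  assumes "basis_mod B I"
  shows "represents B I f (\<lambda>b. coord B f b I)"
proof -
  have "represents B I f (THE c. represents B I f c)"
    using assms by (intro theI'[of "represents B I f"]) (simp add: basis_mod_def)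
  then show ?thesis
    by (simp add: coord_def)
qed

lemma coord_eqI: "basis_mod B I \<Longrightarrow> represents B I f c \<Longrightarrow> coord B f b I = c b"
  using represents_coord[of B I f] by (auto simp: basis_mod_def)

lemma coord_notin: "basis_mod B I \<Longrightarrow> b \<notin> B \<Longrightarrow> coord B f b I = 0"
  using represents_coord[of B I f] by (simp add: represents_iff)

lemma coord_mem: "basis_mod B I \<Longrightarrow> f - lin B (\<lambda>b. coord B f b I) \<in> I"
  using represents_coord[of B I f] by (simp add: represents_iff)

lemma coord_add:
  "basis_mod B I \<Longrightarrow> is_ideal I \<Longrightarrow> coord B (f + g) b I = coord B f b I + coord B g b I"
  by (subst coord_eqI[OF _ represents_add[OF _ represents_coord represents_coord]]) auto

lemma coord_scale:
  "basis_mod B I \<Longrightarrow> is_ideal I \<Longrightarrow> coord B (Const a * f) b I = a * coord B f b I"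
  by (subst coord_eqI[OF _ represents_scale[OF _ represents_coord]]) auto

lemma coord_basis:
  assumes "basis_mod B I" "is_ideal I" "b \<in> B"
  shows "coord B b b' I = (if b' = b then 1 else 0)"
proof (rule coord_eqI[OF assms(1)])
  show "represents B I b (\<lambda>b'. if b' = b then 1 else 0)"
    using assms basis_mod_finite[OF assms(1)]
    by (intro representsI) (auto simp: lin_single ideal_0)
qed

lemma coord_0_iff:
  assumes "basis_mod B I" "is_ideal I"
  shows "f \<in> I \<longleftrightarrow> (\<forall>b. coord B f b I = 0)"
proof
  assume "f \<in> I"
  then have "represents B I f (\<lambda>b. 0)"
    by (intro representsI) (auto simp: lin_def)
  then show "\<forall>b. coord B f b I = 0"
    using coord_eqI[OF assms(1)] by metis
next
  assume "\<forall>b. coord B f b I = 0"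
  then show "f \<in> I"
    using coord_mem[OF assms(1), of f] by (simp add: lin_def)
qed

lemma basis_mod_independent:
  assumes "basis_mod B I" "lin B c \<in> I" "b \<in> B" "is_ideal I"
  shows "c b = 0"
proof -
  \<comment> \<open>\<open>c\<close> is arbitrary off \<open>B\<close>, while
    \<open>represents\<close> demands zero there, so it is cut off before uniqueness is
    applied.\<close>
  have "represents B I 0 (\<lambda>b. if b \<in> B then c b else 0)"
  proof (rule representsI)
    have "lin B (\<lambda>b. if b \<in> B then c b else 0) = lin B c"
      by (simp add: lin_def)
    then show "0 - lin B (\<lambda>b. if b \<in> B then c b else 0) \<in> I"
      using assms ideal_uminus by simp
  qed simp
  moreover have "represents B I 0 (\<lambda>b. 0)"
    using assms by (intro representsI) (auto simp: lin_def ideal_0)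
  ultimately have "(\<lambda>b. if b \<in> B then c b else 0) = (\<lambda>b. 0)"
    using assms(1) unfolding basis_mod_def by blast
  then show ?thesis
    using assms(3) by meson
qed

lemma basis_mod_notin: "basis_mod B I \<Longrightarrow> is_ideal I \<Longrightarrow> b \<in> B \<Longrightarrow> b \<notin> I"
  using coord_0_iff coord_basis by (metis zero_neq_one)

text \<open>Chart coordinates separate points: \<open>coord\<close> is linear in the polynomial, and
  the ideal consists of the polynomials all of whose coordinates vanish.\<close>

lemma basis_mod_ideal_eq:
  assumes B: "basis_mod B I" "basis_mod B J" and I: "is_ideal I" "is_ideal J"
    and eq: "\<And>i j b. b \<in> B \<Longrightarrow> coord B (mon i j) b I = coord B (mon i j) b J"
  shows "I = J"
proof -
  have "coord B f b I = coord B f b J" if "b \<in> B" for f b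
    using that by (induction f rule: cxy_induct) (auto simp: coord_scale coord_add B I eq)
  then have "coord B f b I = coord B f b J" for f b
    using coord_notin B by metis
  then show ?thesis
    by (intro set_eqI) (simp add: coord_0_iff[OF B(1) I(1)] coord_0_iff[OF B(2) I(2)])
qed

text \<open>Ideals of equal colength cannot be properly nested: an expansion modulo \<open>I\<close>
  is also one modulo \<open>J\<close>, so uniqueness identifies the coordinates.\<close>

lemma basis_mod_subset_eq:
  assumes B: "basis_mod B I" "basis_mod B J" and I: "is_ideal I" "is_ideal J" and sub: "I \<subseteq> J"
  shows "I = J"
proof -
  have "coord B f b J = coord B f b I" for f b
    using represents_coord[OF B(1), of f] sub
    by (intro coord_eqI[OF B(2)]) (auto simp: represents_iff)
  then show ?thesis
    by (intro set_eqI) (simp add: coord_0_iff[OF B(1) I(1)] coord_0_iff[OF B(2) I(2)])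
qed

section \<open>Dimension counts in a quotient\<close>

interpretation cx: vector_space "\<lambda>(c::complex) (f::cxy). Const c * f"
  by unfold_locales (simp_all add: Const_add Const_mult algebra_simps)

lemma lin_in_span: "B' \<subseteq> B \<Longrightarrow> finite B \<Longrightarrow> (\<And>b. b \<in> B - B' \<Longrightarrow> c b = 0) \<Longrightarrow> lin B c \<in> cx.span B'"
  unfolding lin_def
  by (subst sum.mono_neutral_right[of B B']) (auto intro!: cx.span_sum intro: cx.span_scale cx.span_base)

text \<open>When \<open>B\<close> is a basis modulo \<open>I\<close>, this is the linear projection
  onto the span of \<open>B\<close> with kernel \<open>I\<close>. It stands in for the class in the
  quotient, so that span and independence can be used inside C[x,y] itself.\<close>

definition nf :: "cxy set \<Rightarrow> cxy set \<Rightarrow> cxy \<Rightarrow> cxy" where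
  "nf B I f = lin B (\<lambda>b. coord B f b I)"

lemma nf_add: "basis_mod B I \<Longrightarrow> is_ideal I \<Longrightarrow> nf B I (f + g) = nf B I f + nf B I g"
  by (simp add: nf_def coord_add lin_add)

lemma nf_scale: "basis_mod B I \<Longrightarrow> is_ideal I \<Longrightarrow> nf B I (Const a * f) = Const a * nf B I f"
  by (simp add: nf_def coord_scale lin_scale)

lemma nf_lin:
  assumes "basis_mod B I" "is_ideal I" "finite B'"
  shows "nf B I (lin B' c) = (\<Sum>b\<in>B'. Const (c b) * nf B I b)"
  unfolding lin_def using assms(3)
proof (induction B')
  case empty
  then show ?case
    using nf_scale[OF assms(1,2), of 0 0] by simp
qed (simp_all add: nf_add nf_scale assms)

lemma nf_eq_0:
  assumes "basis_mod B I" "is_ideal I" "nf B I f = 0"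
  shows "f \<in> I"
  using coord_mem[OF assms(1), of f] assms(3) by (simp add: nf_def)

lemma nf_mem: "basis_mod B I \<Longrightarrow> is_ideal I \<Longrightarrow> f \<in> I \<Longrightarrow> nf B I f = 0"
  by (simp add: nf_def lin_def coord_0_iff)

lemma nf_basis: "basis_mod B I \<Longrightarrow> is_ideal I \<Longrightarrow> b \<in> B \<Longrightarrow> nf B I b = b"
  by (simp add: nf_def coord_basis lin_single basis_mod_finite)

lemma basis_independent:
  assumes "basis_mod B I" "is_ideal I"
  shows "cx.independent B"
proof
  assume "cx.dependent B"
  then obtain u v where "v \<in> B" "u v \<noteq> 0" "(\<Sum>v\<in>B. Const (u v) * v) = 0"
    by (auto simp: cx.dependent_finite basis_mod_finite[OF assms(1)])
  then show False
    using basis_mod_independent[OF assms(1), of u v] assms(2) by (simp add: lin_def ideal_0)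
qed

text \<open>Normal forms preserve \<delta>, so the part of \<open>B'\<close> in degree n is mapped
  into the span of the part of \<open>B\<close> in degree n. The images stay distinct and
  independent because \<open>B'\<close> is independent modulo \<open>I\<close>.\<close>

lemma graded_card_le:
  fixes \<delta> :: "cxy \<Rightarrow> int"
  assumes B: "basis_mod B I" and B': "basis_mod B' I" and I: "is_ideal I"
    and \<delta>: "\<And>b b'. b \<in> B \<Longrightarrow> b' \<in> B' \<Longrightarrow> coord B b' b I \<noteq> 0 \<Longrightarrow> \<delta> b = \<delta> b'"
  shows "card {b'\<in>B'. \<delta> b' = n} \<le> card {b\<in>B. \<delta> b = n}"
proof -
  define S where "S = {b'\<in>B'. \<delta> b' = n}"
  have fin: "finite S" "finite B" "finite B'"
    using basis_mod_finite[OF B'] basis_mod_finite[OF B] by (auto simp: S_def)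
  have zero: "\<forall>b\<in>S. u b = 0" if "(\<Sum>b\<in>S. Const (u b) * nf B I b) = 0" for u
  proof
    fix b assume b: "b \<in> S"
    have "nf B I (lin S u) = 0"
      using that by (simp add: nf_lin B I fin)
    then have "lin S u \<in> I"
      using nf_eq_0 B I by blast
    moreover have "lin S u = lin B' (\<lambda>b. if b \<in> S then u b else 0)"
      unfolding lin_def using fin by (intro sum.mono_neutral_cong_left) (auto simp: S_def)
    ultimately show "u b = 0"
      using basis_mod_independent[OF B', of "\<lambda>b. if b \<in> S then u b else 0" b] b I
      by (auto simp: S_def)
  qed
  have inj: "inj_on (nf B I) S"
  proof (rule inj_onI, rule ccontr)
    fix a b assume ab: "a \<in> S" "b \<in> S" "nf B I a = nf B I b" "a \<noteq> b"
    \<comment> \<open>Equal normal forms of a and b amount to a relation with coefficients 1 and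
      -1.\<close>
    have "(\<Sum>s\<in>S. Const (if s = a then 1 else if s = b then - 1 else 0) * nf B I s) =
        (\<Sum>s\<in>{a, b}. Const (if s = a then 1 else if s = b then - 1 else 0) * nf B I s)"
      using ab fin by (intro sum.mono_neutral_right) auto
    also have "\<dots> = 0"
      using ab by (simp add: Const_minus)
    finally show False
      using zero[of "\<lambda>s. if s = a then 1 else if s = b then - 1 else 0"] ab by auto
  qed
  have "cx.independent (nf B I ` S)"
  proof
    assume "cx.dependent (nf B I ` S)"
    then obtain u v where v: "v \<in> nf B I ` S" "u v \<noteq> 0" "(\<Sum>v\<in>nf B I ` S. Const (u v) * v) = 0"
      using fin by (auto simp: cx.dependent_finite)
    from v(3) have "(\<Sum>b\<in>S. Const (u (nf B I b)) * nf B I b) = 0"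
      by (simp add: sum.reindex[OF inj])
    then show False
      using zero[of "\<lambda>b. u (nf B I b)"] v by auto
  qed
  moreover have "nf B I ` S \<subseteq> cx.span {b\<in>B. \<delta> b = n}"
    unfolding nf_def by (auto intro!: lin_in_span simp: fin) (use \<delta> in \<open>force simp: S_def\<close>)
  ultimately have "card (nf B I ` S) \<le> card {b\<in>B. \<delta> b = n}"
    using cx.independent_span_bound[of "{b\<in>B. \<delta> b = n}" "nf B I ` S"] fin by simp
  then show ?thesis
    using card_image[OF inj] by (simp add: S_def)
qed

text \<open>The trivial grading puts everything into degree 0.\<close>

lemma basis_mod_card_eq:
  assumes "basis_mod B I" "basis_mod B' I" "is_ideal I"
  shows "card B = card B'"
  using graded_card_le[OF assms, of "\<lambda>b. 0" 0] graded_card_le[OF assms(2,1,3), of "\<lambda>b. 0" 0]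
  by simp

text \<open>The normal forms of a spanning set span \<open>B\<close>; with no more of them than
  \<open>card B\<close>, none may coincide or be redundant. This spares a direct independence proof
  for the second rectangle.\<close>

lemma basis_mod_spanning:
  assumes B: "basis_mod B I" and I: "is_ideal I" and fin: "finite B'" and card: "card B' \<le> card B"
    and span: "\<And>i j. \<exists>c. represents B' I (mon i j) c" and mons: "B \<subseteq> monomials"
  shows "basis_mod B' I"
proof (rule basis_modI[OF I fin span])
  fix u assume u: "lin B' u \<in> I"
  have sub: "B \<subseteq> cx.span (nf B I ` B')"
  proof
    fix b assume b: "b \<in> B"
    then obtain c where "represents B' I b c"
      using span[of "xdeg b" "ydeg b"] mon_xdeg_ydeg[of b] mons by auto
    then have "b - lin B' c \<in> I"
      by (simp add: represents_iff)
    then have "nf B I (b - lin B' c + lin B' c) = 0 + nf B I (lin B' c)"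
      by (subst nf_add) (auto simp: B I nf_mem)
    then have "b = nf B I (lin B' c)"
      using b by (simp add: nf_basis B I)
    also have "\<dots> \<in> cx.span (nf B I ` B')"
      unfolding nf_lin[OF B I fin] by (intro cx.span_sum cx.span_scale cx.span_base) auto
    finally show "b \<in> cx.span (nf B I ` B')" .
  qed
  have le: "card B \<le> card T" if "finite T" "B \<subseteq> cx.span T" for T
    using cx.independent_span_bound[OF that(1) basis_independent[OF B I] that(2)] by simp
  have "card (nf B I ` B') = card B'"
    using le[OF _ sub] card card_image_le[OF fin, of "nf B I"] fin by simp
  then have inj: "inj_on (nf B I) B'"
    by (simp add: eq_card_imp_inj_on fin)
  have "cx.independent (nf B I ` B')"
  proof
    assume "cx.dependent (nf B I ` B')"
    then obtain v where v: "v \<in> nf B I ` B'" "v \<in> cx.span (nf B I ` B' - {v})"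
      by (auto simp: cx.dependent_def)
    then have "cx.span (nf B I ` B' - {v}) = cx.span (nf B I ` B')"
      by (metis cx.span_redundant insert_Diff)
    then have "card B \<le> card (nf B I ` B' - {v})"
      using le sub fin by simp
    also have "\<dots> < card (nf B I ` B')"
      using v fin by (intro psubset_card_mono) auto
    also have "\<dots> \<le> card B"
      using card card_image_le[OF fin, of "nf B I"] by simp
    finally show False
      by simp
  qed
  moreover have "(\<Sum>v\<in>nf B I ` B'. Const (u (inv_into B' (nf B I) v)) * v) = nf B I (lin B' u)"
    by (simp add: sum.reindex[OF inj] inj nf_lin B I fin)
  ultimately have "\<forall>v\<in>nf B I ` B'. u (inv_into B' (nf B I) v) = 0"
    using u by (auto simp: nf_mem B I cx.dependent_finite fin)
  then show "\<forall>b\<in>B'. u b = 0"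
    by (simp add: inj)
qed

section \<open>The torus action\<close>

lemma coeff_scale_vars:
  "coeff (coeff (scale_vars s t f) j) i = s ^ i * t ^ j * coeff (coeff f j) i"
  by (simp add: scale_vars_def coeff_pcompose_linear coeff_map_poly poly_const_pow)

lemma scale_vars_add: "scale_vars s t (f + g) = scale_vars s t f + scale_vars s t g"
  by (intro cxy_eqI) (simp add: coeff_scale_vars algebra_simps)

lemma scale_vars_diff: "scale_vars s t (f - g) = scale_vars s t f - scale_vars s t g"
  by (intro cxy_eqI) (simp add: coeff_scale_vars algebra_simps)

lemma scale_vars_Const_mult: "scale_vars s t (Const c * f) = Const c * scale_vars s t f"
  by (intro cxy_eqI) (simp add: coeff_scale_vars coeff_Const_mult)

lemma scale_vars_mon: "scale_vars s t (mon i j) = Const (s ^ i * t ^ j) * mon i j"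
  by (intro cxy_eqI) (simp add: coeff_scale_vars coeff_Const_mult coeff_mon)

lemma scale_vars_0 [simp]: "scale_vars s t 0 = 0"
  by (intro cxy_eqI) (simp add: coeff_scale_vars)

lemma scale_vars_1 [simp]: "scale_vars s t 1 = 1"
  using scale_vars_mon[of s t 0 0] by simp

lemma Const_mon_mult:
  "(Const c * mon i j) * (Const c' * mon i' j') = Const (c * c') * mon (i + i') (j + j')"
  unfolding Const_mult mon_mult[symmetric] by (simp only: mult_ac)

lemma scale_vars_Const_mon: "scale_vars s t (Const c * mon i j) = Const (c * (s ^ i * t ^ j)) * mon i j"
  by (simp only: scale_vars_Const_mult scale_vars_mon Const_mult mult.assoc)

lemma scale_vars_mult: "scale_vars s t (f * g) = scale_vars s t f * scale_vars s t g"
proof (induction f rule: cxy_induct)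
  case (mon c i j)
  then show ?case
  proof (induction g rule: cxy_induct)
    case (mon c' i' j')
    show ?case
      unfolding scale_vars_Const_mon Const_mon_mult by (simp only: power_add mult_ac)
  qed (simp add: scale_vars_add distrib_left)
qed (simp add: scale_vars_add distrib_right)

lemma scale_vars_prod: "scale_vars s t (prod h A) = (\<Prod>a\<in>A. scale_vars s t (h a))"
  by (induction A rule: infinite_finite_induct) (simp_all add: scale_vars_mult)

lemma scale_vars_linear: "scale_vars s t (varX - Const r * varY) = Const s * varX - Const (r * t) * varY"
  using scale_vars_mon[of s t 1 0] scale_vars_mon[of s t 0 1]
  by (simp add: scale_vars_diff scale_vars_Const_mult mon_def Const_mult)

lemma scale_vars_scale_vars:
  "scale_vars s t (scale_vars s' t' f) = scale_vars (s * s') (t * t') f"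
  by (intro cxy_eqI) (simp add: coeff_scale_vars power_mult_distrib)

lemma scale_vars_1_1 [simp]: "scale_vars 1 1 f = f"
  by (intro cxy_eqI) (simp add: coeff_scale_vars)

lemma scale_vars_lin:
  assumes "B \<subseteq> monomials"
  shows "scale_vars s t (lin B c) = lin B (\<lambda>b. c b * (s ^ xdeg b * t ^ ydeg b))"
proof -
  have sum: "scale_vars s t (sum h A) = (\<Sum>a\<in>A. scale_vars s t (h a))" for h :: "cxy \<Rightarrow> cxy" and A
    by (induction A rule: infinite_finite_induct) (simp_all add: scale_vars_add)
  have "scale_vars s t (Const (c b) * b) = Const (c b * (s ^ xdeg b * t ^ ydeg b)) * b" if "b \<in> B" for b
    using scale_vars_Const_mon[of s t "c b" "xdeg b" "ydeg b"] mon_xdeg_ydeg[of b] that assms by auto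
  then show ?thesis
    by (simp add: lin_def sum)
qed

lemma torus_act_1_1 [simp]: "torus_act 1 1 I = I"
  by (simp add: torus_act_def)

lemma torus_act_torus_act: "torus_act s t (torus_act s' t' I) = torus_act (s * s') (t * t') I"
  by (simp add: torus_act_def image_image scale_vars_scale_vars)

lemma torus_act_mem_iff:
  assumes "s \<noteq> 0" "t \<noteq> 0"
  shows "scale_vars s t f \<in> torus_act s t I \<longleftrightarrow> f \<in> I"
proof
  assume "scale_vars s t f \<in> torus_act s t I"
  then obtain g where g: "g \<in> I" "scale_vars s t f = scale_vars s t g"
    by (auto simp: torus_act_def)
  have "scale_vars (1 / s) (1 / t) (scale_vars s t f') = f'" for f'
    using assms by (simp add: scale_vars_scale_vars)
  then show "f \<in> I"
    using g by metis
qed (simp add: torus_act_def)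

lemma scale_vars_inverse: "s \<noteq> 0 \<Longrightarrow> t \<noteq> 0 \<Longrightarrow> scale_vars s t (scale_vars (1 / s) (1 / t) f) = f"
  by (simp add: scale_vars_scale_vars)

lemma is_ideal_torus_act:
  assumes "is_ideal I" "s \<noteq> 0" "t \<noteq> 0"
  shows "is_ideal (torus_act s t I)"
  unfolding is_ideal_iff
proof (intro conjI ballI allI)
  show "0 \<in> torus_act s t I"
    using torus_act_mem_iff[OF assms(2,3), of 0 I] assms ideal_0 by simp
next
  fix x y assume "x \<in> torus_act s t I" "y \<in> torus_act s t I"
  then obtain f g where "f \<in> I" "x = scale_vars s t f" "g \<in> I" "y = scale_vars s t g"
    by (auto simp: torus_act_def)
  then show "x + y \<in> torus_act s t I"
    using torus_act_mem_iff[OF assms(2,3), of "f + g" I] ideal_add[OF assms(1)]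
    by (simp add: scale_vars_add)
next
  fix c x assume "x \<in> torus_act s t I"
  then obtain f where "f \<in> I" "x = scale_vars s t f"
    by (auto simp: torus_act_def)
  then show "c * x \<in> torus_act s t I"
    using torus_act_mem_iff[OF assms(2,3), of "scale_vars (1 / s) (1 / t) c * f" I] ideal_mult[OF assms(1)]
    by (simp add: scale_vars_mult scale_vars_inverse assms)
qed

lemma represents_torus_act:
  assumes "B \<subseteq> monomials" "represents B I f c"
  shows "represents B (torus_act s t I) (scale_vars s t f) (\<lambda>b. c b * (s ^ xdeg b * t ^ ydeg b))"
proof (rule representsI)
  have "scale_vars s t (f - lin B c) \<in> torus_act s t I"
    using assms by (simp add: torus_act_def represents_iff)
  then show "scale_vars s t f - lin B (\<lambda>b. c b * (s ^ xdeg b * t ^ ydeg b)) \<in> torus_act s t I"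
    by (simp add: scale_vars_diff scale_vars_lin assms)
qed (use assms in \<open>simp add: represents_iff\<close>)

lemma basis_mod_torus_act:
  assumes "B \<subseteq> monomials" "basis_mod B I" "is_ideal I" "s \<noteq> 0" "t \<noteq> 0"
  shows "basis_mod B (torus_act s t I)"
proof (rule basis_modI)
  fix i j
  show "\<exists>c. represents B (torus_act s t I) (mon i j) c"
    using represents_torus_act[OF assms(1) represents_coord[OF assms(2)], of s t "scale_vars (1 / s) (1 / t) (mon i j)"]
    by (auto simp: scale_vars_inverse assms)
next
  fix c assume c: "lin B c \<in> torus_act s t I"
  have "scale_vars s t (lin B (\<lambda>b. c b / (s ^ xdeg b * t ^ ydeg b))) = lin B c"
    using assms by (simp add: scale_vars_lin)
  then have "lin B (\<lambda>b. c b / (s ^ xdeg b * t ^ ydeg b)) \<in> I"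
    using c torus_act_mem_iff assms by metis
  then show "\<forall>b\<in>B. c b = 0"
    using basis_mod_independent[OF assms(2)] assms by fastforce
qed (use assms is_ideal_torus_act basis_mod_finite in auto)

lemma coord_torus_act:
  assumes "B \<subseteq> monomials" "basis_mod B I" "is_ideal I" "s \<noteq> 0" "t \<noteq> 0"
  shows "coord B (mon i j) b (torus_act s t I) =
    coord B (mon i j) b I * (s powi (int (xdeg b) - int i) * t powi (int (ydeg b) - int j))"
proof -
  \<comment> \<open>Unscale the monomial, so that it is the image of a polynomial whose coordinates
    modulo \<open>I\<close> are known. The factor 1 / (s^i t^j) is the source of the negative
    exponents.\<close>
  have "mon i j = scale_vars s t (Const (1 / (s ^ i * t ^ j)) * mon i j)"
    using assms by (simp add: scale_vars_Const_mult scale_vars_mon mult.assoc[symmetric] flip: Const_mult)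
  then have "coord B (mon i j) b (torus_act s t I) =
      coord B (scale_vars s t (Const (1 / (s ^ i * t ^ j)) * mon i j)) b (torus_act s t I)"
    by simp
  also have "\<dots> = coord B (Const (1 / (s ^ i * t ^ j)) * mon i j) b I * (s ^ xdeg b * t ^ ydeg b)"
    by (rule coord_eqI[OF basis_mod_torus_act[OF assms]
          represents_torus_act[OF assms(1) represents_coord[OF assms(2)]]])
  also have "\<dots> = 1 / (s ^ i * t ^ j) * coord B (mon i j) b I * (s ^ xdeg b * t ^ ydeg b)"
    by (simp only: coord_scale[OF assms(2,3)])
  also have "\<dots> = coord B (mon i j) b I * (s powi (int (xdeg b) - int i) * t powi (int (ydeg b) - int j))"
    using assms by (simp add: power_int_diff)
  finally show ?thesis .
qed

lemma Hilb_torus_act: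
  assumes "B \<subseteq> monomials" "basis_mod B I" "is_ideal I" "s \<noteq> 0" "t \<noteq> 0" "card B = n"
  shows "torus_act s t I \<in> Hilb n"
  using basis_mod_torus_act[OF assms(1-5)] is_ideal_torus_act[OF assms(3-5)] assms(6)
  by (auto simp: Hilb_def)

lemma torus_orbit_refl: "I \<in> torus_orbit I"
  unfolding torus_orbit_def using torus_act_1_1[of I] by (metis (mono_tags, lifting) mem_Collect_eq one_neq_zero)

lemma torus_orbitI: "s \<noteq> 0 \<Longrightarrow> t \<noteq> 0 \<Longrightarrow> torus_act s t I \<in> torus_orbit I"
  by (auto simp: torus_orbit_def)

lemma torus_orbit_torus_act:
  assumes "s \<noteq> 0" "t \<noteq> 0"
  shows "torus_orbit (torus_act s t I) = torus_orbit I"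
proof
  show "torus_orbit (torus_act s t I) \<subseteq> torus_orbit I"
    using assms by (auto simp: torus_orbit_def torus_act_torus_act)
      (metis mult_eq_0_iff)
  show "torus_orbit I \<subseteq> torus_orbit (torus_act s t I)"
  proof
    fix J assume "J \<in> torus_orbit I"
    then obtain s' t' where J: "J = torus_act s' t' I" "s' \<noteq> 0" "t' \<noteq> 0"
      by (auto simp: torus_orbit_def)
    then have "J = torus_act (s' / s) (t' / t) (torus_act s t I)"
      using assms by (simp add: torus_act_torus_act)
    then show "J \<in> torus_orbit (torus_act s t I)"
      using J assms by (metis divide_eq_0_iff torus_orbitI)
  qed
qed

section \<open>Rational curves in the Hilbert scheme\<close>

text \<open>One fixed quotient of polynomials must represent g on all of \<open>G\<close>, without
  poles there. Hence a function that is nonzero somewhere on \<open>G\<close> has only finitely many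
  zeros in \<open>G\<close>.\<close>

definition rat_on :: "complex set \<Rightarrow> (complex \<Rightarrow> complex) \<Rightarrow> bool" where
  "rat_on G g \<longleftrightarrow> (\<exists>P Q. \<forall>z\<in>G. poly Q z \<noteq> 0 \<and> g z = poly P z / poly Q z)"

lemma rat_onI: "(\<And>z. z \<in> G \<Longrightarrow> poly Q z \<noteq> 0) \<Longrightarrow> (\<And>z. z \<in> G \<Longrightarrow> g z = poly P z / poly Q z) \<Longrightarrow> rat_on G g"
  by (auto simp: rat_on_def)

lemma rat_on_cong: "(\<And>z. z \<in> G \<Longrightarrow> f z = g z) \<Longrightarrow> rat_on G f \<longleftrightarrow> rat_on G g"
  by (simp add: rat_on_def)

lemma rat_on_poly: "rat_on G (poly P)"
  by (rule rat_onI[of _ 1]) auto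

lemma rat_on_const: "rat_on G (\<lambda>z. a)"
  by (rule rat_onI[of _ 1 _ "[:a:]"]) auto

lemma rat_on_id: "rat_on G (\<lambda>z. z)"
  by (rule rat_onI[of _ 1 _ "[:0, 1:]"]) auto

lemma rat_on_add:
  assumes "rat_on G f" "rat_on G g"
  shows "rat_on G (\<lambda>z. f z + g z)"
proof -
  obtain P Q P' Q' where "\<forall>z\<in>G. poly Q z \<noteq> 0 \<and> f z = poly P z / poly Q z"
    "\<forall>z\<in>G. poly Q' z \<noteq> 0 \<and> g z = poly P' z / poly Q' z"
    using assms by (auto simp: rat_on_def)
  then show ?thesis
    by (intro rat_onI[of _ "Q * Q'" _ "P * Q' + P' * Q"]) (auto simp: field_simps)
qed

lemma rat_on_mult:
  assumes "rat_on G f" "rat_on G g"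
  shows "rat_on G (\<lambda>z. f z * g z)"
proof -
  obtain P Q P' Q' where "\<forall>z\<in>G. poly Q z \<noteq> 0 \<and> f z = poly P z / poly Q z"
    "\<forall>z\<in>G. poly Q' z \<noteq> 0 \<and> g z = poly P' z / poly Q' z"
    using assms by (auto simp: rat_on_def)
  then show ?thesis
    by (intro rat_onI[of _ "Q * Q'" _ "P * P'"]) auto
qed

lemma rat_on_inverse:
  assumes "rat_on G f" "\<And>z. z \<in> G \<Longrightarrow> f z \<noteq> 0"
  shows "rat_on G (\<lambda>z. inverse (f z))"
proof -
  obtain P Q where "\<forall>z\<in>G. poly Q z \<noteq> 0 \<and> f z = poly P z / poly Q z"
    using assms by (auto simp: rat_on_def)
  then show ?thesis
    using assms by (intro rat_onI[of _ P _ Q]) (force simp: field_simps)+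
qed

lemma rat_on_power: "rat_on G f \<Longrightarrow> rat_on G (\<lambda>z. f z ^ n)"
  by (induction n) (auto intro: rat_on_const rat_on_mult)

lemma rat_on_power_int: "rat_on G f \<Longrightarrow> (\<And>z. z \<in> G \<Longrightarrow> f z \<noteq> 0) \<Longrightarrow> rat_on G (\<lambda>z. f z powi n)"
  by (cases "n \<ge> 0") (auto simp: power_int_def intro!: rat_on_power rat_on_inverse)

lemma rat_on_finite_zeros:
  assumes "rat_on G g" "z0 \<in> G" "g z0 \<noteq> 0"
  shows "finite {z\<in>G. g z = 0}"
proof -
  obtain P Q where PQ: "\<forall>z\<in>G. poly Q z \<noteq> 0 \<and> g z = poly P z / poly Q z"
    using assms by (auto simp: rat_on_def)
  then have "P \<noteq> 0"
    using assms by force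
  then have "finite {z. poly P z = 0}"
    by (rule poly_roots_finite)
  then show ?thesis
    by (rule finite_subset[rotated]) (use PQ in auto)
qed

text \<open>Chart functions are polynomials in the coordinates, and coordinates are linear in the
  polynomial expanded, so rationality is inherited from the coordinates of monomials.\<close>

lemma rat_on_chart_function:
  assumes \<phi>: "\<phi> \<in> chart_functions B"
    and h: "\<And>z. z \<in> G \<Longrightarrow> basis_mod B (h z) \<and> is_ideal (h z)"
    and co: "\<And>i j b. b \<in> B \<Longrightarrow> rat_on G (\<lambda>z. coord B (mon i j) b (h z))"
  shows "rat_on G (\<lambda>z. \<phi> (h z))"
  using \<phi>
proof (induction rule: chart_functions.induct)
  case (coord b f)
  show ?case
  proof (induction f rule: cxy_induct)
    case (mon c i j)
    have "rat_on G (\<lambda>z. c * coord B (mon i j) b (h z))"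
      using co coord by (intro rat_on_mult rat_on_const)
    then show ?case
      by (subst rat_on_cong) (auto simp: coord_scale h)
  next
    case (add f g)
    then have "rat_on G (\<lambda>z. coord B f b (h z) + coord B g b (h z))"
      by (rule rat_on_add)
    then show ?case
      by (subst rat_on_cong) (auto simp: coord_add h)
  qed
qed (auto intro: rat_on_const rat_on_add rat_on_mult)

lemma rat_on_torus_act:
  assumes "\<phi> \<in> chart_functions B" "B \<subseteq> monomials" "basis_mod B I" "is_ideal I"
    and s: "rat_on G s" "\<And>z. z \<in> G \<Longrightarrow> s z \<noteq> 0" and t: "rat_on G t" "\<And>z. z \<in> G \<Longrightarrow> t z \<noteq> 0"
  shows "rat_on G (\<lambda>z. \<phi> (torus_act (s z) (t z) I))"
proof (rule rat_on_chart_function[OF assms(1)])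
  fix i j b
  have "rat_on G (\<lambda>z. coord B (mon i j) b I *
      (s z powi (int (xdeg b) - int i) * t z powi (int (ydeg b) - int j)))"
    by (intro rat_on_mult rat_on_const rat_on_power_int s t)
  then show "rat_on G (\<lambda>z. coord B (mon i j) b (torus_act (s z) (t z) I))"
    by (subst rat_on_cong) (auto simp: coord_torus_act assms)
qed (use assms basis_mod_torus_act is_ideal_torus_act in auto)

text \<open>Preimages of principal opens are empty or cofinite in \<open>G\<close>: continuity for
  the cofinite topology, stated on generators. Irreducibility and limit points are deduced from this
  property of parametrized curves.\<close>

definition rat_curve :: "nat \<Rightarrow> complex set \<Rightarrow> (complex \<Rightarrow> cxy set) \<Rightarrow> bool" where
  "rat_curve n G h \<longleftrightarrow> h ` G \<subseteq> Hilb n \<and>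
     (\<forall>B \<phi> z0. B \<subseteq> monomials \<longrightarrow> \<phi> \<in> chart_functions B \<longrightarrow> z0 \<in> G \<longrightarrow>
        basis_mod B (h z0) \<longrightarrow> \<phi> (h z0) \<noteq> 0 \<longrightarrow>
        finite {z\<in>G. \<not> (basis_mod B (h z) \<and> \<phi> (h z) \<noteq> 0)})"

text \<open>Having an empty or cofinite preimage passes from the generators to finite intersections
  and arbitrary unions.\<close>

lemma rat_curve_open:
  assumes h: "rat_curve n G h" and U: "openin (hilb_zariski n) U" and z0: "z0 \<in> G" "h z0 \<in> U"
  shows "finite {z\<in>G. h z \<notin> U}"
proof -
  have "generate_topology_on
     {{I \<in> Hilb n. basis_mod B I \<and> \<phi> I \<noteq> 0} | B \<phi>. B \<subseteq> monomials \<and> \<phi> \<in> chart_functions B} U"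
    using U by (simp add: hilb_zariski_def openin_topology_generated_by_iff)
  then have "\<forall>z0\<in>G. h z0 \<in> U \<longrightarrow> finite {z\<in>G. h z \<notin> U}"
  proof induction
    case (Int a b)
    show ?case
    proof (intro ballI impI)
      fix z0 assume "z0 \<in> G" "h z0 \<in> a \<inter> b"
      then have "finite ({z\<in>G. h z \<notin> a} \<union> {z\<in>G. h z \<notin> b})"
        using Int by blast
      then show "finite {z\<in>G. h z \<notin> a \<inter> b}"
        by (rule rev_finite_subset) auto
    qed
  next
    case (UN K)
    show ?case
    proof (intro ballI impI)
      fix z0 assume "z0 \<in> G" "h z0 \<in> \<Union>K"
      then obtain k where "k \<in> K" "h z0 \<in> k"
        by blast
      then have "finite {z\<in>G. h z \<notin> k}"
        using UN \<open>z0 \<in> G\<close> by blast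
      then show "finite {z\<in>G. h z \<notin> \<Union>K}"
        by (rule rev_finite_subset) (use \<open>k \<in> K\<close> in auto)
    qed
  next
    case (Basis V)
    then obtain B \<phi> where V: "V = {I \<in> Hilb n. basis_mod B I \<and> \<phi> I \<noteq> 0}"
      "B \<subseteq> monomials" "\<phi> \<in> chart_functions B"
      by blast
    show ?case
    proof (intro ballI impI)
      fix z0 assume "z0 \<in> G" "h z0 \<in> V"
      then have "finite {z\<in>G. \<not> (basis_mod B (h z) \<and> \<phi> (h z) \<noteq> 0)}"
        using h V by (simp add: rat_curve_def)
      then show "finite {z\<in>G. h z \<notin> V}"
        by (rule rev_finite_subset) (use h in \<open>auto simp: V rat_curve_def\<close>)
    qed
  qed auto
  then show ?thesis
    using z0 by blast
qed

text \<open>Charts are torus stable, since scaling multiplies basis monomials by nonzero constants.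
  An orbit thus lies inside a chart or misses it.\<close>

lemma basis_mod_torus_act_iff:
  assumes "B \<subseteq> monomials" "is_ideal I" "s \<noteq> 0" "t \<noteq> 0"
  shows "basis_mod B (torus_act s t I) \<longleftrightarrow> basis_mod B I"
proof
  assume "basis_mod B (torus_act s t I)"
  then have "basis_mod B (torus_act (1 / s) (1 / t) (torus_act s t I))"
    using assms is_ideal_torus_act by (intro basis_mod_torus_act[where I = "torus_act s t I"]) auto
  moreover have "torus_act (1 / s) (1 / t) (torus_act s t I) = I"
    using assms by (simp add: torus_act_torus_act)
  ultimately show "basis_mod B I"
    by simp
qed (use assms basis_mod_torus_act in auto)

text \<open>\<open>B0\<close> fixes the colength. A chart \<open>B\<close> containing one point of
  the curve contains all of them, and there a chart function is a rational function of the
  parameter.\<close>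

lemma rat_curve_torus:
  assumes I: "is_ideal I" and B0: "B0 \<subseteq> monomials" "basis_mod B0 I" "card B0 = n"
    and s: "rat_on G s" "\<And>z. z \<in> G \<Longrightarrow> s z \<noteq> 0" and t: "rat_on G t" "\<And>z. z \<in> G \<Longrightarrow> t z \<noteq> 0"
  shows "rat_curve n G (\<lambda>z. torus_act (s z) (t z) I)"
  unfolding rat_curve_def
proof (intro conjI allI impI)
  show "(\<lambda>z. torus_act (s z) (t z) I) ` G \<subseteq> Hilb n"
    using Hilb_torus_act[OF B0(1,2) I] B0 s t by auto
next
  fix B \<phi> z0 assume B: "B \<subseteq> monomials" "\<phi> \<in> chart_functions B" "z0 \<in> G"
    "basis_mod B (torus_act (s z0) (t z0) I)" "\<phi> (torus_act (s z0) (t z0) I) \<noteq> 0"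
  then have BI: "basis_mod B I"
    using basis_mod_torus_act_iff I s t by blast
  have "finite {z\<in>G. \<phi> (torus_act (s z) (t z) I) = 0}"
    using rat_on_torus_act[OF B(2,1) BI I s t] B(3,5)
    by (rule rat_on_finite_zeros)
  then show "finite {z\<in>G. \<not> (basis_mod B (torus_act (s z) (t z) I) \<and> \<phi> (torus_act (s z) (t z) I) \<noteq> 0)}"
    by (rule rev_finite_subset) (use B BI I s t basis_mod_torus_act in auto)
qed

section \<open>Principal opens and level sets of chart functions\<close>

lemma openin_chart:
  "B \<subseteq> monomials \<Longrightarrow> \<phi> \<in> chart_functions B \<Longrightarrow>
    openin (hilb_zariski n) {I \<in> Hilb n. basis_mod B I \<and> \<phi> I \<noteq> 0}"
  unfolding hilb_zariski_def by (rule topology_generated_by_Basis) blast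

text \<open>The topspace of a generated topology is the union of its generators, so membership has
  to come from an actual monomial basis.\<close>

lemma chart_subset_topspace:
  assumes "B \<subseteq> monomials" "basis_mod B I" "I \<in> Hilb n"
  shows "I \<in> topspace (hilb_zariski n)"
  using openin_subset[OF openin_chart[OF assms(1) chart_functions.const[of 1]]] assms by auto

text \<open>\<open>Orb\<close> lies in a single chart, so the complement of a level set is the trace
  of the principal open where \<phi> - a is nonzero.\<close>

lemma closedin_level:
  assumes B: "B \<subseteq> monomials" "\<phi> \<in> chart_functions B"
    and Orb: "\<And>J. J \<in> Orb \<Longrightarrow> basis_mod B J \<and> J \<in> Hilb n"
  shows "closedin (subtopology (hilb_zariski n) Orb) {J\<in>Orb. \<phi> J = a}"
proof -
  have "(\<lambda>J. \<phi> J + (- a)) \<in> chart_functions B"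
    using B by (intro chart_functions.intros)
  then have "openin (hilb_zariski n) {J \<in> Hilb n. basis_mod B J \<and> \<phi> J + (- a) \<noteq> 0}"
    by (intro openin_chart B)
  then have "openin (subtopology (hilb_zariski n) Orb) (Orb \<inter> {J \<in> Hilb n. basis_mod B J \<and> \<phi> J + (- a) \<noteq> 0})"
    by (rule openin_subtopology_Int2)
  moreover have "topspace (subtopology (hilb_zariski n) Orb) = Orb"
    using Orb chart_subset_topspace[OF B(1)] by (auto simp: topspace_subtopology)
  moreover have *: "Orb - (Orb \<inter> {J \<in> Hilb n. basis_mod B J \<and> \<phi> J + (- a) \<noteq> 0}) = {J\<in>Orb. \<phi> J = a}"
    using Orb by auto
  ultimately show ?thesis
    unfolding *[symmetric] by (intro closedin_diff) (auto simp: closedin_topspace intro: back_subst[of "closedin _", OF closedin_topspace])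
qed

section \<open>Irreducible subsets of orbits and their dimension\<close>

lemma rat_curve_closedin:
  assumes h: "rat_curve n G h" and X: "X = subtopology (hilb_zariski n) Orb"
    and hG: "h ` G \<subseteq> topspace X" and C: "closedin X C" and z0: "z0 \<in> G" "h z0 \<notin> C"
  shows "finite {z\<in>G. h z \<in> C}"
proof -
  obtain D where D: "closedin (hilb_zariski n) D" "C = D \<inter> Orb"
    using C by (auto simp: X closedin_subtopology)
  have "finite {z\<in>G. h z \<notin> topspace (hilb_zariski n) - D}"
    using rat_curve_open[OF h openin_diff[OF openin_topspace D(1)] z0(1)] z0 hG D
    by (auto simp: X topspace_subtopology)
  then show ?thesis
    by (rule rev_finite_subset) (use D in auto)
qed

text \<open>A closed set that misses one point of the curve contains its points for finitely many
  parameters only, and two such sets cannot cover the infinite \<open>G\<close>.\<close>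

lemma irreducible_closure_of_curve:
  assumes h: "rat_curve n G h" and hG: "h ` G \<subseteq> topspace X" and G: "infinite G"
    and X: "X = subtopology (hilb_zariski n) Orb"
  shows "irreducible_closed X (X closure_of (h ` G))"
  unfolding irreducible_closed_def
proof (intro conjI allI impI)
  show "X closure_of (h ` G) \<noteq> {}"
    using closure_of_subset[OF hG] G by auto
next
  fix C D assume CD: "closedin X C \<and> closedin X D \<and> X closure_of (h ` G) = C \<union> D"
  have sub: "h ` G \<subseteq> C \<union> D"
    using closure_of_subset[OF hG] CD by simp
  have "h ` G \<subseteq> C \<or> h ` G \<subseteq> D"
  proof (rule ccontr)
    assume "\<not> ?thesis"
    then obtain z1 z2 where "z1 \<in> G" "h z1 \<notin> C" "z2 \<in> G" "h z2 \<notin> D"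
      by auto
    then have "finite ({z\<in>G. h z \<in> C} \<union> {z\<in>G. h z \<in> D})"
      using rat_curve_closedin[OF h X hG] CD by auto
    moreover have "G \<subseteq> {z\<in>G. h z \<in> C} \<union> {z\<in>G. h z \<in> D}"
      using sub by auto
    ultimately show False
      using G finite_subset by blast
  qed
  then have "X closure_of (h ` G) \<subseteq> C \<or> X closure_of (h ` G) \<subseteq> D"
    using CD closure_of_minimal[of "h ` G" C X] closure_of_minimal[of "h ` G" D X] by blast
  then show "X closure_of (h ` G) = C \<or> X closure_of (h ` G) = D"
    using CD by auto
qed simp

text \<open>Two points of an orbit lie on the image of a line in the torus.\<close>

lemma irreducible_orbit:
  assumes I: "is_ideal I" and B: "B \<subseteq> monomials" "basis_mod B I" "card B = n"
    and X: "X = subtopology (hilb_zariski n) (torus_orbit I)"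
  shows "irreducible_closed X (torus_orbit I)" and "topspace X = torus_orbit I"
proof -
  have Hilb: "torus_act s t I \<in> Hilb n \<and> basis_mod B (torus_act s t I)" if "s \<noteq> 0" "t \<noteq> 0" for s t
    using that Hilb_torus_act basis_mod_torus_act B I by auto
  then show top: "topspace X = torus_orbit I"
    unfolding X topspace_subtopology
    using chart_subset_topspace[OF B(1)] by (auto simp: torus_orbit_def)
  show "irreducible_closed X (torus_orbit I)"
    unfolding irreducible_closed_def
  proof (intro conjI allI impI)
    show "closedin X (torus_orbit I)"
      using top closedin_topspace by metis
    show "torus_orbit I \<noteq> {}"
      using torus_orbit_refl by blast
  next
    fix C D assume CD: "closedin X C \<and> closedin X D \<and> torus_orbit I = C \<union> D"
    show "torus_orbit I = C \<or> torus_orbit I = D"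
    proof (rule ccontr)
      assume "\<not> ?thesis"
      then obtain J K where JK: "J \<in> torus_orbit I" "J \<notin> C" "K \<in> torus_orbit I" "K \<notin> D"
        using CD by auto
      then obtain s1 t1 s2 t2 where st: "J = torus_act s1 t1 I" "s1 \<noteq> 0" "t1 \<noteq> 0"
        "K = torus_act s2 t2 I" "s2 \<noteq> 0" "t2 \<noteq> 0"
        by (auto simp: torus_orbit_def)
      define s where "s = poly [:s1, s2 - s1:]"
      define t where "t = poly [:t1, t2 - t1:]"
      define G where "G = {z. s z \<noteq> 0 \<and> t z \<noteq> 0}"
      \<comment> \<open>The line leaves the torus for finitely many parameters only: both linear
        polynomials have nonzero constant terms.\<close>
      have "finite ({z. s z = 0} \<union> {z. t z = 0})"
        unfolding finite_Un s_def t_def using st by (intro conjI poly_roots_finite) auto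
      moreover have "- G = {z. s z = 0} \<union> {z. t z = 0}"
        by (auto simp: G_def)
      ultimately have "finite (- G)"
        by simp
      then have inf: "infinite G"
        using infinite_UNIV_char_0[where 'a = complex] finite_UnI[of G "- G"] by (auto simp: Compl_partition)
      have curve: "rat_curve n G (\<lambda>z. torus_act (s z) (t z) I)"
      proof (rule rat_curve_torus[OF I B])
        show "rat_on G s" "rat_on G t"
          unfolding s_def t_def by (rule rat_on_poly)+
      qed (auto simp: G_def)
      have hG: "(\<lambda>z. torus_act (s z) (t z) I) ` G \<subseteq> torus_orbit I"
        by (auto simp: G_def intro: torus_orbitI)
      have "0 \<in> G" "1 \<in> G" "torus_act (s 0) (t 0) I = J" "torus_act (s 1) (t 1) I = K"
        using st by (auto simp: G_def s_def t_def)
      then have "finite ({z\<in>G. torus_act (s z) (t z) I \<in> C} \<union> {z\<in>G. torus_act (s z) (t z) I \<in> D})"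
        using rat_curve_closedin[OF curve X hG[folded top], of C 0] rat_curve_closedin[OF curve X hG[folded top], of D 1]
          CD JK by simp
      moreover have "G \<subseteq> {z\<in>G. torus_act (s z) (t z) I \<in> C} \<union> {z\<in>G. torus_act (s z) (t z) I \<in> D}"
        using hG CD by auto
      ultimately show False
        using inf finite_subset by blast
    qed
  qed
qed

lemma krull_dim_le_1:
  assumes "krull_dim X \<le> 1"
  shows "\<not> (irreducible_closed X Z0 \<and> irreducible_closed X Z1 \<and> irreducible_closed X Z2 \<and> Z0 \<subset> Z1 \<and> Z1 \<subset> Z2)"
proof
  assume *: "irreducible_closed X Z0 \<and> irreducible_closed X Z1 \<and> irreducible_closed X Z2 \<and> Z0 \<subset> Z1 \<and> Z1 \<subset> Z2"
  define Z where "Z i = (if i = 0 then Z0 else if i = 1 then Z1 else Z2)" for i :: nat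
  have "(\<forall>i\<le>2. irreducible_closed X (Z i)) \<and> (\<forall>i<2. Z i \<subset> Z (Suc i))"
    using * by (auto simp: Z_def less_Suc_eq numeral_2_eq_2)
  then have "enat 2 \<le> krull_dim X"
    unfolding krull_dim_def by (intro Sup_upper) blast
  then have "enat 2 \<le> enat 1"
    using assms by (metis one_enat_def order_trans)
  then show False
    by simp
qed

text \<open>2 is not a root of unity, so it serves as a single test value that detects whether a
  weight is zero.\<close>

lemma powi_2_eq_1: "(2 :: complex) powi n = 1 \<Longrightarrow> n = 0"
proof -
  assume "(2 :: complex) powi n = 1"
  then have "norm ((2 :: complex) powi n) = 1"
    by simp
  then have "(2 :: real) powi n = 1"
    by (simp add: norm_power_int)
  then show "n = 0"
    using power_int_strict_increasing[of 0 n "2 :: real"] power_int_strict_increasing[of n 0 "2 :: real"]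
    by (cases n "0 :: int" rule: linorder_cases) auto
qed

text \<open>Two independent weights give a chain consisting of a point, a one-parameter subgroup that fixes
  the coordinate of the first weight, and the whole orbit.\<close>

lemma one_dim_orbit_weights_parallel:
  assumes I: "is_ideal I" and B: "B \<subseteq> monomials" "basis_mod B I" "card B = n"
    and dim: "krull_dim (subtopology (hilb_zariski n) (torus_orbit I)) = 1"
    and b: "b \<in> B" "coord B (mon i j) b I \<noteq> 0" and b': "b' \<in> B" "coord B (mon i' j') b' I \<noteq> 0"
  shows "(int (xdeg b) - int i) * (int (ydeg b') - int j') = (int (xdeg b') - int i') * (int (ydeg b) - int j)"
proof (rule ccontr)
  define w1 w2 v1 v2 where "w1 = int (xdeg b) - int i" and "w2 = int (ydeg b) - int j"
    and "v1 = int (xdeg b') - int i'" and "v2 = int (ydeg b') - int j'"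
  assume "\<not> ?thesis"
  then have det: "w1 * v2 - v1 * w2 \<noteq> 0"
    by (simp add: w1_def w2_def v1_def v2_def)
  define X where "X = subtopology (hilb_zariski n) (torus_orbit I)"
  have top: "topspace X = torus_orbit I" and Z2: "irreducible_closed X (torus_orbit I)"
    using irreducible_orbit[OF I B X_def] by auto
  have orb: "basis_mod B J \<and> J \<in> Hilb n" if "J \<in> torus_orbit I" for J
    using that Hilb_torus_act basis_mod_torus_act B I by (auto simp: torus_orbit_def)
  have coordf: "coord B (mon i j) b \<in> chart_functions B" "coord B (mon i' j') b' \<in> chart_functions B"
    using b b' by (auto intro: chart_functions.coord)
  have level: "X closure_of S \<subseteq> {J\<in>torus_orbit I. \<phi> J = a}"
    if "S \<subseteq> {J\<in>torus_orbit I. \<phi> J = a}" "\<phi> \<in> chart_functions B" for S \<phi> a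
    using that closedin_level[OF B(1) that(2) orb] by (intro closure_of_minimal) (auto simp: X_def)
  \<comment> \<open>The exponents (-w2, w1) pair to 0 with the first weight and to the nonzero
    determinant with the second.\<close>
  define h where "h z = torus_act (z powi (- w2)) (z powi w1) I" for z
  have h_orb: "h z \<in> torus_orbit I" if "z \<noteq> 0" for z
    using that by (auto simp: h_def intro: torus_orbitI)
  have h1: "h 1 = I"
    by (simp add: h_def)
  have curve: "rat_curve n (- {0}) h"
    unfolding h_def by (rule rat_curve_torus[OF I B]) (auto intro!: rat_on_power_int rat_on_id)
  have const: "rat_curve n UNIV (\<lambda>z. I)"
    using rat_curve_torus[OF I B, of UNIV "\<lambda>z. 1" "\<lambda>z. 1"] by (simp add: rat_on_const)
  \<comment> \<open>The point is taken as the closure of a constant curve over an infinite parameter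
    set, so that its irreducibility is an instance of
    \<open>irreducible_closure_of_curve\<close>.\<close>
  define Z0 where "Z0 = X closure_of ((\<lambda>z::complex. I) ` UNIV)"
  define Z1 where "Z1 = X closure_of (h ` (- {0}))"
  have Z0: "irreducible_closed X Z0"
    unfolding Z0_def using torus_orbit_refl[of I]
    by (intro irreducible_closure_of_curve[OF const _ _ X_def]) (auto simp: top infinite_UNIV_char_0)
  have "infinite (- {0 :: complex})"
    using infinite_UNIV_char_0[where 'a = complex] by (simp add: Compl_eq_Diff_UNIV)
  then have Z1: "irreducible_closed X Z1"
    unfolding Z1_def using h_orb
    by (intro irreducible_closure_of_curve[OF curve _ _ X_def]) (auto simp: top)
  have h_w: "coord B (mon i j) b (h z) = coord B (mon i j) b I" if "z \<noteq> 0" for z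
  proof -
    have "(z powi (- w2)) powi w1 * (z powi w1) powi w2 = 1"
      using that by (simp add: power_int_mult[symmetric] power_int_add[symmetric] mult.commute)
    then show ?thesis
      using that by (simp add: h_def coord_torus_act[OF B(1,2) I] flip: w1_def w2_def)
  qed
  have h_v: "coord B (mon i' j') b' (h 2) \<noteq> coord B (mon i' j') b' I"
  proof
    assume "coord B (mon i' j') b' (h 2) = coord B (mon i' j') b' I"
    then have "(2 powi (- w2)) powi v1 * (2 powi w1) powi v2 = (1 :: complex)"
      using b' by (simp add: h_def coord_torus_act[OF B(1,2) I] flip: v1_def v2_def)
    then have "(2 :: complex) powi ((- w2) * v1 + w1 * v2) = 1"
      by (subst power_int_add) (simp_all only: power_int_mult, simp)
    then have "(- w2) * v1 + w1 * v2 = 0"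
      by (rule powi_2_eq_1)
    then show False
      using det by (simp add: algebra_simps)
  qed
  have "Z0 \<subseteq> {J\<in>torus_orbit I. coord B (mon i' j') b' J = coord B (mon i' j') b' I}"
    unfolding Z0_def using coordf torus_orbit_refl by (intro level) auto
  then have "h 2 \<notin> Z0"
    using h_v by auto
  moreover have "h 2 \<in> Z1"
    unfolding Z1_def using h_orb by (intro subsetD[OF closure_of_subset]) (auto simp: top)
  moreover have "Z0 \<subseteq> Z1"
    unfolding Z0_def Z1_def using h1 by (intro closure_of_mono) (auto simp: image_iff intro!: bexI[of _ 1])
  ultimately have "Z0 \<subset> Z1"
    by auto
  moreover have "Z1 \<subset> torus_orbit I"
  proof -
    have Z1_sub: "Z1 \<subseteq> {J\<in>torus_orbit I. coord B (mon i j) b J = coord B (mon i j) b I}"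
      unfolding Z1_def using coordf h_orb h_w by (intro level) auto
    \<comment> \<open>As the first weight is nonzero, (2, 1) or (1, 2) changes its coordinate, so
      the level set containing \<open>Z1\<close> is not the whole orbit.\<close>
    have "w1 \<noteq> 0 \<or> w2 \<noteq> 0"
      using det by auto
    then have "2 powi w1 \<noteq> (1 :: complex) \<or> 2 powi w2 \<noteq> (1 :: complex)"
      using powi_2_eq_1 by blast
    then have "coord B (mon i j) b (torus_act 2 1 I) \<noteq> coord B (mon i j) b I \<or>
        coord B (mon i j) b (torus_act 1 2 I) \<noteq> coord B (mon i j) b I"
      using b by (simp add: coord_torus_act[OF B(1,2) I] flip: w1_def w2_def)
    moreover have "torus_act 2 1 I \<in> torus_orbit I" "torus_act 1 2 I \<in> torus_orbit I"
      by (auto intro: torus_orbitI)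
    ultimately show ?thesis
      using Z1_sub by blast
  qed
  ultimately show False
    using krull_dim_le_1[of X Z0 Z1 "torus_orbit I"] Z0 Z1 Z2 dim by (simp add: X_def)
qed

text \<open>The orbit is the image of the curve t -> (1, t), so its proper closed subsets are
  finite, and finite irreducible closed sets are points. The weight with nonzero y-component makes
  the orbit larger than one point.\<close>

lemma krull_dim_eq_1:
  assumes I: "is_ideal I" and B: "B \<subseteq> monomials" "basis_mod B I" "card B = n"
    and hom: "torus_orbit I = {torus_act 1 t I | t. t \<noteq> 0}"
    and b: "b \<in> B" "coord B (mon i j) b I \<noteq> 0" "ydeg b \<noteq> j"
  shows "krull_dim (subtopology (hilb_zariski n) (torus_orbit I)) = 1"
proof -
  define X where "X = subtopology (hilb_zariski n) (torus_orbit I)"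
  have top: "topspace X = torus_orbit I" and irr: "irreducible_closed X (torus_orbit I)"
    using irreducible_orbit[OF I B X_def] by auto
  have orb: "basis_mod B J \<and> J \<in> Hilb n \<and> is_ideal J" if "J \<in> torus_orbit I" for J
    using that Hilb_torus_act basis_mod_torus_act is_ideal_torus_act B I by (auto simp: torus_orbit_def)
  have curve: "rat_curve n (- {0}) (\<lambda>t. torus_act 1 t I)"
    by (rule rat_curve_torus[OF I B]) (auto intro!: rat_on_const rat_on_id)
  have curve_sub: "(\<lambda>t. torus_act 1 t I) ` (- {0}) \<subseteq> topspace X"
    by (auto simp: top intro: torus_orbitI)
  have "t1_space X"
    unfolding t1_space_def top
  proof (intro ballI impI)
    fix K J assume KJ: "K \<in> torus_orbit I" "J \<in> torus_orbit I" "K \<noteq> J"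
    \<comment> \<open>Distinct ideals of one chart are incomparable, so some polynomial lies in
      \<open>J\<close> but not in \<open>K\<close>; one of its coordinates separates the
      two.\<close>
    then obtain f where f: "f \<in> J" "f \<notin> K"
      using basis_mod_subset_eq[of B J K] orb by blast
    then obtain b where b: "coord B f b K \<noteq> 0"
      using coord_0_iff[of B K f] orb KJ by blast
    then have bB: "b \<in> B"
      using coord_notin[of B K b f] orb KJ by blast
    have "openin X (topspace X - {L\<in>torus_orbit I. coord B f b L = 0})"
      unfolding X_def using orb
      by (intro openin_diff openin_topspace closedin_level[OF B(1) chart_functions.coord[OF bB, of f]]) auto
    moreover have "coord B f b J = 0"
      using coord_0_iff[of B J f] orb KJ f by blast
    ultimately show "\<exists>U. openin X U \<and> K \<in> U \<and> J \<notin> U"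
      using b KJ by (intro exI[of _ "topspace X - {L\<in>torus_orbit I. coord B f b L = 0}"]) (auto simp: top)
  qed
  then have fin_closed: "closedin X S" if "finite S" "S \<subseteq> torus_orbit I" for S
    using that by (simp add: t1_space_closedin_finite top)
  have no_chain: False if "irreducible_closed X Z0" "irreducible_closed X Z1" "Z0 \<subset> Z1" "Z1 \<subset> Z2"
    "irreducible_closed X Z2" for Z0 Z1 Z2
  proof -
    have "Z2 \<subseteq> torus_orbit I"
      using that(5) closedin_subset[of X Z2] top by (simp add: irreducible_closed_def)
    then have sub: "Z1 \<subset> torus_orbit I"
      using that(4) by blast
    then obtain z0 where z0: "z0 \<noteq> 0" "torus_act 1 z0 I \<notin> Z1"
      using hom by auto
    have "finite {z \<in> - {0}. torus_act 1 z I \<in> Z1}"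
      using rat_curve_closedin[OF curve X_def curve_sub, of Z1 z0] that z0
      by (auto simp: irreducible_closed_def)
    then have "finite ((\<lambda>z. torus_act 1 z I) ` {z \<in> - {0}. torus_act 1 z I \<in> Z1})"
      by simp
    moreover have "Z1 \<subseteq> (\<lambda>z. torus_act 1 z I) ` {z \<in> - {0}. torus_act 1 z I \<in> Z1}"
      using sub hom by auto
    ultimately have fin: "finite Z1"
      using finite_subset by blast
    have "Z0 \<noteq> {}"
      using that(1) by (simp add: irreducible_closed_def)
    then obtain x where x: "x \<in> Z0"
      by blast
    \<comment> \<open>Splitting off a point of \<open>Z0\<close> decomposes the finite set
      \<open>Z1\<close>; irreducibility leaves only {x}, which has no proper nonempty
      subset.\<close>
    then have "closedin X {x}" "closedin X (Z1 - {x})" "Z1 = {x} \<union> (Z1 - {x})"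
      using fin sub that(3) by (auto intro!: fin_closed)
    moreover have "\<forall>C D. closedin X C \<and> closedin X D \<and> Z1 = C \<union> D \<longrightarrow> Z1 = C \<or> Z1 = D"
      using that(2) by (simp add: irreducible_closed_def)
    ultimately have "Z1 = {x} \<or> Z1 = Z1 - {x}"
      by blast
    then show False
      using x that(3) by auto
  qed
  have "krull_dim X \<le> 1"
    unfolding krull_dim_def
  proof (rule Sup_least)
    fix m assume "m \<in> {enat n | n. \<exists>Z :: nat \<Rightarrow> cxy set set.
      (\<forall>i\<le>n. irreducible_closed X (Z i)) \<and> (\<forall>i<n. Z i \<subset> Z (Suc i))}"
    then obtain n' Z where Z: "m = enat n'" "\<forall>i\<le>n'. irreducible_closed X (Z i)" "\<forall>i<n'. Z i \<subset> Z (Suc i)"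
      by blast
    have "n' \<le> 1"
    proof (rule ccontr)
      assume "\<not> n' \<le> 1"
      then show False
        using no_chain[of "Z 0" "Z 1" "Z 2"] Z(2)[rule_format, of 0] Z(2)[rule_format, of 1]
          Z(2)[rule_format, of 2] Z(3)[rule_format, of 0] Z(3)[rule_format, of 1]
        by (simp add: numeral_2_eq_2)
    qed
    then show "m \<le> 1"
      using Z by (simp add: one_enat_def)
  qed
  moreover have "1 \<le> krull_dim X"
  proof -
    have "irreducible_closed X {I}"
      using fin_closed[of "{I}"] torus_orbit_refl[of I]
      by (auto simp: irreducible_closed_def singleton_Un_iff simp del: Un_insert_left Un_insert_right)
    moreover have "{I} \<subset> torus_orbit I"
    proof -
      have "coord B (mon i j) b (torus_act 1 2 I) \<noteq> coord B (mon i j) b I"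
        using b powi_2_eq_1[of "int (ydeg b) - int j"] by (auto simp: coord_torus_act[OF B(1,2) I])
      then have "torus_act 1 2 I \<noteq> I"
        by auto
      then show ?thesis
        using torus_orbit_refl[of I] torus_orbitI[of 1 2 I] by auto
    qed
    ultimately have "\<exists>Z. (\<forall>i\<le>1. irreducible_closed X (Z i)) \<and> (\<forall>i<1. Z i \<subset> Z (Suc i))"
      using irr by (intro exI[of _ "\<lambda>i. if i = 0 then {I} else torus_orbit I"]) auto
    then show ?thesis
      unfolding krull_dim_def one_enat_def by (intro Sup_upper) blast
  qed
  ultimately show ?thesis
    by (simp add: X_def)
qed

section \<open>Closures of orbits\<close>

text \<open>Basis monomials avoid the ideal, hence sit inside \<open>B\<close>, and the sizes agree.
  Neighbourhoods of a monomial ideal thus need testing in a single chart.\<close>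

lemma monomial_basis_unique:
  assumes P: "is_ideal P" "basis_mod B P" "\<And>i j. mon i j \<notin> B \<Longrightarrow> mon i j \<in> P"
    and B': "B' \<subseteq> monomials" "basis_mod B' P"
  shows "B' = B"
proof -
  have "B' \<subseteq> B"
    using P(3) B' basis_mod_notin[OF B'(2) P(1)] by (fastforce simp: monomials_eq)
  then show ?thesis
    using basis_mod_card_eq[OF B'(2) P(2,1)] basis_mod_finite[OF P(2)] by (simp add: card_subset_eq)
qed

lemma coord_monomial_ideal:
  assumes P: "is_ideal P" "basis_mod B P" "\<And>i j. mon i j \<notin> B \<Longrightarrow> mon i j \<in> P"
  shows "coord B (mon i j) b P = (if mon i j \<in> B \<and> b = mon i j then 1 else 0)"
proof (cases "mon i j \<in> B")
  case True
  then show ?thesis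
    using coord_basis[OF P(2,1)] by simp
next
  case False
  then show ?thesis
    using P(3)[OF False] coord_0_iff[OF P(2,1), of "mon i j"] by simp
qed

text \<open>The subgroup z -> (z^\<alpha>, z^\<beta>) is extended by \<open>P\<close> at z = 0. By
  \<open>pos\<close> every coordinate of a monomial outside \<open>B\<close> becomes a constant
  multiple of a positive power of z, so the extension is again a rational curve, and a neighbourhood
  of \<open>P\<close> contains points with z \<noteq> 0.\<close>

lemma limit_in_closure:
  assumes I: "is_ideal I" and B: "B \<subseteq> monomials" "basis_mod B I" "card B = n"
    and P: "is_ideal P" "basis_mod B P" "\<And>i j. mon i j \<notin> B \<Longrightarrow> mon i j \<in> P"
    and pos: "\<And>i j b. mon i j \<notin> B \<Longrightarrow> b \<in> B \<Longrightarrow> coord B (mon i j) b I \<noteq> 0 \<Longrightarrow>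
      int \<alpha> * (int (xdeg b) - int i) + int \<beta> * (int (ydeg b) - int j) > 0"
  shows "P \<in> hilb_zariski n closure_of torus_orbit I"
proof -
  define h where "h z = (if z = 0 then P else torus_act (z ^ \<alpha>) (z ^ \<beta>) I)" for z
  have h0: "h 0 = P"
    by (simp add: h_def)
  have ideal: "is_ideal (h z)" and basis: "basis_mod B (h z)" for z
    using P I B is_ideal_torus_act basis_mod_torus_act by (auto simp: h_def)
  have rat: "rat_on UNIV (\<lambda>z. \<phi> (h z))" if "\<phi> \<in> chart_functions B" for \<phi>
  proof (rule rat_on_chart_function[OF that])
    fix i j b assume b: "b \<in> B"
    show "rat_on UNIV (\<lambda>z. coord B (mon i j) b (h z))"
    proof (cases "mon i j \<in> B \<or> coord B (mon i j) b I = 0")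
      case True
      \<comment> \<open>Basis monomials have the constant coordinates 0 and 1, and vanishing
        coordinates stay zero under scaling.\<close>
      then have "coord B (mon i j) b (h z) = coord B (mon i j) b P" for z
        using coord_monomial_ideal[OF P, of i j b] ideal basis coord_basis[of B "h z" "mon i j" b]
          coord_basis[of B P "mon i j" b]
        by (auto simp: h_def coord_torus_act[OF B(1,2) I])
      then show ?thesis
        by (simp add: rat_on_const)
    next
      case False
      define N where "N = nat (int \<alpha> * (int (xdeg b) - int i) + int \<beta> * (int (ydeg b) - int j))"
      have N: "N > 0" "int N = int \<alpha> * (int (xdeg b) - int i) + int \<beta> * (int (ydeg b) - int j)"
        using pos[of i j b] b False by (auto simp: N_def)
      have "coord B (mon i j) b (h z) = coord B (mon i j) b I * z ^ N" for z
      proof (cases "z = 0")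
        case True
        then show ?thesis
          using False N coord_monomial_ideal[OF P] by (simp add: h0)
      next
        case z: False
        have "(z ^ \<alpha>) powi (int (xdeg b) - int i) * (z ^ \<beta>) powi (int (ydeg b) - int j) = z powi int N"
          unfolding N(2) using z
          by (simp only: power_int_of_nat[symmetric] power_int_mult[symmetric]) (simp add: power_int_add)
        then show ?thesis
          using z by (simp add: h_def coord_torus_act[OF B(1,2) I])
      qed
      then show ?thesis
        by (simp add: rat_on_const rat_on_mult rat_on_power rat_on_id)
    qed
  qed (use ideal basis in auto)
  have curve0: "rat_curve n (- {0}) (\<lambda>z. torus_act (z ^ \<alpha>) (z ^ \<beta>) I)"
    by (rule rat_curve_torus[OF I B]) (auto intro!: rat_on_power rat_on_id)
  have "rat_curve n UNIV h"
    unfolding rat_curve_def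
  proof (intro conjI allI impI)
    show "h ` UNIV \<subseteq> Hilb n"
      using ideal basis B by (auto simp: Hilb_def)
  next
    fix B' \<phi> z0 assume B': "B' \<subseteq> monomials" "\<phi> \<in> chart_functions B'" "basis_mod B' (h z0)" "\<phi> (h z0) \<noteq> 0"
    show "finite {z\<in>UNIV. \<not> (basis_mod B' (h z) \<and> \<phi> (h z) \<noteq> 0)}"
    proof (cases "z0 = 0")
      case True
      then have "B' = B"
        using monomial_basis_unique[OF P B'(1)] B' by (simp add: h0)
      then show ?thesis
        using rat_on_finite_zeros[OF rat[of \<phi>], of z0] B' basis by simp
    next
      case False
      then have "finite {z\<in>-{0}. \<not> (basis_mod B' (torus_act (z ^ \<alpha>) (z ^ \<beta>) I) \<and>
          \<phi> (torus_act (z ^ \<alpha>) (z ^ \<beta>) I) \<noteq> 0)}"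
        using curve0 B' unfolding rat_curve_def by (simp add: h_def)
      then have "finite (insert 0 {z\<in>-{0}. \<not> (basis_mod B' (torus_act (z ^ \<alpha>) (z ^ \<beta>) I) \<and>
          \<phi> (torus_act (z ^ \<alpha>) (z ^ \<beta>) I) \<noteq> 0)})"
        by simp
      then show ?thesis
        by (rule rev_finite_subset) (auto simp: h_def)
    qed
  qed
  note curve = this
  show ?thesis
    unfolding in_closure_of
  proof (intro conjI allI impI)
    show "P \<in> topspace (hilb_zariski n)"
      using P B by (intro chart_subset_topspace[of B]) (auto simp: Hilb_def)
  next
    fix U assume U: "P \<in> U \<and> openin (hilb_zariski n) U"
    then have "finite {z\<in>UNIV. h z \<notin> U}"
      using rat_curve_open[OF curve, of U 0] by (simp add: h0)
    \<comment> \<open>Excluding 0 as well ensures that the point found lies on the orbit.\<close>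
    then have "finite (insert 0 {z. h z \<notin> U})"
      by simp
    then obtain z where "z \<notin> insert 0 {z. h z \<notin> U}"
      using infinite_UNIV_char_0[where 'a = complex] by (metis UNIV_eq_I)
    then have "z \<noteq> 0" "h z \<in> U"
      by auto
    then show "\<exists>y. y \<in> torus_orbit I \<and> y \<in> U"
      by (intro exI[of _ "h z"]) (auto simp: h_def intro: torus_orbitI)
  qed
qed

section \<open>Conditions satisfied by points of an orbit closure\<close>

lemma closure_of_meets: "x \<in> X closure_of S \<Longrightarrow> openin X U \<Longrightarrow> x \<in> U \<Longrightarrow> S \<inter> U \<noteq> {}"
  unfolding in_closure_of by blast

text \<open>The chart around \<open>J\<close> is open, so it meets the orbit, and charts are torus
  stable.\<close>

lemma closure_chart:
  assumes I: "is_ideal I" and J: "J \<in> hilb_zariski n closure_of torus_orbit I" "J \<in> Hilb n"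
    and B: "B \<subseteq> monomials" "basis_mod B J"
  shows "basis_mod B I"
proof -
  have "openin (hilb_zariski n) {I \<in> Hilb n. basis_mod B I \<and> (1 :: complex) \<noteq> 0}"
    by (rule openin_chart[OF B(1) chart_functions.const])
  from closure_of_meets[OF J(1) this] obtain K where "K \<in> torus_orbit I" "basis_mod B K"
    using J(2) B(2) by auto
  then show ?thesis
    using basis_mod_torus_act_iff[OF B(1) I] by (auto simp: torus_orbit_def)
qed

text \<open>Otherwise the principal open where \<phi> is nonzero would be a neighbourhood of
  \<open>J\<close> missing the orbit.\<close>

lemma closure_relation:
  assumes J: "J \<in> hilb_zariski n closure_of torus_orbit I" "J \<in> Hilb n"
    and B: "B \<subseteq> monomials" "basis_mod B J" and \<phi>: "\<phi> \<in> chart_functions B"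
    and zero: "\<And>s t. s \<noteq> 0 \<Longrightarrow> t \<noteq> 0 \<Longrightarrow> \<phi> (torus_act s t I) = 0"
  shows "\<phi> J = 0"
proof (rule ccontr)
  assume "\<phi> J \<noteq> 0"
  then obtain K where "K \<in> torus_orbit I" "\<phi> K \<noteq> 0"
    using closure_of_meets[OF J(1) openin_chart[OF B(1) \<phi>]] J(2) B(2) by auto
  then show False
    using zero by (auto simp: torus_orbit_def)
qed

lemma topspace_chart:
  assumes "J \<in> topspace (hilb_zariski n)"
  obtains B where "B \<subseteq> monomials" "basis_mod B J" "J \<in> Hilb n"
  using assms unfolding hilb_zariski_def topology_generated_by_topspace by blast

lemma coord_lin:
  assumes "basis_mod B I" "is_ideal I" "finite B'"
  shows "coord B (lin B' c) x I = (\<Sum>b\<in>B'. c b * coord B b x I)"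
  unfolding lin_def using assms(3)
proof (induction B')
  case empty
  then show ?case
    using coord_scale[OF assms(1,2), of 0 0 x] by simp
qed (simp_all add: coord_add coord_scale assms)

text \<open>A chart in which every coordinate raises the value of \<open>ht\<close> is spanned by the standard monomials
  for the term order given by \<open>ht\<close>.\<close>

lemma standard_monomials_unique:
  fixes ht :: "cxy \<Rightarrow> int"
  assumes I: "is_ideal I" and B: "B \<subseteq> monomials" "basis_mod B I" and B': "B' \<subseteq> monomials" "basis_mod B' I"
    and up: "\<And>i j b. mon i j \<notin> B \<Longrightarrow> coord B (mon i j) b I \<noteq> 0 \<Longrightarrow> ht (mon i j) < ht b"
    and up': "\<And>i j b. mon i j \<notin> B' \<Longrightarrow> coord B' (mon i j) b I \<noteq> 0 \<Longrightarrow> ht (mon i j) < ht b"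
  shows "B = B'"
proof -
  have "B \<subseteq> B'"
  proof
    fix m assume m: "m \<in> B"
    show "m \<in> B'"
    proof (rule ccontr)
      assume m': "m \<notin> B'"
      \<comment> \<open>Expand \<open>m\<close> in \<open>B'\<close>, then each term in
        \<open>B\<close>, and read off the coefficient of \<open>m\<close>. A nonzero contribution
        through b would need ht m < ht b < ht m.\<close>
      define c where "c b = coord B' m b I" for b
      have "m - lin B' c \<in> I"
        unfolding c_def by (rule coord_mem[OF B'(2)])
      then have "coord B (m - lin B' c + lin B' c) m I = 0 + coord B (lin B' c) m I"
        by (subst coord_add[OF B(2) I]) (simp add: coord_0_iff[OF B(2) I])
      then have "1 = (\<Sum>b\<in>B'. c b * coord B b m I)"
        using coord_basis[OF B(2) I m, of m] by (simp add: coord_lin[OF B(2) I basis_mod_finite[OF B'(2)]])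
      moreover have "c b * coord B b m I = 0" if b: "b \<in> B'" for b
      proof (rule ccontr)
        assume nz: "c b * coord B b m I \<noteq> 0"
        have mm: "mon (xdeg m) (ydeg m) = m" "mon (xdeg b) (ydeg b) = b"
          using mon_xdeg_ydeg m b B B' by auto
        have "ht m < ht b"
          using up'[of "xdeg m" "ydeg m" b] m' nz by (simp add: mm c_def)
        moreover have "b \<notin> B"
          using nz coord_basis[OF B(2) I, of b m] m' b by (auto split: if_splits)
        then have "ht b < ht m"
          using up[of "xdeg b" "ydeg b" m] nz by (simp add: mm)
        ultimately show False
          by simp
      qed
      ultimately show False
        by simp
    qed
  qed
  then show ?thesis
    using basis_mod_card_eq[OF B(2) B'(2) I] basis_mod_finite[OF B'(2)] by (simp add: card_subset_eq)
qed

text \<open>\<open>S\<close> is the graph of a multiplicative map on a subsemigroup of the integers.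
  Once it is nonzero at some nonzero weight, it is nonzero throughout, so it extends to the group of
  differences. That group is generated by some g > 0, and any g-th root of the value at g is a
  suitable v.\<close>

lemma semigroup_character:
  fixes S :: "(int \<times> complex) set"
  assumes one: "(0, 1) \<in> S"
    and mult: "\<And>w a w' a'. (w, a) \<in> S \<Longrightarrow> (w', a') \<in> S \<Longrightarrow> (w + w', a * a') \<in> S"
    and func: "\<And>w a a'. (w, a) \<in> S \<Longrightarrow> (w, a') \<in> S \<Longrightarrow> a = a'"
    and w0: "(w0, a0) \<in> S" "w0 \<noteq> 0" "a0 \<noteq> 0"
  shows "\<exists>v. v \<noteq> 0 \<and> (\<forall>w a. (w, a) \<in> S \<longrightarrow> a = v powi w)"
proof -
  have pow: "(int n * w, a ^ n) \<in> S" if "(w, a) \<in> S" for n w a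
    using that by (induction n) (auto simp: one algebra_simps dest: mult)
  have nz: "a \<noteq> 0" if wa: "(w, a) \<in> S" for w a
  proof (cases "w = 0")
    case True
    then show ?thesis
      using func[OF one, of a] wa by auto
  next
    case False
    \<comment> \<open>|w0| * w and |w| * w0 agree up to sign, so a power of \<open>a\<close> equals
      a power of \<open>a0\<close> or its inverse.\<close>
    define N M where "N = nat \<bar>w0\<bar>" and "M = nat \<bar>w\<bar>"
    have NM: "(int N * w, a ^ N) \<in> S" "(int M * w0, a0 ^ M) \<in> S" "N > 0"
      using pow[OF wa, of N] pow[OF w0(1), of M] w0(2) by (simp_all add: N_def)
    have "int N * w = int M * w0 \<or> int N * w + int M * w0 = 0"
      by (cases "w > 0"; cases "w0 > 0") (auto simp: N_def M_def)
    then have "a ^ N = a0 ^ M \<or> a ^ N * a0 ^ M = 1"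
    proof
      assume "int N * w = int M * w0"
      then show ?thesis
        using NM func by metis
    next
      assume "int N * w + int M * w0 = 0"
      then have "(0, a ^ N * a0 ^ M) \<in> S"
        using mult[OF NM(1,2)] by simp
      then show ?thesis
        using func one by blast
    qed
    then show ?thesis
      using NM(3) w0(3) by (auto simp: zero_power)
  qed
  \<comment> \<open>Group of fractions of \<open>S\<close>.\<close>
  define R where "R = {(w - w', a / a') | w a w' a'. (w, a) \<in> S \<and> (w', a') \<in> S}"
  have R_nz: "a \<noteq> 0" if "(w, a) \<in> R" for w a
    using that nz by (auto simp: R_def)
  have R_func: "a = a'" if "(w, a) \<in> R" "(w, a') \<in> R" for w a a'
  proof -
    obtain w1 a1 w2 a2 w3 a3 w4 a4 where
      *: "(w1, a1) \<in> S" "(w2, a2) \<in> S" "(w3, a3) \<in> S" "(w4, a4) \<in> S"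
      "w = w1 - w2" "w = w3 - w4" "a = a1 / a2" "a' = a3 / a4"
      using \<open>(w, a) \<in> R\<close> \<open>(w, a') \<in> R\<close> unfolding R_def by blast
    have "(w1 + w4, a1 * a4) \<in> S" "(w3 + w2, a3 * a2) \<in> S"
      using * mult by auto
    moreover have "w1 + w4 = w3 + w2"
      using * by simp
    ultimately have "a1 * a4 = a3 * a2"
      using func by metis
    then have "a1 / a2 = a3 / a4"
      using nz[OF *(2)] nz[OF *(4)] by (simp add: frac_eq_eq)
    then show ?thesis
      using *(7,8) by simp
  qed
  have R_mult: "(w + w', a * a') \<in> R" if "(w, a) \<in> R" "(w', a') \<in> R" for w a w' a'
  proof -
    obtain w1 a1 w2 a2 w3 a3 w4 a4 where
      *: "(w1, a1) \<in> S" "(w2, a2) \<in> S" "(w3, a3) \<in> S" "(w4, a4) \<in> S"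
      "w = w1 - w2" "w' = w3 - w4" "a = a1 / a2" "a' = a3 / a4"
      using \<open>(w, a) \<in> R\<close> \<open>(w', a') \<in> R\<close> unfolding R_def by blast
    have "(w1 + w3, a1 * a3) \<in> S" "(w2 + w4, a2 * a4) \<in> S"
      using * mult by auto
    moreover have "w + w' = (w1 + w3) - (w2 + w4)" "a * a' = (a1 * a3) / (a2 * a4)"
      using * by simp_all
    ultimately show ?thesis
      unfolding R_def by blast
  qed
  have R_inv: "(- w, inverse a) \<in> R" if "(w, a) \<in> R" for w a
  proof -
    obtain w1 a1 w2 a2 where *: "(w1, a1) \<in> S" "(w2, a2) \<in> S" "w = w1 - w2" "a = a1 / a2"
      using \<open>(w, a) \<in> R\<close> unfolding R_def by blast
    then have "- w = w2 - w1" "inverse a = a2 / a1"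
      by simp_all
    then show ?thesis
      using * unfolding R_def by blast
  qed
  have SR: "(w, a) \<in> R" if "(w, a) \<in> S" for w a
  proof -
    have "w = w - 0" "a = a / 1"
      by simp_all
    then show ?thesis
      using that one unfolding R_def by blast
  qed
  have R_pow: "(int n * w, a ^ n) \<in> R" if "(w, a) \<in> R" for n w a
    using that by (induction n) (auto simp: SR one algebra_simps dest: R_mult)
  have R_powi: "(n * w, a powi n) \<in> R" if "(w, a) \<in> R" for n w a
  proof (cases "n \<ge> 0")
    case True
    then show ?thesis
      using R_pow[OF that, of "nat n"] by (simp add: power_int_def)
  next
    case False
    then show ?thesis
      using R_inv[OF R_pow[OF that, of "nat (- n)"]] by (simp add: power_int_def power_inverse)
  qed
  have ex: "\<exists>g>0. \<exists>r. (int g, r) \<in> R"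
  proof (cases "w0 > 0")
    case True
    then show ?thesis
      using SR[OF w0(1)] by (intro exI[of _ "nat w0"]) auto
  next
    case False
    then show ?thesis
      using R_inv[OF SR[OF w0(1)]] w0(2) by (intro exI[of _ "nat (- w0)"]) auto
  qed
  \<comment> \<open>The least positive weight generates the group: a nonzero remainder modulo g
    would be a smaller one.\<close>
  define g where "g = (LEAST g. g > 0 \<and> (\<exists>r. (int g, r) \<in> R))"
  have "g > 0 \<and> (\<exists>r. (int g, r) \<in> R)"
    unfolding g_def by (rule LeastI_ex) (use ex in auto)
  then obtain r where g: "g > 0" "(int g, r) \<in> R"
    by blast
  have g_min: "g \<le> m" if "m > 0" "(int m, a) \<in> R" for m a
    unfolding g_def using that by (intro Least_le) auto
  obtain v where v: "v \<noteq> 0" "r = v ^ g"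
    using exists_complex_root_nonzero[of r g] R_nz[OF g(2)] g(1) by auto
  have "a = v powi w" if "(w, a) \<in> S" for w a
  proof -
    define q where "q = w div int g"
    define m where "m = w mod int g"
    have wqm: "w = q * int g + m"
      by (simp add: q_def m_def)
    have "(w + - (q * int g), a * inverse (r powi q)) \<in> R"
      by (rule R_mult[OF SR[OF that] R_inv[OF R_powi[OF g(2)]]])
    then have mR: "(m, a * inverse (r powi q)) \<in> R"
      by (simp add: wqm)
    have m: "0 \<le> m" "m < int g"
      using g(1) by (simp_all add: m_def)
    have "m = 0"
    proof (rule ccontr)
      assume "m \<noteq> 0"
      then have "g \<le> nat m"
        using m mR by (intro g_min) auto
      then show False
        using m by linarith
    qed
    then have "a * inverse (r powi q) = 1"
      using R_func mR SR[OF one] by blast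
    then have "a = r powi q"
      using R_nz[OF g(2)] by (simp add: field_simps)
    also have "\<dots> = v powi (int g * q)"
      unfolding v(2) by (simp only: power_int_mult power_int_of_nat)
    also have "int g * q = w"
      using wqm \<open>m = 0\<close> by (simp add: mult.commute)
    finally show ?thesis .
  qed
  then show ?thesis
    using v(1) by blast
qed

text \<open>The functions that are pure powers of the orbit parameter have values at a boundary point \<open>J\<close>
  that form a multiplicative character of the semigroup of weights.  If it is not zero away from \<open>0\<close>,
  it is evaluation at a point of the torus; otherwise \<open>J\<close> is a monomial ideal.\<close>

lemma closure_of_one_dim_orbit:
  assumes I: "is_ideal I"
    and hom: "torus_orbit I = {torus_act 1 t I | t. t \<noteq> 0}"
    and inv: "\<And>s. s \<noteq> 0 \<Longrightarrow> torus_act s s I = I"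
    and J: "J \<in> hilb_zariski n closure_of torus_orbit I"
  obtains "J \<in> torus_orbit I"
  | B where "B \<subseteq> monomials" "basis_mod B I" "basis_mod B J" "is_ideal J" "\<And>i j. mon i j \<notin> B \<Longrightarrow> mon i j \<in> J"
      "\<And>i j b. mon i j \<notin> B \<Longrightarrow> coord B (mon i j) b I \<noteq> 0 \<Longrightarrow> j < ydeg b"
  | B where "B \<subseteq> monomials" "basis_mod B I" "basis_mod B J" "is_ideal J" "\<And>i j. mon i j \<notin> B \<Longrightarrow> mon i j \<in> J"
      "\<And>i j b. mon i j \<notin> B \<Longrightarrow> coord B (mon i j) b I \<noteq> 0 \<Longrightarrow> j > ydeg b"
proof -
  have "J \<in> topspace (hilb_zariski n)"
    using J by (simp add: in_closure_of)
  then obtain B where B: "B \<subseteq> monomials" "basis_mod B J" and Jn: "J \<in> Hilb n"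
    by (rule topspace_chart)
  have BI: "basis_mod B I"
    by (rule closure_chart[OF I J Jn B])
  have idJ: "is_ideal J"
    using Jn by (simp add: Hilb_def)
  \<comment> \<open>The curve t -> (1, t) covers the orbit, so identities along it persist at
    \<open>J\<close>.\<close>
  have rel: "\<phi> J = \<psi> J" if "\<phi> \<in> chart_functions B" "\<psi> \<in> chart_functions B"
    "\<And>t. t \<noteq> 0 \<Longrightarrow> \<phi> (torus_act 1 t I) = \<psi> (torus_act 1 t I)" for \<phi> \<psi>
  proof -
    have "(\<lambda>I. \<phi> I + (- 1) * \<psi> I) \<in> chart_functions B"
      using that by (intro chart_functions.intros)
    moreover have "\<phi> (torus_act s t I) + (- 1) * \<psi> (torus_act s t I) = 0" if st: "s \<noteq> 0" "t \<noteq> 0" for s t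
    proof -
      obtain t' where "t' \<noteq> 0" "torus_act s t I = torus_act 1 t' I"
        using torus_orbitI[OF st, of I] unfolding hom by blast
      then show ?thesis
        using \<open>\<And>t. t \<noteq> 0 \<Longrightarrow> \<phi> (torus_act 1 t I) = \<psi> (torus_act 1 t I)\<close> by simp
    qed
    ultimately have "\<phi> J + (- 1) * \<psi> J = 0"
      by (rule closure_relation[OF J Jn B])
    then show ?thesis
      by simp
  qed
  define S where "S = {(w, a). \<exists>\<phi>\<in>chart_functions B. (\<forall>t. t \<noteq> 0 \<longrightarrow> \<phi> (torus_act 1 t I) = t powi w) \<and> \<phi> J = a}"
  have S_one: "(0, 1) \<in> S"
    unfolding S_def by (auto intro!: bexI[of _ "\<lambda>I. 1"] chart_functions.const)
  have S_mult: "(w + w', a * a') \<in> S" if "(w, a) \<in> S" "(w', a') \<in> S" for w a w' a'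
  proof -
    obtain \<phi> \<psi> where "\<phi> \<in> chart_functions B" "\<psi> \<in> chart_functions B"
      "\<And>t. t \<noteq> 0 \<Longrightarrow> \<phi> (torus_act 1 t I) = t powi w" "\<phi> J = a"
      "\<And>t. t \<noteq> 0 \<Longrightarrow> \<psi> (torus_act 1 t I) = t powi w'" "\<psi> J = a'"
      using \<open>(w, a) \<in> S\<close> \<open>(w', a') \<in> S\<close> by (auto simp: S_def)
    then show ?thesis
      unfolding S_def by (auto intro!: bexI[of _ "\<lambda>I. \<phi> I * \<psi> I"] chart_functions.mult simp: power_int_add)
  qed
  have S_func: "a = a'" if aa: "(w, a) \<in> S" "(w, a') \<in> S" for w a a'
  proof -
    obtain \<phi> \<psi> where *: "\<phi> \<in> chart_functions B" "\<psi> \<in> chart_functions B"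
      "\<And>t. t \<noteq> 0 \<Longrightarrow> \<phi> (torus_act 1 t I) = t powi w" "\<phi> J = a"
      "\<And>t. t \<noteq> 0 \<Longrightarrow> \<psi> (torus_act 1 t I) = t powi w" "\<psi> J = a'"
      using aa by (auto simp: S_def)
    have "\<phi> J = \<psi> J"
      using *(3,5) by (intro rel[OF *(1,2)]) simp
    then show ?thesis
      using *(4,6) by simp
  qed
  \<comment> \<open>Dividing by the value at \<open>I\<close> normalizes a coordinate so that it
    restricts to a pure power of t.\<close>
  have S_coord: "(int (ydeg b) - int j, coord B (mon i j) b J / coord B (mon i j) b I) \<in> S"
    if "b \<in> B" "coord B (mon i j) b I \<noteq> 0" for i j b
    unfolding S_def
  proof (simp, intro bexI conjI allI impI)
    show "(\<lambda>K. (1 / coord B (mon i j) b I) * coord B (mon i j) b K) \<in> chart_functions B"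
      using that by (intro chart_functions.intros)
  qed (use that in \<open>simp_all add: coord_torus_act[OF B(1) BI I]\<close>)
  have coord_0: "coord B (mon i j) b J = 0" if "b \<in> B" "coord B (mon i j) b I = 0" for i j b
    using that by (intro rel[of "coord B (mon i j) b" "\<lambda>I. 0"])
      (auto intro: chart_functions.intros simp: coord_torus_act[OF B(1) BI I])
  \<comment> \<open>Invariance under the diagonal element (2, 2) forces every occurring weight to
    have total degree 0.\<close>
  have homog: "int (xdeg b) + int (ydeg b) = int i + int j" if "coord B (mon i j) b I \<noteq> 0" for i j b
  proof -
    have "coord B (mon i j) b I = coord B (mon i j) b I *
        (2 powi (int (xdeg b) - int i) * 2 powi (int (ydeg b) - int j))"
      using coord_torus_act[OF B(1) BI I, of 2 2 i j b] inv[of 2] by simp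
    then have "(2 :: complex) powi ((int (xdeg b) - int i) + (int (ydeg b) - int j)) = 1"
      using that by (simp add: power_int_add)
    then show ?thesis
      using powi_2_eq_1 by fastforce
  qed
  show thesis
  proof (cases "\<exists>w0 a0. (w0, a0) \<in> S \<and> w0 \<noteq> 0 \<and> a0 \<noteq> 0")
    case True
    then obtain w0 a0 where w0: "(w0, a0) \<in> S" "w0 \<noteq> 0" "a0 \<noteq> 0"
      by blast
    have "\<exists>v. v \<noteq> 0 \<and> (\<forall>w a. (w, a) \<in> S \<longrightarrow> a = v powi w)"
      by (rule semigroup_character[OF S_one _ _ w0]) (fact S_mult, fact S_func)
    then obtain v where "v \<noteq> 0 \<and> (\<forall>w a. (w, a) \<in> S \<longrightarrow> a = v powi w)"
      by (rule exE)
    then have v: "v \<noteq> 0" "\<And>w a. (w, a) \<in> S \<Longrightarrow> a = v powi w"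
      by simp_all
    have "J = torus_act 1 v I"
    proof (rule basis_mod_ideal_eq[OF B(2) basis_mod_torus_act[OF B(1) BI I] idJ is_ideal_torus_act[OF I]])
      fix i j b assume "b \<in> B"
      then show "coord B (mon i j) b J = coord B (mon i j) b (torus_act 1 v I)"
        using v(2)[OF S_coord[of b i j]] coord_0[of b i j] v(1)
        by (cases "coord B (mon i j) b I = 0") (auto simp: coord_torus_act[OF B(1) BI I] field_simps)
    qed (use v in auto)
    then show thesis
      using that(1) torus_orbitI[of 1 v I] v by simp
  next
    case False
    then have S0: "a = 0" if "(w, a) \<in> S" "w \<noteq> 0" for w a
      using that by blast
    \<comment> \<open>By homogeneity, equal y-degrees would make b the monomial itself, which is
      outside \<open>B\<close>.\<close>
    have w_nz: "int (ydeg b) - int j \<noteq> 0" if "mon i j \<notin> B" "b \<in> B" "coord B (mon i j) b I \<noteq> 0" for i j b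
      using homog[OF that(3)] that mon_xdeg_ydeg[of b] B(1) by auto
    have cJ: "coord B (mon i j) b J = 0" if "mon i j \<notin> B" for i j b
    proof (cases "b \<in> B \<and> coord B (mon i j) b I \<noteq> 0")
      case True
      then show ?thesis
        using S0[OF S_coord[of b i j]] w_nz[of i j b] that by simp
    next
      case False
      then show ?thesis
        using coord_0 coord_notin[OF B(2)] by blast
    qed
    have mem: "mon i j \<in> J" if "mon i j \<notin> B" for i j
      using cJ[OF that] coord_0_iff[OF B(2) idJ] by blast
    have in_B: "b \<in> B" if "coord B (mon i j) b I \<noteq> 0" for i j b
      using that coord_notin[OF BI] by blast
    \<comment> \<open>Weights of both signs would combine to weight 0, where the value is 1,
      although the factors vanish at \<open>J\<close>. The common sign distinguishes the two
      remaining alternatives.\<close>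
    have "\<not> (w > 0 \<and> w' < 0)" if "(w, a) \<in> S" "(w', a') \<in> S" for w a w' a'
    proof
      assume ww: "w > 0 \<and> w' < 0"
      have pow: "(int n * w, a ^ n) \<in> S" if "(w, a) \<in> S" for n w a
        using that by (induction n) (auto simp: S_one algebra_simps dest: S_mult)
      have "(int (nat (- w')) * w + int (nat w) * w', a ^ nat (- w') * a' ^ nat w) \<in> S"
        using that by (intro S_mult pow)
      moreover have "int (nat (- w')) * w + int (nat w) * w' = 0"
        using ww by simp
      ultimately have "a ^ nat (- w') * a' ^ nat w = 1"
        using S_func S_one by metis
      then show False
        using S0[OF that(1)] ww by (simp add: zero_power)
    qed
    then have "(\<forall>(w, a)\<in>S. w \<ge> 0) \<or> (\<forall>(w, a)\<in>S. w \<le> 0)"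
      by (force simp: not_le)
    then show thesis
    proof
      assume *: "\<forall>(w, a)\<in>S. w \<ge> 0"
      have "j < ydeg b" if "mon i j \<notin> B" "coord B (mon i j) b I \<noteq> 0" for i j b
        using * S_coord[OF in_B[OF that(2)] that(2)] w_nz[OF that(1) in_B[OF that(2)] that(2)] by fastforce
      then show thesis
        using that(2) B BI idJ mem by blast
    next
      assume *: "\<forall>(w, a)\<in>S. w \<le> 0"
      have "j > ydeg b" if "mon i j \<notin> B" "coord B (mon i j) b I \<noteq> 0" for i j b
        using * S_coord[OF in_B[OF that(2)] that(2)] w_nz[OF that(1) in_B[OF that(2)] that(2)] by fastforce
      then show thesis
        using that(3) B BI idJ mem by blast
    qed
  qed
qed

section \<open>Monomial ideals of rectangular shape\<close>

definition rect :: "nat \<Rightarrow> nat \<Rightarrow> cxy set" where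
  "rect a b = (\<lambda>(i, j). mon i j) ` ({..<a} \<times> {..<b})"

lemma mon_in_rect [simp]: "mon i j \<in> rect a b \<longleftrightarrow> i < a \<and> j < b"
  by (auto simp: rect_def)

lemma rect_subset_monomials: "rect a b \<subseteq> monomials"
  by (auto simp: rect_def)

lemma finite_rect [simp]: "finite (rect a b)"
  by (simp add: rect_def)

lemma inj_on_mon: "inj_on (\<lambda>(i, j). mon i j) S"
  by (auto simp: inj_on_def)

lemma card_rect: "card (rect a b) = a * b"
  by (simp add: rect_def card_image[OF inj_on_mon])

lemma sum_rect: "sum h (rect a b) = (\<Sum>i<a. \<Sum>j<b. h (mon i j))"
  unfolding rect_def sum.cartesian_product
  by (subst sum.reindex[OF inj_on_mon]) (simp add: case_prod_unfold comp_def)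

lemma coeff_lin_rect:
  "coeff (coeff (lin (rect a b) c) j) i = (if i < a \<and> j < b then c (mon i j) else 0)"
proof -
  have "coeff (coeff (lin (rect a b) c) j) i = (\<Sum>i'<a. \<Sum>j'<b. c (mon i' j') * (if i = i' \<and> j = j' then 1 else 0))"
    by (simp add: lin_def sum_rect coeff_sum coeff_Const_mult coeff_mon)
  also have "\<dots> = (\<Sum>i'<a. \<Sum>j'<b. if i' = i then if j' = j then c (mon i j) else 0 else 0)"
    by (intro sum.cong refl) auto
  also have "\<dots> = (\<Sum>i'<a. if i' = i then (\<Sum>j'<b. if j' = j then c (mon i j) else 0) else 0)"
    by (intro sum.cong refl) auto
  finally show ?thesis
    by (simp add: sum.delta)
qed

text \<open>Read a f + e y^d as a polynomial in y. Below y^d only a f contributes, and by induction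
  its lowest coefficient is x^k times a coefficient of a. The rectangle has x-degrees below k, so
  that coefficient is zero. This covers both f = x^k and the product of lines.\<close>

lemma rect_independent:
  assumes f: "coeff f 0 = monom 1 k" and c: "lin (rect k d) c \<in> ideal_gen {f, varY ^ d}"
  shows "\<forall>b\<in>rect k d. c b = 0"
proof -
  define L where "L = lin (rect k d) c"
  obtain a e where L: "L = a * f + e * varY ^ d"
    using ideal_gen_2[OF c] by (auto simp: L_def)
  have coeff_L: "coeff L j = (\<Sum>l\<le>j. coeff a l * coeff f (j - l))" if "j < d" for j
    using that by (simp add: L varY_power coeff_mult coeff_monom_mult mult.commute[of e])
  have a0: "coeff a j = 0" if "j < d" for j
    using that
  proof (induction j rule: less_induct)
    case (less j)
    have "coeff L j = (\<Sum>l\<in>{j}. coeff a l * coeff f (j - l))"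
      unfolding coeff_L[OF less.prems] using less by (intro sum.mono_neutral_right) auto
    then have "coeff L j = coeff a j * monom 1 k"
      by (simp add: f)
    then have "coeff (coeff a j) i = coeff (coeff L j) (i + k)" for i
      by (simp add: coeff_monom_mult mult.commute[of "coeff a j"])
    also have "coeff (coeff L j) (i + k) = 0" for i
      by (simp add: L_def coeff_lin_rect)
    finally show ?case
      by (intro poly_eqI) simp
  qed
  have "coeff L j = 0" if "j < d" for j
    using that by (simp add: coeff_L a0)
  then have "c (mon i j) = 0" if "i < k" "j < d" for i j
    using coeff_lin_rect[of k d c j i] that by (simp add: L_def)
  then show ?thesis
    by (auto simp: rect_def)
qed

section \<open>Corner ideals\<close>

definition corner_ideal :: "nat \<Rightarrow> nat \<Rightarrow> cxy set" where
  "corner_ideal a b = ideal_gen {varX ^ a, varY ^ b}"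

lemma corner_ideal_is_ideal: "is_ideal (corner_ideal a b)"
  by (simp add: corner_ideal_def is_ideal_ideal_gen)

lemma mon_in_corner_ideal:
  assumes "mon i j \<notin> rect a b"
  shows "mon i j \<in> corner_ideal a b"
proof (cases "i < a")
  case False
  then have "mon i j = mon (i - a) j * mon a 0"
    by (simp add: mon_mult)
  moreover have "mon a 0 \<in> corner_ideal a b"
    by (simp add: corner_ideal_def mon_def ideal_gen_superset)
  ultimately show ?thesis
    by (simp add: ideal_mult corner_ideal_is_ideal)
next
  case True
  then have "mon i j = mon i (j - b) * mon 0 b"
    using assms by (simp add: mon_mult)
  moreover have "mon 0 b \<in> corner_ideal a b"
    by (simp add: corner_ideal_def mon_def ideal_gen_superset)
  ultimately show ?thesis
    by (simp add: ideal_mult corner_ideal_is_ideal)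
qed

lemma represents_single:
  "is_ideal I \<Longrightarrow> finite B \<Longrightarrow> b \<in> B \<Longrightarrow> represents B I b (\<lambda>b'. if b' = b then 1 else 0)"
  by (intro representsI) (auto simp: lin_single ideal_0)

lemma represents_0: "f \<in> I \<Longrightarrow> represents B I f (\<lambda>b. 0)"
  by (intro representsI) (auto simp: lin_def)

lemma basis_corner_ideal: "basis_mod (rect a b) (corner_ideal a b)"
proof (rule basis_modI[OF corner_ideal_is_ideal finite_rect])
  fix i j
  show "\<exists>c. represents (rect a b) (corner_ideal a b) (mon i j) c"
    using represents_single[OF corner_ideal_is_ideal finite_rect] represents_0 mon_in_corner_ideal by metis
next
  fix c assume "lin (rect a b) c \<in> corner_ideal a b"
  moreover have "coeff (varX ^ a) 0 = monom (1 :: complex) a"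
    by (simp add: varX_power)
  ultimately show "\<forall>m\<in>rect a b. c m = 0"
    unfolding corner_ideal_def using rect_independent by blast
qed

lemma corner_ideal_eqI:
  assumes "is_ideal J" "basis_mod (rect a b) J" "\<And>i j. mon i j \<notin> rect a b \<Longrightarrow> mon i j \<in> J"
  shows "J = corner_ideal a b"
  using assms basis_corner_ideal corner_ideal_is_ideal mon_in_corner_ideal
  by (intro basis_mod_ideal_eq[of "rect a b"]) (auto simp: coord_monomial_ideal simp del: mon_in_rect)

lemma corner_ideal_Hilb: "corner_ideal a b \<in> Hilb (a * b)"
  unfolding Hilb_def
  by (intro CollectI conjI exI[of _ "rect a b"] corner_ideal_is_ideal basis_corner_ideal card_rect)

text \<open>Scaling multiplies monomials by nonzero constants, so the image still contains all
  monomials outside the rectangle and is recognized by \<open>corner_ideal_eqI\<close>.\<close>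

lemma corner_ideal_fixed:
  assumes "n = a * b"
  shows "corner_ideal a b \<in> torus_fixed_points n"
  unfolding torus_fixed_points_def
proof (intro CollectI conjI allI impI)
  fix s t :: complex assume st: "s \<noteq> 0 \<and> t \<noteq> 0"
  have "basis_mod (rect a b) (torus_act s t (corner_ideal a b))"
    using st by (intro basis_mod_torus_act rect_subset_monomials basis_corner_ideal corner_ideal_is_ideal) auto
  moreover have "mon i j \<in> torus_act s t (corner_ideal a b)" if "mon i j \<notin> rect a b" for i j
  proof -
    have "Const (1 / (s ^ i * t ^ j)) * mon i j \<in> corner_ideal a b"
      using mon_in_corner_ideal[OF that] by (simp add: ideal_mult corner_ideal_is_ideal)
    then have "scale_vars s t (Const (1 / (s ^ i * t ^ j)) * mon i j) \<in> torus_act s t (corner_ideal a b)"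
      using st by (simp add: torus_act_mem_iff)
    then show ?thesis
      using st by (simp add: scale_vars_Const_mon)
  qed
  ultimately show "torus_act s t (corner_ideal a b) = corner_ideal a b"
    using st by (intro corner_ideal_eqI is_ideal_torus_act corner_ideal_is_ideal) auto
qed (simp add: assms corner_ideal_Hilb)

section \<open>Unions of lines\<close>

lemma represents_sum:
  assumes I: "is_ideal I" and "finite S" and rep: "\<And>l. l \<in> S \<Longrightarrow> represents B I (g l) (c l)"
  shows "represents B I (\<Sum>l\<in>S. Const (e l) * g l) (\<lambda>b. \<Sum>l\<in>S. e l * c l b)"
  using assms(2) rep
proof (induction S)
  case empty
  then show ?case
    using represents_0 ideal_0[OF I] by simp
next
  case (insert l S)
  then show ?case
    using represents_add[OF I represents_scale[OF I, of B "g l" "c l" "e l"]] by simp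
qed

lemma represents_diff_mem:
  assumes I: "is_ideal I" and "f - g \<in> I" "represents B I g c"
  shows "represents B I f c"
  using assms ideal_add[OF I, of "f - g" "g - lin B c"] by (simp add: represents_iff)

text \<open>Rewriting \<open>X\<^sup>k\<close> raises the exponent of \<open>Y\<close>; here \<open>(X, Y)\<close> is \<open>(x, y)\<close> or \<open>(y, x)\<close>.\<close>

lemma represents_rewriting:
  fixes X Y :: cxy
  assumes I: "is_ideal I" and Y: "Y ^ d \<in> I"
    and X: "X ^ k - (\<Sum>l\<in>{1..k}. Const (e l) * (X ^ (k - l) * Y ^ l)) \<in> I"
    and B: "finite B" "B = {X ^ a * Y ^ a' | a a'. a < k \<and> a' < d}"
  shows "\<exists>c. represents B I (X ^ i * Y ^ j) c \<and> (\<forall>b. c b \<noteq> 0 \<longrightarrow>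
    (\<exists>a a'. b = X ^ a * Y ^ a' \<and> a < k \<and> a' < d \<and> a + a' = i + j \<and> (j < a' \<or> (a = i \<and> a' = j))))"
    (is "\<exists>c. ?P i j c")
\<comment> \<open>Each rewriting raises the exponent of Y by l \<ge> 1, and the process stops since
  Y^d lies in the ideal.\<close>
proof (induction "d - j" arbitrary: i j rule: less_induct)
  case less
  consider "j \<ge> d" | "j < d" "i < k" | "j < d" "i \<ge> k"
    by linarith
  then show ?case
  proof cases
    case 1
    then have "Y ^ j = Y ^ (j - d) * Y ^ d"
      by (simp flip: power_add)
    then have "X ^ i * Y ^ j = (X ^ i * Y ^ (j - d)) * Y ^ d"
      by (simp only: mult.assoc)
    then have "X ^ i * Y ^ j \<in> I"
      using ideal_mult[OF I Y] by presburger
    then have "?P i j (\<lambda>b. 0)"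
      by (simp add: represents_0)
    then show ?thesis
      by blast
  next
    case 2
    then have "X ^ i * Y ^ j \<in> B"
      by (auto simp: B)
    then have "?P i j (\<lambda>b. if b = X ^ i * Y ^ j then 1 else 0)"
      using represents_single[OF I B(1)] 2 by auto
    then show ?thesis
      by blast
  next
    case 3
    have "\<forall>l\<in>{1..k}. \<exists>c. ?P (i - l) (j + l) c"
      using 3 by (intro ballI less) auto
    then obtain c where c: "\<And>l. l \<in> {1..k} \<Longrightarrow> ?P (i - l) (j + l) (c l)"
      by metis
    define c' where "c' b = (\<Sum>l\<in>{1..k}. e l * c l b)" for b
    have "X ^ i * Y ^ j - (\<Sum>l\<in>{1..k}. Const (e l) * (X ^ (i - l) * Y ^ (j + l))) =
        (X ^ (i - k) * Y ^ j) * (X ^ k - (\<Sum>l\<in>{1..k}. Const (e l) * (X ^ (k - l) * Y ^ l)))"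
    proof -
      have "Const (e l) * (X ^ (i - l) * Y ^ (j + l)) = (X ^ (i - k) * Y ^ j) * (Const (e l) * (X ^ (k - l) * Y ^ l))"
        if "l \<in> {1..k}" for l
      proof -
        have "(X ^ (i - k) * Y ^ j) * (Const (e l) * (X ^ (k - l) * Y ^ l)) =
            Const (e l) * (X ^ ((i - k) + (k - l)) * Y ^ (j + l))"
          unfolding power_add by (simp only: mult_ac)
        also have "(i - k) + (k - l) = i - l"
          using 3 that by simp
        finally show ?thesis
          by (rule sym)
      qed
      then have "(\<Sum>l\<in>{1..k}. Const (e l) * (X ^ (i - l) * Y ^ (j + l))) =
          (X ^ (i - k) * Y ^ j) * (\<Sum>l\<in>{1..k}. Const (e l) * (X ^ (k - l) * Y ^ l))"
        unfolding sum_distrib_left by (rule sum.cong[OF refl])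
      moreover have "X ^ i * Y ^ j = (X ^ (i - k) * Y ^ j) * X ^ k"
        using 3 by (simp add: mult_ac flip: power_add)
      ultimately show ?thesis
        by (simp only: right_diff_distrib)
    qed
    then have "X ^ i * Y ^ j - (\<Sum>l\<in>{1..k}. Const (e l) * (X ^ (i - l) * Y ^ (j + l))) \<in> I"
      using ideal_mult[OF I X] by simp
    then have "represents B I (X ^ i * Y ^ j) c'"
      unfolding c'_def by (rule represents_diff_mem[OF I]) (use c in \<open>auto intro!: represents_sum[OF I]\<close>)
    moreover have "\<exists>a a'. b = X ^ a * Y ^ a' \<and> a < k \<and> a' < d \<and> a + a' = i + j \<and> (j < a' \<or> (a = i \<and> a' = j))"
      if nz: "c' b \<noteq> 0" for b
    proof -
      obtain l where l: "l \<in> {1..k}" "c l b \<noteq> 0"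
        using nz unfolding c'_def by (metis (no_types, lifting) mult_zero_right sum.neutral)
      then obtain a a' where "b = X ^ a * Y ^ a'" "a < k" "a' < d" "a + a' = (i - l) + (j + l)"
        "j + l < a' \<or> (a = i - l \<and> a' = j + l)"
        using c[OF l(1)] by blast
      then show ?thesis
        using l 3 by (intro exI[of _ a] exI[of _ a']) auto
    qed
    ultimately show ?thesis
      by blast
  qed
qed

lemma linear_prod_dvd:
  assumes "finite R" "\<And>r. r \<in> R \<Longrightarrow> poly p r = (0 :: complex)"
  shows "(\<Prod>r\<in>R. [:- r, 1:]) dvd p"
  using assms
proof (induction R arbitrary: p)
  case (insert r R)
  then obtain q where q: "p = [:- r, 1:] * q"
    by (metis dvdE insertI1 poly_eq_0_iff_dvd)
  \<comment> \<open>The roots are distinct, so the removed factor does not vanish at the remaining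
    ones.\<close>
  have "poly q r' = 0" if "r' \<in> R" for r'
    using insert.prems[of r'] insert.hyps that by (auto simp: q)
  then have "(\<Prod>r\<in>R. [:- r, 1:]) dvd q"
    by (rule insert.IH)
  then show ?case
    using insert.hyps by (simp add: q mult_dvd_mono del: mult_pCons_left)
qed simp

text \<open>The roots of unity are replaced by an arbitrary set of ratios x / y, a family stable
  under the torus, so orbits can be computed within it.\<close>

definition lines_ideal :: "nat \<Rightarrow> complex set \<Rightarrow> cxy set" where
  "lines_ideal d R = ideal_gen {\<Prod>r\<in>R. (varX - Const r * varY), varX ^ d, varY ^ d}"

lemma lines_ideal_is_ideal: "is_ideal (lines_ideal d R)"
  by (simp add: lines_ideal_def is_ideal_ideal_gen)

lemma lines_ideal_gens:
  "(\<Prod>r\<in>R. (varX - Const r * varY)) \<in> lines_ideal d R" "varX ^ d \<in> lines_ideal d R" "varY ^ d \<in> lines_ideal d R"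
  by (auto simp: lines_ideal_def intro: ideal_gen_superset)

text \<open>The substitution turns x - r y into s (x - r (t / s) y), so only t / s matters. One
  inclusion is checked on generators; the inverse torus element gives the other.\<close>

lemma torus_act_lines_ideal:
  assumes "s \<noteq> 0" "t \<noteq> 0"
  shows "torus_act s t (lines_ideal d R) = lines_ideal d ((\<lambda>r. r * (t / s)) ` R)"
proof -
  have sub: "lines_ideal d ((\<lambda>r. r * (t / s)) ` R) \<subseteq> torus_act s t (lines_ideal d R)"
    if st: "s \<noteq> 0" "t \<noteq> 0" for s t R
    unfolding lines_ideal_def[of d "(\<lambda>r. r * (t / s)) ` R"]
  proof (rule ideal_gen_minimal)
    have inj: "inj_on (\<lambda>r. r * (t / s)) R"
      using st by (auto simp: inj_on_def)
    have unit: "f \<in> torus_act s t (lines_ideal d R)"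
      if "Const c * f = scale_vars s t g" "g \<in> lines_ideal d R" "c \<noteq> 0" for c f g
    proof -
      have "Const c * f \<in> torus_act s t (lines_ideal d R)"
        using that st by (simp add: torus_act_mem_iff)
      then have "Const (1 / c) * (Const c * f) \<in> torus_act s t (lines_ideal d R)"
        by (rule ideal_mult[OF is_ideal_torus_act[OF lines_ideal_is_ideal st]])
      also have "Const (1 / c) * (Const c * f) = f"
        using that(3) by (simp add: mult.assoc[symmetric] flip: Const_mult)
      finally show ?thesis .
    qed
    have lin: "scale_vars s t (varX - Const r * varY) = Const s * (varX - Const (r * (t / s)) * varY)" for r
    proof -
      have "Const (r * t) = Const s * Const (r * (t / s))"
        using st by (simp flip: Const_mult)
      then show ?thesis
        by (simp add: scale_vars_linear right_diff_distrib mult.assoc)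
    qed
    have "Const (s ^ card R) * (\<Prod>r\<in>(\<lambda>r. r * (t / s)) ` R. varX - Const r * varY) =
        scale_vars s t (\<Prod>r\<in>R. varX - Const r * varY)"
    proof -
      have "Const (s ^ n) = Const s ^ n" for n
        by (induction n) (simp_all add: Const_mult)
      then show ?thesis
        by (subst prod.reindex[OF inj]) (simp add: scale_vars_prod lin prod.distrib)
    qed
    moreover have "Const (s ^ d) * varX ^ d = scale_vars s t (varX ^ d)" "Const (t ^ d) * varY ^ d = scale_vars s t (varY ^ d)"
      using scale_vars_mon[of s t d 0] scale_vars_mon[of s t 0 d] by (simp_all add: mon_def)
    ultimately show "{\<Prod>r\<in>(\<lambda>r. r * (t / s)) ` R. varX - Const r * varY, varX ^ d, varY ^ d}
        \<subseteq> torus_act s t (lines_ideal d R)"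
      using unit lines_ideal_gens[where R = R] st by auto
  qed (use st in \<open>simp add: is_ideal_torus_act lines_ideal_is_ideal\<close>)
  have "(\<lambda>r. r * ((1 / t) / (1 / s))) ` (\<lambda>r. r * (t / s)) ` R = R"
    using assms by (simp add: image_image)
  then have "lines_ideal d R \<subseteq> torus_act (1 / s) (1 / t) (lines_ideal d ((\<lambda>r. r * (t / s)) ` R))"
    using sub[of "1 / s" "1 / t" "(\<lambda>r. r * (t / s)) ` R"] assms by simp
  then have "torus_act s t (lines_ideal d R) \<subseteq>
      torus_act s t (torus_act (1 / s) (1 / t) (lines_ideal d ((\<lambda>r. r * (t / s)) ` R)))"
    unfolding torus_act_def by (rule image_mono)
  also have "\<dots> = lines_ideal d ((\<lambda>r. r * (t / s)) ` R)"
    using assms by (simp add: torus_act_torus_act)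
  finally show ?thesis
    using sub[OF assms] by blast
qed

text \<open>\<open>roots\<close> makes F divide z^d - v, so that x^d is generated by the form and
  y^d. \<open>R0\<close> makes the constant term of F nonzero, so that y^k can be rewritten just as
  x^k can. The value v is left free because the torus rescales it.\<close>

locale lines =
  fixes k d :: nat and R :: "complex set" and v :: complex
  assumes k: "k \<ge> 1" "k < d" and fin: "finite R" and card_R: "card R = k" and R0: "0 \<notin> R"
    and roots: "\<And>r. r \<in> R \<Longrightarrow> r ^ d = v"
begin

abbreviation "I \<equiv> lines_ideal d R"

abbreviation "F \<equiv> \<Prod>r\<in>R. [:- r, 1:]"

lemma hom_F: "(\<Prod>r\<in>R. (varX - Const r * varY)) = hom_poly k F"
  using hom_poly_linear_prod[OF fin] by (simp add: card_R)

lemma hom_F_mem: "hom_poly k F \<in> I"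
  using lines_ideal_gens(1)[of R d] by (simp add: hom_F)

text \<open>Homogenizing F Q = z^d - v exhibits x^d - v y^d as a multiple of the form. The two
  generators are the shape that \<open>rect_independent\<close> asks for.\<close>

lemma lines_ideal_eq: "I = ideal_gen {hom_poly k F, varY ^ d}"
proof
  have "F dvd monom 1 d - [:v:]"
    by (rule linear_prod_dvd[OF fin]) (simp add: poly_monom roots)
  then obtain Q where Q: "monom 1 d - [:v:] = F * Q"
    by (rule dvdE)
  have deg: "degree (monom 1 d - [:v:]) = d"
  proof -
    have "monom 1 d - [:v:] = monom 1 d + [:- v:]"
      by simp
    also have "degree \<dots> = d"
      using k by (subst degree_add_eq_left) (simp_all add: degree_monom_eq)
    finally show ?thesis .
  qed
  then have "F \<noteq> 0" "Q \<noteq> 0"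
    using Q k by auto
  then have "degree Q = d - k"
    using deg by (simp add: Q degree_mult_eq degree_linear_prod card_R)
  then have "hom_poly (k + (d - k)) (F * Q) = hom_poly k F * hom_poly (d - k) Q"
    by (intro hom_poly_mult) (simp_all add: degree_linear_prod card_R)
  then have "hom_poly d (monom 1 d - monom v 0) = hom_poly k F * hom_poly (d - k) Q"
    using k by (simp add: Q[symmetric] monom_0)
  then have "varX ^ d = hom_poly (d - k) Q * hom_poly k F + Const v * varY ^ d"
    by (simp add: hom_poly_diff hom_poly_monom mon_def algebra_simps)
  also have "\<dots> \<in> ideal_gen {hom_poly k F, varY ^ d}"
    by (intro ideal_add ideal_mult is_ideal_ideal_gen ideal_gen_superset) auto
  finally have "varX ^ d \<in> ideal_gen {hom_poly k F, varY ^ d}" .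
  then show "I \<subseteq> ideal_gen {hom_poly k F, varY ^ d}"
    unfolding lines_ideal_def hom_F
    by (intro ideal_gen_minimal is_ideal_ideal_gen) (auto intro: ideal_gen_superset)
  show "ideal_gen {hom_poly k F, varY ^ d} \<subseteq> I"
    using hom_F_mem lines_ideal_gens by (intro ideal_gen_minimal lines_ideal_is_ideal) auto
qed

lemma rect_alt: "rect k d = {varX ^ a * varY ^ a' | a a'. a < k \<and> a' < d}"
  and rect_alt': "rect d k = {varY ^ a * varX ^ a' | a a'. a < k \<and> a' < d}"
  by (auto simp: rect_def mon_def mult.commute)

lemma hom_F_x: "hom_poly k F = varX ^ k - (\<Sum>l\<in>{1..k}. Const (- coeff F (k - l)) * (varX ^ (k - l) * varY ^ l))"
proof -
  have "hom_poly k F = Const (coeff F k) * mon k 0 + (\<Sum>i<k. Const (coeff F i) * mon i (k - i))"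
    unfolding hom_poly_def by (simp add: lessThan_Suc_atMost[symmetric] add.commute)
  also have "(\<Sum>i<k. Const (coeff F i) * mon i (k - i)) = (\<Sum>l\<in>{1..k}. Const (coeff F (k - l)) * mon (k - l) l)"
    by (rule sum.reindex_bij_witness[of _ "\<lambda>l. k - l" "\<lambda>i. k - i"]) auto
  finally show ?thesis
    using lead_coeff_linear_prod[of R] by (simp add: card_R mon_def Const_minus sum_negf)
qed

text \<open>Division by the constant coefficient, nonzero because 0 is not a root, makes y^k the
  leading term for the opposite order of the variables.\<close>

lemma hom_F_y: "Const (1 / coeff F 0) * hom_poly k F =
    varY ^ k - (\<Sum>l\<in>{1..k}. Const (- (coeff F l / coeff F 0)) * (varY ^ (k - l) * varX ^ l))"
proof -
  have F0: "coeff F 0 \<noteq> 0"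
    using coeff_0_linear_prod[OF R0 fin] .
  have "{..k} = insert 0 {1..k}"
    by auto
  then have "hom_poly k F = Const (coeff F 0) * mon 0 k + (\<Sum>l\<in>{1..k}. Const (coeff F l) * mon l (k - l))"
    unfolding hom_poly_def by simp
  then have "Const (1 / coeff F 0) * hom_poly k F = Const (1 / coeff F 0) * (Const (coeff F 0) * mon 0 k) +
      (\<Sum>l\<in>{1..k}. Const (1 / coeff F 0) * (Const (coeff F l) * mon l (k - l)))"
    by (simp only: distrib_left sum_distrib_left)
  also have "Const (1 / coeff F 0) * (Const (coeff F 0) * mon 0 k) = varY ^ k"
    using F0 by (simp add: mult.assoc[symmetric] mon_def flip: Const_mult)
  also have "(\<Sum>l\<in>{1..k}. Const (1 / coeff F 0) * (Const (coeff F l) * mon l (k - l))) =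
      (\<Sum>l\<in>{1..k}. Const (coeff F l / coeff F 0) * (varY ^ (k - l) * varX ^ l))"
    by (simp add: mult.assoc[symmetric] flip: Const_mult) (simp add: mon_def mult_ac)
  finally show ?thesis
    by (simp add: Const_minus sum_negf)
qed

lemma represents_x:
  "\<exists>c. represents (rect k d) I (mon i j) c \<and> (\<forall>b. c b \<noteq> 0 \<longrightarrow>
    (\<exists>a a'. b = mon a a' \<and> a < k \<and> a' < d \<and> a + a' = i + j \<and> (j < a' \<or> (a = i \<and> a' = j))))"
  unfolding mon_def
  by (rule represents_rewriting[OF lines_ideal_is_ideal lines_ideal_gens(3) _ finite_rect rect_alt])
    (use hom_F_mem in \<open>simp only: hom_F_x\<close>)

lemma represents_y:
  "\<exists>c. represents (rect d k) I (mon i j) c \<and> (\<forall>b. c b \<noteq> 0 \<longrightarrow>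
    (\<exists>a a'. b = mon a' a \<and> a < k \<and> a' < d \<and> a + a' = j + i \<and> (i < a' \<or> (a = j \<and> a' = i))))"
  unfolding mon_def mult.commute[of "varX ^ _"]
  by (rule represents_rewriting[OF lines_ideal_is_ideal lines_ideal_gens(2) _ finite_rect rect_alt',
        where e = "\<lambda>l. - (coeff F l / coeff F 0)"])
    (use ideal_mult[OF lines_ideal_is_ideal hom_F_mem] in \<open>simp only: hom_F_y[symmetric]\<close>)

lemma basis_x: "basis_mod (rect k d) I"
proof (rule basis_modI[OF lines_ideal_is_ideal finite_rect])
  fix c assume "lin (rect k d) c \<in> I"
  moreover have "coeff (hom_poly k F) 0 = monom 1 k"
    using lead_coeff_linear_prod[of R] by (intro poly_eqI) (auto simp: coeff_hom_poly card_R)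
  ultimately show "\<forall>b\<in>rect k d. c b = 0"
    unfolding lines_ideal_eq using rect_independent by blast
next
  fix i j
  show "\<exists>c. represents (rect k d) I (mon i j) c"
    using represents_x[of i j] by blast
qed

text \<open>Rewriting y^k shows that this rectangle spans, and it has the same size as the basis
  \<open>rect k d\<close>.\<close>

lemma basis_y: "basis_mod (rect d k) I"
proof (rule basis_mod_spanning[OF basis_x lines_ideal_is_ideal finite_rect _ _ rect_subset_monomials])
  fix i j
  show "\<exists>c. represents (rect d k) I (mon i j) c"
    using represents_y[of i j] by blast
qed (simp add: card_rect)

lemma coord_x:
  assumes "mon i j \<notin> rect k d" "coord (rect k d) (mon i j) b I \<noteq> 0"
  shows "j < ydeg b"
proof -
  obtain c where c: "represents (rect k d) I (mon i j) c" "\<And>b. c b \<noteq> 0 \<Longrightarrow>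
    (\<exists>a a'. b = mon a a' \<and> a < k \<and> a' < d \<and> a + a' = i + j \<and> (j < a' \<or> (a = i \<and> a' = j)))"
    using represents_x by blast
  then obtain a a' where "b = mon a a'" "a < k" "a' < d" "j < a' \<or> (a = i \<and> a' = j)"
    using coord_eqI[OF basis_x c(1)] assms(2) by metis
  then show ?thesis
    using assms(1) by auto
qed

text \<open>Rewriting y^k raises the x-exponent and, as degrees are preserved, lowers the
  y-exponent. The first serves the limit at the corner, the second the uniqueness of standard
  monomials.\<close>

lemma coord_y:
  assumes "mon i j \<notin> rect d k" "coord (rect d k) (mon i j) b I \<noteq> 0"
  shows "i < xdeg b" "ydeg b < j"
proof -
  obtain c where c: "represents (rect d k) I (mon i j) c" "\<And>b. c b \<noteq> 0 \<Longrightarrow>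
    (\<exists>a a'. b = mon a' a \<and> a < k \<and> a' < d \<and> a + a' = j + i \<and> (i < a' \<or> (a = j \<and> a' = i)))"
    using represents_y by blast
  then obtain a a' where "b = mon a' a" "a < k" "a' < d" "a + a' = j + i" "i < a' \<or> (a = j \<and> a' = i)"
    using coord_eqI[OF basis_y c(1)] assms(2) by metis
  then show "i < xdeg b" "ydeg b < j"
    using assms(1) by auto
qed

lemma torus_act_diag: "s \<noteq> 0 \<Longrightarrow> torus_act s s I = I"
  by (simp add: torus_act_lines_ideal)

lemma torus_orbit_eq: "torus_orbit I = {torus_act 1 t I | t. t \<noteq> 0}"
proof
  show "torus_orbit I \<subseteq> {torus_act 1 t I | t. t \<noteq> 0}"
  proof
    fix J assume "J \<in> torus_orbit I"
    then obtain s t where st: "J = torus_act s t I" "s \<noteq> 0" "t \<noteq> 0"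
      by (auto simp: torus_orbit_def)
    then have "J = torus_act 1 (t / s) I"
      by (simp add: torus_act_lines_ideal)
    then show "J \<in> {torus_act 1 t I | t. t \<noteq> 0}"
      using st by (metis (mono_tags, lifting) divide_eq_0_iff mem_Collect_eq)
  qed
qed (auto intro: torus_orbitI)

lemma I_Hilb: "I \<in> Hilb (d * k)"
  using basis_x lines_ideal_is_ideal card_rect[of k d] by (auto simp: Hilb_def mult.commute)

lemma card_rectes: "card (rect k d) = d * k" "card (rect d k) = d * k"
  by (simp_all add: card_rect mult.commute)

lemma one_dim: "torus_orbit I \<in> one_dim_orbits (d * k)"
proof -
  \<comment> \<open>x^k lies outside \<open>rect k d\<close> but is a basis element for
    \<open>rect d k\<close>, hence nonzero modulo \<open>I\<close>: it supplies a nontrivial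
    weight.\<close>
  have "mon k 0 \<in> rect d k"
    using k by simp
  then have "mon k 0 \<notin> I"
    using basis_mod_notin[OF basis_y lines_ideal_is_ideal] by blast
  then obtain b where b: "coord (rect k d) (mon k 0) b I \<noteq> 0"
    using coord_0_iff[OF basis_x lines_ideal_is_ideal] by blast
  then have "b \<in> rect k d" "ydeg b \<noteq> 0"
    using coord_notin[OF basis_x] coord_x[of k 0 b] by auto
  then have "krull_dim (subtopology (hilb_zariski (d * k)) (torus_orbit I)) = 1"
    using krull_dim_eq_1[OF lines_ideal_is_ideal rect_subset_monomials basis_x card_rectes(1) torus_orbit_eq _ b]
    by simp
  then show ?thesis
    using I_Hilb by (auto simp: one_dim_orbits_def)
qed

lemma orbit_closure:
  "hilb_zariski (d * k) closure_of torus_orbit I = torus_orbit I \<union> {corner_ideal k d, corner_ideal d k}"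
proof
  have "torus_orbit I \<subseteq> topspace (hilb_zariski (d * k))"
    using irreducible_orbit(2)[OF lines_ideal_is_ideal rect_subset_monomials basis_x card_rectes(1) refl]
    by (auto simp: topspace_subtopology)
  then have "torus_orbit I \<subseteq> hilb_zariski (d * k) closure_of torus_orbit I"
    by (rule closure_of_subset)
  \<comment> \<open>Here t tends to 0, below s does: reduction to \<open>rect k d\<close> raises
    y-exponents, reduction to \<open>rect d k\<close> raises x-exponents.\<close>
  moreover have "corner_ideal k d \<in> hilb_zariski (d * k) closure_of torus_orbit I"
    by (rule limit_in_closure[OF lines_ideal_is_ideal rect_subset_monomials basis_x card_rectes(1)
          corner_ideal_is_ideal basis_corner_ideal, where \<alpha> = 0 and \<beta> = 1])
      (auto simp: mon_in_corner_ideal dest: coord_x simp del: mon_in_rect)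
  moreover have "corner_ideal d k \<in> hilb_zariski (d * k) closure_of torus_orbit I"
    by (rule limit_in_closure[OF lines_ideal_is_ideal rect_subset_monomials basis_y card_rectes(2)
          corner_ideal_is_ideal basis_corner_ideal, where \<alpha> = 1 and \<beta> = 0])
      (auto simp: mon_in_corner_ideal dest: coord_y simp del: mon_in_rect)
  ultimately show "torus_orbit I \<union> {corner_ideal k d, corner_ideal d k} \<subseteq>
      hilb_zariski (d * k) closure_of torus_orbit I"
    by blast
  show "hilb_zariski (d * k) closure_of torus_orbit I \<subseteq> torus_orbit I \<union> {corner_ideal k d, corner_ideal d k}"
  proof
    fix J assume J: "J \<in> hilb_zariski (d * k) closure_of torus_orbit I"
    show "J \<in> torus_orbit I \<union> {corner_ideal k d, corner_ideal d k}"
    proof (rule closure_of_one_dim_orbit[OF lines_ideal_is_ideal torus_orbit_eq torus_act_diag J])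
      fix B assume B: "B \<subseteq> monomials" "basis_mod B I" "basis_mod B J" "is_ideal J"
        "\<And>i j. mon i j \<notin> B \<Longrightarrow> mon i j \<in> J"
        "\<And>i j b. mon i j \<notin> B \<Longrightarrow> coord B (mon i j) b I \<noteq> 0 \<Longrightarrow> j < ydeg b"
      \<comment> \<open>The y-exponent serves as height here; its negative does in the other
        case.\<close>
      have "B = rect k d"
        using B(6) coord_x
        by (intro standard_monomials_unique[OF lines_ideal_is_ideal B(1,2) rect_subset_monomials basis_x,
              of "\<lambda>b. int (ydeg b)"]) (auto simp del: mon_in_rect)
      then show ?thesis
        using corner_ideal_eqI[of J k d] B by blast
    next
      fix B assume B: "B \<subseteq> monomials" "basis_mod B I" "basis_mod B J" "is_ideal J"
        "\<And>i j. mon i j \<notin> B \<Longrightarrow> mon i j \<in> J"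
        "\<And>i j b. mon i j \<notin> B \<Longrightarrow> coord B (mon i j) b I \<noteq> 0 \<Longrightarrow> j > ydeg b"
      have "B = rect d k"
        using B(6) coord_y
        by (intro standard_monomials_unique[OF lines_ideal_is_ideal B(1,2) rect_subset_monomials basis_y,
              of "\<lambda>b. - int (ydeg b)"]) (auto simp del: mon_in_rect)
      then show ?thesis
        using corner_ideal_eqI[of J d k] B by blast
    qed auto
  qed
qed

lemma corner_ideals_neq: "corner_ideal k d \<noteq> corner_ideal d k"
proof
  assume "corner_ideal k d = corner_ideal d k"
  then have "mon k 0 \<in> corner_ideal d k"
    using mon_in_corner_ideal[of k 0 k d] by simp
  then show False
    using basis_mod_notin[OF basis_corner_ideal corner_ideal_is_ideal, of "mon k 0" d k] k by simp
qed

lemma orbit_between: "torus_orbit I \<in> orbits_between (d * k) (corner_ideal k d) (corner_ideal d k)"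
  using one_dim orbit_closure corner_ideals_neq corner_ideal_fixed[of "d * k" k d] corner_ideal_fixed[of "d * k" d k]
  by (simp add: orbits_between_def has_limit_points_def mult.commute)

end

section \<open>Orbits joining the two corner ideals\<close>

text \<open>Inequalities in each degree with equal totals are equalities, so both sets have the same
  degrees with multiplicity.\<close>

lemma graded_sum_eq:
  fixes \<delta> :: "'a \<Rightarrow> int"
  assumes fin: "finite S" "finite T" and card: "card S = card T"
    and le: "\<And>m. card {x\<in>S. \<delta> x = m} \<le> card {x\<in>T. \<delta> x = m}"
  shows "sum \<delta> S = sum \<delta> T"
proof -
  define R where "R = \<delta> ` S \<union> \<delta> ` T"
  have R: "finite R" "\<delta> ` S \<subseteq> R" "\<delta> ` T \<subseteq> R"
    using fin by (auto simp: R_def)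
  have "(\<Sum>m\<in>R. card {x\<in>S. \<delta> x = m}) = (\<Sum>m\<in>R. card {x\<in>T. \<delta> x = m})"
    using sum_fun_comp[OF fin(1) R(1,2), of "\<lambda>_. 1 :: nat"] sum_fun_comp[OF fin(2) R(1,3), of "\<lambda>_. 1 :: nat"] card
    by simp
  then have eq: "card {x\<in>S. \<delta> x = m} = card {x\<in>T. \<delta> x = m}" if "m \<in> R" for m
    by (rule sum_mono_inv[OF _ le that R(1)])
  show ?thesis
    using sum_fun_comp[OF fin(1) R(1,2), of "\<lambda>m. m"] sum_fun_comp[OF fin(2) R(1,3), of "\<lambda>m. m"] eq by simp
qed

text \<open>Stated for twice the sum, so that the triangular numbers need no division.\<close>

lemma sum_rect_weight:
  "2 * (\<Sum>m\<in>rect a b. \<alpha> * int (xdeg m) + \<beta> * int (ydeg m)) =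
    \<alpha> * (int b * (int a * (int a - 1))) + \<beta> * (int a * (int b * (int b - 1)))"
proof -
  have gauss: "2 * (\<Sum>i<n. int i) = int n * (int n - 1)" for n
    by (induction n) (simp_all add: algebra_simps)
  have "(\<Sum>m\<in>rect a b. \<alpha> * int (xdeg m) + \<beta> * int (ydeg m)) =
      \<alpha> * (int b * (\<Sum>i<a. int i)) + \<beta> * (int a * (\<Sum>j<b. int j))"
    by (simp add: sum_rect sum.distrib sum_distrib_left mult_ac)
  then have "2 * (\<Sum>m\<in>rect a b. \<alpha> * int (xdeg m) + \<beta> * int (ydeg m)) =
      \<alpha> * (int b * (2 * (\<Sum>i<a. int i))) + \<beta> * (int a * (2 * (\<Sum>j<b. int j)))"
    by (simp add: algebra_simps)
  then show ?thesis
    by (simp only: gauss)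
qed

text \<open>All weights are orthogonal to some \<open>(\<alpha>, \<beta>)\<close>, so that both rectangles are homogeneous bases of
  the same quotient for the corresponding grading.  Comparing the sums of the degrees of their
  elements gives \<open>\<alpha> = \<beta>\<close>.\<close>

lemma one_dim_orbit_homogeneous:
  assumes I: "is_ideal I" and B: "basis_mod (rect a b) I" "basis_mod (rect b a) I"
    and ab: "a \<noteq> b" "a > 0" "b > 0" and n: "n = a * b"
    and dim: "krull_dim (subtopology (hilb_zariski n) (torus_orbit I)) = 1"
    and nz: "coord (rect a b) (mon i j) m I \<noteq> 0"
  shows "int (xdeg m) + int (ydeg m) = int i + int j"
proof -
  have parallel: "(int (xdeg m) - int i) * (int (ydeg m') - int j') = (int (xdeg m') - int i') * (int (ydeg m) - int j)"
    if "coord (rect a b) (mon i j) m I \<noteq> 0" "coord (rect a b) (mon i' j') m' I \<noteq> 0" for i j m i' j' m'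
    using one_dim_orbit_weights_parallel[OF I rect_subset_monomials B(1) _ dim _ that(1) _ that(2)]
      coord_notin[OF B(1)] that card_rect n by blast
  \<comment> \<open>A monomial of one rectangle outside the other is nonzero modulo
    \<open>I\<close>; its expansion yields a nonzero weight.\<close>
  obtain i0 j0 where m0: "mon i0 j0 \<in> rect b a" "mon i0 j0 \<notin> rect a b"
    using ab by (cases "a < b") (auto intro: that[of a 0] that[of 0 b])
  then have "mon i0 j0 \<notin> I"
    using basis_mod_notin[OF B(2) I] by blast
  then obtain b0 where b0: "coord (rect a b) (mon i0 j0) b0 I \<noteq> 0"
    using coord_0_iff[OF B(1) I] by blast
  then have "b0 \<in> rect a b"
    using coord_notin[OF B(1)] by blast
  then have b0': "b0 \<noteq> mon i0 j0" "mon (xdeg b0) (ydeg b0) = b0"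
    using m0 mon_xdeg_ydeg rect_subset_monomials by auto
  \<comment> \<open>That weight turned by a right angle; by parallelism every weight is orthogonal
    to it.\<close>
  define \<alpha> \<beta> where "\<alpha> = int j0 - int (ydeg b0)" and "\<beta> = int (xdeg b0) - int i0"
  define \<delta> where "\<delta> m = \<alpha> * int (xdeg m) + \<beta> * int (ydeg m)" for m
  have nonzero: "\<alpha> \<noteq> 0 \<or> \<beta> \<noteq> 0"
    using b0' by (auto simp: \<alpha>_def \<beta>_def)
  have \<delta>: "\<alpha> * (int (xdeg m) - int i) + \<beta> * (int (ydeg m) - int j) = 0"
    if "coord (rect a b) (mon i j) m I \<noteq> 0" for i j m
    using parallel[OF b0 that] by (simp add: \<alpha>_def \<beta>_def algebra_simps)
  have "card {m\<in>rect b a. \<delta> m = l} \<le> card {m\<in>rect a b. \<delta> m = l}" for l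
  proof (rule graded_card_le[OF B I])
    fix m m' assume "m' \<in> rect b a" "coord (rect a b) m' m I \<noteq> 0"
    moreover have "mon (xdeg m') (ydeg m') = m'"
      using \<open>m' \<in> rect b a\<close> mon_xdeg_ydeg rect_subset_monomials by auto
    ultimately show "\<delta> m = \<delta> m'"
      using \<delta>[of "xdeg m'" "ydeg m'" m] by (simp add: \<delta>_def algebra_simps)
  qed
  then have "sum \<delta> (rect b a) = sum \<delta> (rect a b)"
    by (intro graded_sum_eq) (simp_all add: card_rect)
  then have "\<alpha> * (int a * (int b * (int b - 1))) + \<beta> * (int b * (int a * (int a - 1))) =
      \<alpha> * (int b * (int a * (int a - 1))) + \<beta> * (int a * (int b * (int b - 1)))"
    using sum_rect_weight[of \<alpha> \<beta> b a] sum_rect_weight[of \<alpha> \<beta> a b] by (simp add: \<delta>_def)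
  then have "(\<alpha> - \<beta>) * (int a * int b * (int b - int a)) = 0"
    by (simp add: algebra_simps)
  then have "\<alpha> = \<beta>"
    using ab by simp
  then have "\<alpha> * ((int (xdeg m) + int (ydeg m)) - (int i + int j)) = 0"
    using \<delta>[OF nz] by (simp add: algebra_simps)
  then show ?thesis
    using nonzero \<open>\<alpha> = \<beta>\<close> by simp
qed

lemma chart_functions_power: "\<phi> \<in> chart_functions B \<Longrightarrow> (\<lambda>I. \<phi> I ^ N) \<in> chart_functions B"
  by (induction N) (auto intro: chart_functions.intros)

text \<open>Otherwise a product of powers of two coordinates would be a nonzero constant on the orbit but
  vanish at the monomial ideal.\<close>

lemma no_opposite_weights:
  assumes I: "is_ideal I" and cl: "corner_ideal a b \<in> hilb_zariski n closure_of torus_orbit I"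
    and B: "basis_mod (rect a b) I" and n: "n = a * b"
    and hom: "\<And>i j m. coord (rect a b) (mon i j) m I \<noteq> 0 \<Longrightarrow> int (xdeg m) + int (ydeg m) = int i + int j"
    and pos: "coord (rect a b) (mon i j) m I \<noteq> 0" "j < ydeg m" "mon i j \<notin> rect a b"
    and neg: "coord (rect a b) (mon i' j') m' I \<noteq> 0" "ydeg m' < j'"
  shows False
proof -
  \<comment> \<open>By homogeneity the weights are N (-1, 1) and N' (1, -1); the exponents N' and N
    make them cancel.\<close>
  define N where "N = ydeg m - j"
  define N' where "N' = j' - ydeg m'"
  define c where "c = coord (rect a b) (mon i j) m I ^ N' * coord (rect a b) (mon i' j') m' I ^ N"
  define \<phi> where "\<phi> K = coord (rect a b) (mon i j) m K ^ N' * coord (rect a b) (mon i' j') m' K ^ N" for K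
  have N: "int N = int (ydeg m) - int j" "int N' = int j' - int (ydeg m')" "N' > 0"
    using pos neg by (auto simp: N_def N'_def)
  have w: "int (xdeg m) - int i = - int N" "int (xdeg m') - int i' = int N'" "int (ydeg m') - int j' = - int N'"
    using hom[OF pos(1)] hom[OF neg(1)] N by auto
  have in_B: "m \<in> rect a b" "m' \<in> rect a b"
    using pos neg coord_notin[OF B] by blast+
  have "(\<lambda>K. \<phi> K + (- c)) \<in> chart_functions (rect a b)"
    unfolding \<phi>_def using in_B by (intro chart_functions.intros chart_functions_power)
  moreover have "\<phi> (torus_act s t I) + (- c) = 0" if st: "s \<noteq> 0" "t \<noteq> 0" for s t
  proof -
    have "(s powi (- int N) * t powi int N) ^ N' * (s powi int N' * t powi (- int N')) ^ N = 1"
      using st by (simp add: power_int_minus power_mult_distrib field_simps flip: power_mult)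
    then show ?thesis
      using st by (simp add: \<phi>_def c_def coord_torus_act[OF rect_subset_monomials B I] w power_mult_distrib mult_ac
          flip: N(1))
  qed
  ultimately have "\<phi> (corner_ideal a b) + (- c) = 0"
    using closure_relation[OF cl _ rect_subset_monomials basis_corner_ideal] corner_ideal_Hilb n by blast
  moreover have "\<phi> (corner_ideal a b) = 0"
    using coord_monomial_ideal[OF corner_ideal_is_ideal basis_corner_ideal mon_in_corner_ideal, of a b i j m] pos N(3)
    by (simp add: \<phi>_def del: mon_in_rect)
  ultimately show False
    using pos neg by (simp add: c_def)
qed

text \<open>With no terms outside the rectangle, the form is a combination of basis elements, so it
  lies in \<open>I\<close> only if it is zero.\<close>

lemma hom_poly_mem_basis:
  assumes B: "basis_mod (rect a b) I" "is_ideal I" and mem: "hom_poly n p \<in> I"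
    and out: "\<And>i. i \<le> n \<Longrightarrow> \<not> (i < a \<and> n - i < b) \<Longrightarrow> coeff p i = 0" and i: "i \<le> n"
  shows "coeff p i = 0"
proof (cases "i < a \<and> n - i < b")
  case True
  define c where "c m = (if xdeg m + ydeg m = n then coeff p (xdeg m) else 0)" for m
  have "hom_poly n p = lin (rect a b) c"
  proof (rule cxy_eqI)
    fix j i show "coeff (coeff (hom_poly n p) j) i = coeff (coeff (lin (rect a b) c) j) i"
      using out[of i] by (auto simp: coeff_hom_poly coeff_lin_rect c_def)
  qed
  then have "c (mon i (n - i)) = 0"
    using basis_mod_independent[OF B(1), of c "mon i (n - i)"] mem True B(2) by simp
  then show ?thesis
    using i by (simp add: c_def)
qed (use out i in blast)

text \<open>The d distinct solutions of z^d = c are shared between F and Q, whose degrees add up to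
  at most d. So F has k distinct roots and, being monic, is the product of its linear
  factors.\<close>

lemma factor_of_binomial:
  assumes FQ: "F * Q = monom 1 d - [:c:]" and F: "coeff F k = 1" "degree F = k" and c: "c \<noteq> 0" and d: "d > 0"
  shows "F = (\<Prod>r\<in>{z. poly F z = 0}. [:- r, 1:])" "card {z. poly F z = 0} = k"
    "\<And>z. poly F z = 0 \<Longrightarrow> z ^ d = (c :: complex)"
proof -
  have ev: "poly F z * poly Q z = z ^ d - c" for z
    using arg_cong[OF FQ, of "\<lambda>p. poly p z"] by (simp add: poly_monom)
  show root: "z ^ d = c" if "poly F z = 0" for z
    using ev[of z] that by simp
  have "monom 1 d - [:c:] \<noteq> 0"
  proof
    assume "monom 1 d - [:c:] = 0"
    then have "coeff (monom 1 d - [:c:]) 0 = 0"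
      by simp
    then show False
      using c d by simp
  qed
  then have nz: "F \<noteq> 0" "Q \<noteq> 0"
    using FQ by auto
  have "degree (F * Q) \<le> d"
    unfolding FQ by (intro degree_diff_le) (auto simp: degree_monom_le)
  then have deg: "degree F + degree Q \<le> d"
    using nz by (simp add: degree_mult_eq)
  have "{z. z ^ d = c} \<subseteq> {z. poly F z = 0} \<union> {z. poly Q z = 0}"
  proof
    fix z assume "z \<in> {z. z ^ d = c}"
    then have "poly F z * poly Q z = 0"
      by (simp add: ev)
    then show "z \<in> {z. poly F z = 0} \<union> {z. poly Q z = 0}"
      by simp
  qed
  then have "card {z. z ^ d = c} \<le> card ({z. poly F z = 0} \<union> {z. poly Q z = 0})"
    using poly_roots_finite nz by (intro card_mono) auto
  also have "\<dots> \<le> card {z. poly F z = 0} + card {z. poly Q z = 0}"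
    by (rule card_Un_le)
  finally have "d \<le> card {z. poly F z = 0} + card {z. poly Q z = 0}"
    using c d by (simp add: card_nth_roots)
  moreover have "card {z. poly F z = 0} \<le> degree F" "card {z. poly Q z = 0} \<le> degree Q"
    using card_poly_roots_bound nz by auto
  ultimately show card: "card {z. poly F z = 0} = k"
    using deg F by simp
  have "(\<Prod>r\<in>{z. poly F z = 0}. [:- r, 1:]) dvd F"
    using nz by (intro linear_prod_dvd poly_roots_finite) auto
  then obtain u where u: "F = (\<Prod>r\<in>{z. poly F z = 0}. [:- r, 1:]) * u"
    by (rule dvdE)
  then have u0: "u \<noteq> 0" and prod0: "(\<Prod>r\<in>{z. poly F z = 0}. [:- r, 1:]) \<noteq> 0"
    using nz by auto
  have "degree F = degree (\<Prod>r\<in>{z. poly F z = 0}. [:- r, 1:]) + degree u"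
    using arg_cong[OF u, of degree] degree_mult_eq[OF prod0 u0] by simp
  then have "degree u = 0"
    using card F by (simp add: degree_linear_prod)
  then obtain a where a: "u = [:a:]"
    by (rule degree_eq_zeroE)
  have "lead_coeff F = lead_coeff (\<Prod>r\<in>{z. poly F z = 0}. [:- r, 1:]) * lead_coeff u"
    using arg_cong[OF u, of lead_coeff] by (simp only: lead_coeff_mult)
  then have "a = 1"
    using F a by (simp add: lead_coeff_prod)
  then show "F = (\<Prod>r\<in>{z. poly F z = 0}. [:- r, 1:])"
    using u a by (simp add: one_pCons[symmetric])
qed

lemma orbit_between_lines:
  assumes k: "k \<ge> 1" "k < d"
    and Orb: "Orb \<in> orbits_between (d * k) (corner_ideal k d) (corner_ideal d k)"
  obtains R c where "lines k d R c" "c \<noteq> 0" "Orb = torus_orbit (lines_ideal d R)"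
proof -
  define n where "n = d * k"
  have n: "n = k * d" "n = d * k"
    by (simp_all add: n_def)
  obtain I where I: "I \<in> Hilb n" "Orb = torus_orbit I"
    "krull_dim (subtopology (hilb_zariski n) (torus_orbit I)) = 1"
    using Orb by (auto simp: orbits_between_def one_dim_orbits_def n_def)
  have id: "is_ideal I"
    using I by (simp add: Hilb_def)
  have cl: "corner_ideal k d \<in> hilb_zariski n closure_of torus_orbit I"
    "corner_ideal d k \<in> hilb_zariski n closure_of torus_orbit I"
    using Orb I by (auto simp: orbits_between_def has_limit_points_def n_def)
  have Hilb: "corner_ideal k d \<in> Hilb n" "corner_ideal d k \<in> Hilb n"
    using corner_ideal_Hilb[of k d] corner_ideal_Hilb[of d k] by (simp_all add: n_def mult.commute)
  have B: "basis_mod (rect k d) I"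
    by (rule closure_chart[OF id cl(1) Hilb(1) rect_subset_monomials basis_corner_ideal])
  have B': "basis_mod (rect d k) I"
    by (rule closure_chart[OF id cl(2) Hilb(2) rect_subset_monomials basis_corner_ideal])
  have hom: "int (xdeg m) + int (ydeg m) = int i + int j" if "coord (rect k d) (mon i j) m I \<noteq> 0" for i j m
    by (rule one_dim_orbit_homogeneous[OF id B B' _ _ _ n(1) I(3) that]) (use k in auto)
  have hom': "int (xdeg m) + int (ydeg m) = int i + int j" if "coord (rect d k) (mon i j) m I \<noteq> 0" for i j m
    by (rule one_dim_orbit_homogeneous[OF id B' B _ _ _ n(2) I(3) that]) (use k in auto)
  have in_rect: "xdeg m < a" "ydeg m < b" if "m \<in> rect a b" for m a b
    using that by (auto simp: rect_def)
  have mem: "f \<in> I \<or> (\<exists>m\<in>rect a b. coord (rect a b) f m I \<noteq> 0)" if "basis_mod (rect a b) I" for a b f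
    using coord_0_iff[OF that id] coord_notin[OF that] by metis
  have xk: "mon k 0 \<notin> I"
    using basis_mod_notin[OF B' id, of "mon k 0"] k by simp
  have yk: "mon 0 k \<notin> I"
    using basis_mod_notin[OF B id, of "mon 0 k"] k by simp
  \<comment> \<open>x^k is not in \<open>I\<close>, and by homogeneity its expansion in
    \<open>rect k d\<close> uses positive powers of y only: a positive weight.\<close>
  obtain m1 where m1: "m1 \<in> rect k d" "coord (rect k d) (mon k 0) m1 I \<noteq> 0"
    using mem[OF B] xk by blast
  have m1_pos: "0 < ydeg m1"
    using hom[OF m1(2)] in_rect[OF m1(1)] by simp
  \<comment> \<open>Otherwise y^d would have a coordinate at a smaller y-exponent, a weight of the
    opposite sign.\<close>
  have yd: "mon 0 d \<in> I"
  proof (rule ccontr)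
    assume "mon 0 d \<notin> I"
    then obtain m where m: "m \<in> rect k d" "coord (rect k d) (mon 0 d) m I \<noteq> 0"
      using mem[OF B] by blast
    show False
      by (rule no_opposite_weights[OF id cl(1) B n(1) hom m1(2) m1_pos _ m(2) in_rect(2)[OF m(1)]]) simp_all
  qed
  obtain m2 where m2: "m2 \<in> rect d k" "coord (rect d k) (mon 0 k) m2 I \<noteq> 0"
    using mem[OF B'] yk by blast
  \<comment> \<open>In the chart of the other rectangle, x^d would supply the positive weight, and
    y^k supplies the negative one.\<close>
  have xd: "mon d 0 \<in> I"
  proof (rule ccontr)
    assume "mon d 0 \<notin> I"
    then obtain m where m: "m \<in> rect d k" "coord (rect d k) (mon d 0) m I \<noteq> 0"
      using mem[OF B'] by blast
    have "0 < ydeg m"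
      using hom'[OF m(2)] in_rect[OF m(1)] by simp
    then show False
      by (intro no_opposite_weights[OF id cl(2) B' n(2) hom' m(2) _ _ m2(2) in_rect(2)[OF m2(1)]]) simp_all
  qed
  define c where "c m = coord (rect k d) (mon k 0) m I" for m
  \<comment> \<open>Dehomogenization of x^k minus its normal form.\<close>
  define F where "F = monom 1 k - (\<Sum>i<k. monom (c (mon i (k - i))) i)"
  have coeff_F: "coeff F i = (if i = k then 1 else if i < k then - c (mon i (k - i)) else 0)" for i
    unfolding F_def by (auto simp: coeff_sum sum.delta' sum.neutral)
  have F: "coeff F k = 1" "degree F = k"
    using coeff_F by (auto intro!: antisym degree_le le_degree)
  have "mon k 0 - lin (rect k d) c \<in> I"
    unfolding c_def by (rule coord_mem[OF B])
  also have "mon k 0 - lin (rect k d) c = hom_poly k F"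
  proof (rule cxy_eqI)
    fix j i
    have "c (mon i j) = 0" if "i + j \<noteq> k"
      using hom[of k 0 "mon i j"] that by (auto simp: c_def)
    moreover have "j = k - i" if "i + j = k"
      using that by simp
    ultimately show "coeff (coeff (mon k 0 - lin (rect k d) c) j) i = coeff (coeff (hom_poly k F) j) i"
      using k by (auto simp: coeff_hom_poly coeff_lin_rect coeff_mon coeff_F)
  qed
  finally have hom_F: "hom_poly k F \<in> I" .
  \<comment> \<open>Without its y^k term the form would be a combination of monomials in
    \<open>rect d k\<close> and, lying in \<open>I\<close>, would vanish; but it contains
    x^k.\<close>
  have F0: "coeff F 0 \<noteq> 0"
  proof
    assume *: "coeff F 0 = 0"
    have "coeff F k = 0"
    proof (rule hom_poly_mem_basis[OF B' id hom_F])
      fix i assume "i \<le> k" "\<not> (i < d \<and> k - i < k)"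
      then have "i = 0"
        using k by auto
      then show "coeff F i = 0"
        using * by simp
    qed simp
    then show False
      using F by simp
  qed
  \<comment> \<open>Since x^d, y^d and the multiple of the form lie in \<open>I\<close>, the
    remainder minus its constant term homogenizes to a form in \<open>I\<close>. It is supported on
    \<open>rect k d\<close>, hence zero, so the remainder is constant.\<close>
  define Q where "Q = monom 1 d div F"
  define S where "S = monom 1 d mod F"
  have F_nz: "F \<noteq> 0"
    using F by auto
  have QS: "monom 1 d = F * Q + S"
    by (simp add: Q_def S_def)
  have S_deg: "degree S < k"
    using degree_mod_less[OF F_nz, of "monom 1 d"] F(2) k by (auto simp: S_def)
  have "degree (F * Q) \<le> d"
  proof -
    have "F * Q = monom 1 d - S"
      using QS by simp
    then show ?thesis
      using S_deg k by (simp add: degree_diff_le degree_monom_le)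
  qed
  then have "degree Q \<le> d - k"
    using F F_nz by (cases "Q = 0") (auto simp: degree_mult_eq)
  then have "hom_poly (k + (d - k)) (F * Q) = hom_poly k F * hom_poly (d - k) Q"
    using F by (intro hom_poly_mult) auto
  then have "hom_poly d (F * Q) = hom_poly (d - k) Q * hom_poly k F"
    using k by (simp add: mult.commute)
  then have FQ_mem: "hom_poly d (F * Q) \<in> I"
    using ideal_mult[OF id hom_F] by simp
  have "hom_poly d (S - [:coeff S 0:]) = mon d 0 - hom_poly d (F * Q) - Const (coeff S 0) * mon 0 d"
  proof -
    have "S = monom 1 d - F * Q"
      using QS by simp
    then have "hom_poly d S = mon d 0 - hom_poly d (F * Q)"
      by (simp add: hom_poly_diff hom_poly_monom)
    moreover have "hom_poly d [:coeff S 0:] = Const (coeff S 0) * mon 0 d"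
      using hom_poly_monom[of 0 d "coeff S 0"] by (simp add: monom_0)
    ultimately show ?thesis
      by (simp add: hom_poly_diff)
  qed
  also have "\<dots> \<in> I"
    by (intro ideal_diff id xd yd FQ_mem ideal_mult)
  finally have S_mem: "hom_poly d (S - [:coeff S 0:]) \<in> I" .
  have S_high: "coeff (S - [:coeff S 0:]) i = 0" if "i = 0 \<or> i \<ge> k" for i
    using that S_deg k by (cases i) (auto simp: coeff_eq_0)
  have "coeff (S - [:coeff S 0:]) i = 0" for i
  proof (cases "i \<le> d")
    case True
    show ?thesis
    proof (rule hom_poly_mem_basis[OF B id S_mem _ True])
      fix i assume "i \<le> d" "\<not> (i < k \<and> d - i < d)"
      then have "i = 0 \<or> i \<ge> k"
        using k by auto
      then show "coeff (S - [:coeff S 0:]) i = 0"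
        by (rule S_high)
    qed
  next
    case False
    then show ?thesis
      using k by (intro S_high) simp
  qed
  then have "S - [:coeff S 0:] = 0"
    by (intro poly_eqI) (simp only: coeff_0)
  moreover define c' where "c' = coeff S 0"
  ultimately have "S = [:c':]"
    by (simp only: right_minus_eq)
  then have FQ: "F * Q = monom 1 d - [:c':]"
    using QS by simp
  \<comment> \<open>For c' = 0 every root of F would be 0, against its nonzero constant
    term.\<close>
  have c': "c' \<noteq> 0"
  proof
    assume "c' = 0"
    have "\<not> constant (poly F)"
      using F k by (simp add: constant_degree)
    then obtain z where z: "poly F z = 0"
      using fundamental_theorem_of_algebra by blast
    then have "z ^ d = 0"
      using arg_cong[OF FQ, of "\<lambda>p. poly p z"] \<open>c' = 0\<close> by (simp add: poly_monom)
    then have "poly F 0 = 0"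
      using z by simp
    then show False
      using F0 by (simp add: poly_0_coeff_0)
  qed
  define R where "R = {z. poly F z = 0}"
  have R: "F = (\<Prod>r\<in>R. [:- r, 1:])" "card R = k" "\<And>r. r \<in> R \<Longrightarrow> r ^ d = c'"
    using factor_of_binomial[OF FQ F c'] k by (auto simp: R_def)
  have fin: "finite R"
    using poly_roots_finite[OF F_nz] by (simp add: R_def)
  have lines: "lines k d R c'"
    using k R(2,3) fin c' by unfold_locales (auto simp: zero_power dest!: R(3)[of 0])
  have prod: "(\<Prod>r\<in>R. varX - Const r * varY) = hom_poly k F"
    using lines.hom_F[OF lines] unfolding R(1)[symmetric] .
  \<comment> \<open>Both ideals have the basis \<open>rect k d\<close>, so one inclusion
    suffices.\<close>
  have "lines_ideal d R \<subseteq> I"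
    unfolding lines_ideal_def
  proof (rule ideal_gen_minimal[OF _ id])
    have "mon d 0 = varX ^ d" "mon 0 d = varY ^ d"
      by (simp_all add: mon_def)
    then show "{\<Prod>r\<in>R. varX - Const r * varY, varX ^ d, varY ^ d} \<subseteq> I"
      using hom_F xd yd by (simp add: prod)
  qed
  then have "lines_ideal d R = I"
    by (rule basis_mod_subset_eq[OF lines.basis_x[OF lines] B lines_ideal_is_ideal id])
  then show thesis
    using that[OF lines c'] I by simp
qed

section \<open>Necklaces\<close>

definition root_of_unity :: "nat \<Rightarrow> nat \<Rightarrow> complex" where
  "root_of_unity d a = cis (2 * pi * real a / real d)"

lemma root_of_unity_nz [simp]: "root_of_unity d a \<noteq> 0"
  by (simp add: root_of_unity_def)

lemma root_of_unity_add: "root_of_unity d (a + b) = root_of_unity d a * root_of_unity d b"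
  by (simp add: root_of_unity_def cis_mult algebra_simps add_divide_distrib)

lemma root_of_unity_self: "d > 0 \<Longrightarrow> root_of_unity d d = 1"
  by (simp add: root_of_unity_def)

lemma root_of_unity_mod:
  assumes "d > 0"
  shows "root_of_unity d (a mod d) = root_of_unity d a"
proof -
  have "root_of_unity d (q * d + r) = root_of_unity d r" for q r
    by (induction q) (simp_all add: root_of_unity_add root_of_unity_self assms)
  from this[of "a div d" "a mod d"] show ?thesis
    by simp
qed

lemma bij_root_of_unity: "d > 0 \<Longrightarrow> bij_betw (root_of_unity d) {..<d} {z. z ^ d = 1}"
  unfolding root_of_unity_def by (rule Complex.bij_betw_roots_unity)

lemma inj_root_of_unity: "d > 0 \<Longrightarrow> inj_on (root_of_unity d) {..<d}"
  using bij_root_of_unity bij_betw_imp_inj_on by blast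

lemma bead_ideal_eq_lines_ideal:
  assumes "A \<subseteq> {..<d}"
  shows "bead_ideal d A = lines_ideal d (root_of_unity d ` A)"
proof (cases "d = 0")
  case False
  then have "inj_on (root_of_unity d) A"
    using inj_root_of_unity[of d] assms by (auto intro: inj_on_subset)
  then show ?thesis
    by (simp add: bead_ideal_def lines_ideal_def prod.reindex flip: root_of_unity_def)
qed (use assms in \<open>simp add: bead_ideal_def lines_ideal_def\<close>)

lemma lines_root_of_unity:
  assumes "k \<ge> 1" "k < d" "A \<in> bead_sets k d"
  shows "lines k d (root_of_unity d ` A) 1"
proof
  have A: "A \<subseteq> {..<d}" "card A = k"
    using assms by (auto simp: bead_sets_def)
  then have "inj_on (root_of_unity d) A"
    using inj_root_of_unity[of d] assms by (auto intro: inj_on_subset)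
  then show "card (root_of_unity d ` A) = k"
    using A by (simp add: card_image)
  show "finite (root_of_unity d ` A)"
    using A finite_subset by blast
  show "r ^ d = 1" if "r \<in> root_of_unity d ` A" for r
    using that A bij_root_of_unity[of d] assms by (force simp: bij_betw_def)
qed (use assms in auto)

lemma torus_orbit_rotate:
  assumes "d > 0" "A \<subseteq> {..<d}"
  shows "torus_orbit (bead_ideal d (rotate_beads d r A)) = torus_orbit (bead_ideal d A)"
proof -
  have "rotate_beads d r A \<subseteq> {..<d}"
    using assms by (auto simp: rotate_beads_def)
  then have "bead_ideal d (rotate_beads d r A) = lines_ideal d (root_of_unity d ` rotate_beads d r A)"
    by (rule bead_ideal_eq_lines_ideal)
  also have "root_of_unity d ` rotate_beads d r A = (\<lambda>z. z * (root_of_unity d r / 1)) ` root_of_unity d ` A"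
    using assms by (simp add: rotate_beads_def image_image root_of_unity_mod root_of_unity_add)
  also have "lines_ideal d \<dots> = torus_act 1 (root_of_unity d r) (bead_ideal d A)"
    using bead_ideal_eq_lines_ideal[OF assms(2)] torus_act_lines_ideal[of 1 "root_of_unity d r" d "root_of_unity d ` A"]
    by simp
  finally show ?thesis
    by (simp add: torus_orbit_torus_act)
qed

text \<open>Both forms have coefficient 1 at x^k, so their difference is supported on
  \<open>rect k d\<close>. Lying in the common ideal, it vanishes, and the root sets agree.\<close>

lemma lines_ideal_inj:
  assumes "lines k d R v" "lines k d R' v'" and eq: "lines_ideal d R = lines_ideal d R'"
  shows "R = R'"
proof -
  interpret L: lines k d R v
    by (rule assms)
  interpret L': lines k d R' v'
    by (rule assms)
  have mem: "hom_poly k (L.F - L'.F) \<in> lines_ideal d R"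
    unfolding hom_poly_diff using L.hom_F_mem L'.hom_F_mem eq
    by (intro ideal_diff lines_ideal_is_ideal) auto
  have lead: "coeff (L.F - L'.F) k = 0"
    using lead_coeff_linear_prod[of R] lead_coeff_linear_prod[of R'] L.card_R L'.card_R by simp
  have "coeff (L.F - L'.F) i = 0" if "i \<le> k" for i
  proof (rule hom_poly_mem_basis[OF L.basis_x lines_ideal_is_ideal mem _ that])
    fix i assume "i \<le> k" "\<not> (i < k \<and> k - i < d)"
    then have "i = k"
      using L.k by auto
    then show "coeff (L.F - L'.F) i = 0"
      using lead by simp
  qed
  moreover have "coeff (L.F - L'.F) i = 0" if "i > k" for i
    using that L.card_R L'.card_R by (simp add: coeff_eq_0 degree_linear_prod)
  ultimately have "L.F - L'.F = 0"
    by (intro poly_eqI) (metis coeff_0 linorder_not_le)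
  then have "L.F = L'.F"
    by simp
  then have "z \<in> R \<longleftrightarrow> z \<in> R'" for z
    using poly_linear_prod_0[OF L.fin, of z] poly_linear_prod_0[OF L'.fin, of z] by simp
  then show ?thesis
    by blast
qed

lemma lines_scale:
  assumes "lines k d R v" "u \<noteq> 0"
  shows "lines k d ((\<lambda>z. z * u) ` R) (v * u ^ d)"
proof -
  interpret lines k d R v
    by (rule assms)
  have "inj_on (\<lambda>z. z * u) R"
    using assms by (auto simp: inj_on_def)
  then show ?thesis
    using k fin card_R R0 roots assms
    by unfold_locales (auto simp: card_image power_mult_distrib)
qed

text \<open>Equal orbits mean that multiplication by some u carries one root set to the other. Both
  consist of d-th roots of unity, so u is one as well, and multiplying by it is a rotation.\<close>

lemma torus_orbit_bead_ideal_eq_iff: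
  assumes k: "k \<ge> 1" "k < d" and A: "A \<in> bead_sets k d" "B \<in> bead_sets k d"
  shows "torus_orbit (bead_ideal d A) = torus_orbit (bead_ideal d B) \<longleftrightarrow> (\<exists>r<d. B = rotate_beads d r A)"
proof
  assume "\<exists>r<d. B = rotate_beads d r A"
  then show "torus_orbit (bead_ideal d A) = torus_orbit (bead_ideal d B)"
    using torus_orbit_rotate[of d A] A k by (auto simp: bead_sets_def)
next
  assume eq: "torus_orbit (bead_ideal d A) = torus_orbit (bead_ideal d B)"
  have sub: "A \<subseteq> {..<d}" "B \<subseteq> {..<d}"
    using A by (auto simp: bead_sets_def)
  have LA: "lines k d (root_of_unity d ` A) 1" and LB: "lines k d (root_of_unity d ` B) 1"
    using lines_root_of_unity k A by auto
  have "bead_ideal d B \<in> torus_orbit (bead_ideal d A)"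
    using eq torus_orbit_refl by simp
  then obtain u where u: "u \<noteq> 0" "bead_ideal d B = torus_act 1 u (bead_ideal d A)"
    using lines.torus_orbit_eq[OF LA] by (auto simp: bead_ideal_eq_lines_ideal sub)
  then have "lines_ideal d (root_of_unity d ` B) = lines_ideal d ((\<lambda>z. z * u) ` root_of_unity d ` A)"
    by (simp add: bead_ideal_eq_lines_ideal sub torus_act_lines_ideal)
  then have R: "root_of_unity d ` B = (\<lambda>z. z * u) ` root_of_unity d ` A"
    by (rule lines_ideal_inj[OF LB lines_scale[OF LA u(1)]])
  have "A \<noteq> {}"
    using A k by (auto simp: bead_sets_def)
  then obtain a where a: "a \<in> A"
    by blast
  then obtain b where b: "b \<in> B" "root_of_unity d a * u = root_of_unity d b"
    using R by (metis (no_types, lifting) image_iff)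
  \<comment> \<open>This is b - a modulo d; writing d - a avoids truncated subtraction.\<close>
  define r where "r = (b + (d - a)) mod d"
  have r: "r < d"
    using k by (simp add: r_def)
  have "root_of_unity d r * root_of_unity d a = root_of_unity d (b + d)"
  proof -
    have "root_of_unity d r * root_of_unity d a = root_of_unity d (b + (d - a)) * root_of_unity d a"
      using k by (simp add: r_def root_of_unity_mod)
    also have "\<dots> = root_of_unity d (b + (d - a) + a)"
      by (simp only: root_of_unity_add)
    also have "b + (d - a) + a = b + d"
      using a sub by auto
    finally show ?thesis .
  qed
  also have "\<dots> = root_of_unity d a * u"
    using k b by (simp add: root_of_unity_add root_of_unity_self)
  finally have "u = root_of_unity d r"
    by simp
  then have "root_of_unity d ` B = root_of_unity d ` rotate_beads d r A"
    using R k by (simp add: rotate_beads_def image_image root_of_unity_mod root_of_unity_add)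
  moreover have "rotate_beads d r A \<subseteq> {..<d}"
    using k by (auto simp: rotate_beads_def)
  ultimately have "B = rotate_beads d r A"
    using inj_on_image_eq_iff[OF inj_root_of_unity[of d] sub(2)] k by simp
  then show "\<exists>r<d. B = rotate_beads d r A"
    using r by blast
qed

lemma bead_orbit_between:
  assumes "k \<ge> 1" "k < d" "A \<in> bead_sets k d"
  shows "torus_orbit (bead_ideal d A) \<in> orbits_between (d * k) (corner_ideal k d) (corner_ideal d k)"
proof -
  have "bead_ideal d A = lines_ideal d (root_of_unity d ` A)"
    using assms by (intro bead_ideal_eq_lines_ideal) (auto simp: bead_sets_def)
  then show ?thesis
    using lines.orbit_between[OF lines_root_of_unity[OF assms]] by simp
qed

text \<open>If v^d = c, the solutions of z^d = c are v times the d-th roots of unity, and the factor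
  v is absorbed by the torus element (1, v).\<close>

lemma orbit_between_bead:
  assumes k: "k \<ge> 1" "k < d"
    and Orb: "Orb \<in> orbits_between (d * k) (corner_ideal k d) (corner_ideal d k)"
  shows "\<exists>A\<in>bead_sets k d. Orb = torus_orbit (bead_ideal d A)"
proof -
  obtain R c where L: "lines k d R c" and c: "c \<noteq> 0" and Orb_eq: "Orb = torus_orbit (lines_ideal d R)"
    by (rule orbit_between_lines[OF k Orb])
  interpret lines k d R c
    by (rule L)
  obtain v where v: "v \<noteq> 0" "c = v ^ d"
    using exists_complex_root_nonzero[of c d] c k by auto
  define A where "A = {a\<in>{..<d}. root_of_unity d a * v \<in> R}"
  have A: "A \<subseteq> {..<d}"
    by (auto simp: A_def)
  \<comment> \<open>The factor is written v / 1 to match t / s in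
    \<open>torus_act_lines_ideal\<close>.\<close>
  have R_eq: "R = (\<lambda>z. z * (v / 1)) ` root_of_unity d ` A"
  proof
    show "R \<subseteq> (\<lambda>z. z * (v / 1)) ` root_of_unity d ` A"
    proof
      fix z assume z: "z \<in> R"
      then have "(z / v) ^ d = 1"
        using roots v by (simp add: power_divide)
      then obtain a where "a < d" "z / v = root_of_unity d a"
        using bij_root_of_unity[of d] k by (force simp: bij_betw_def)
      then have "z = root_of_unity d a * v"
        using v by (simp add: field_simps)
      then show "z \<in> (\<lambda>z. z * (v / 1)) ` root_of_unity d ` A"
        using z \<open>a < d\<close> by (auto simp: A_def)
    qed
  qed (auto simp: A_def)
  have "inj_on (\<lambda>z. z * (v / 1)) (root_of_unity d ` A)" "inj_on (root_of_unity d) A"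
    using v inj_root_of_unity[of d] k A by (auto intro: inj_on_subset inj_onI)
  then have "card A = k"
    using card_R unfolding R_eq by (simp add: card_image)
  then have "A \<in> bead_sets k d"
    using A by (simp add: bead_sets_def)
  moreover have "lines_ideal d R = torus_act 1 v (bead_ideal d A)"
    using v by (simp only: R_eq bead_ideal_eq_lines_ideal[OF A] torus_act_lines_ideal one_neq_zero not_False_eq_True)
  then have "Orb = torus_orbit (bead_ideal d A)"
    using v by (simp add: Orb_eq torus_orbit_torus_act)
  ultimately show ?thesis
    by blast
qed

theorem theorem5p11:
  fixes k d :: nat
  assumes "k \<ge> 1" and "d > k"
  shows "finite (orbits_between (d * k) (ideal_gen {varX ^ k, varY ^ d}) (ideal_gen {varX ^ d, varY ^ k})) \<and>
    bij_betw (necklace_orbit d) (necklaces k d)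
      (orbits_between (d * k) (ideal_gen {varX ^ k, varY ^ d}) (ideal_gen {varX ^ d, varY ^ k})) \<and>
    {ideal_gen {varX ^ k, varY ^ d}, ideal_gen {varX ^ d, varY ^ k}} \<in> T_graph_edges (d * k)"
proof -
  define S where "S = orbits_between (d * k) (corner_ideal k d) (corner_ideal d k)"
  \<comment> \<open>Rotation classes are rewritten as fibres of the map from bead sets to orbits,
    which makes injectivity immediate.\<close>
  define N where "N A = {B \<in> bead_sets k d. torus_orbit (bead_ideal d A) = torus_orbit (bead_ideal d B)}" for A
  have neck: "necklaces k d = N ` bead_sets k d"
  proof -
    have "{(A, B). A \<in> bead_sets k d \<and> B \<in> bead_sets k d \<and> (\<exists>r<d. B = rotate_beads d r A)} `` {A} = N A"
      if "A \<in> bead_sets k d" for A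
      using that torus_orbit_bead_ideal_eq_iff[OF assms that] by (auto simp: N_def)
    then show ?thesis
      unfolding necklaces_def quotient_def by auto
  qed
  have orbit: "necklace_orbit d (N A) = torus_orbit (bead_ideal d A)" if "A \<in> bead_sets k d" for A
    using that by (auto simp: necklace_orbit_def N_def)
  have "inj_on (necklace_orbit d) (necklaces k d)"
  proof (rule inj_onI)
    fix x y assume "x \<in> necklaces k d" "y \<in> necklaces k d" and eq: "necklace_orbit d x = necklace_orbit d y"
    then obtain A B where "x = N A" "A \<in> bead_sets k d" "y = N B" "B \<in> bead_sets k d"
      by (auto simp: neck)
    then show "x = y"
      using eq by (simp add: orbit) (simp add: N_def)
  qed
  moreover have "necklace_orbit d ` necklaces k d = S"
  proof -
    have "necklace_orbit d ` necklaces k d = (\<lambda>A. torus_orbit (bead_ideal d A)) ` bead_sets k d"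
      by (simp add: neck image_image orbit)
    also have "\<dots> = S"
      using bead_orbit_between[OF assms] orbit_between_bead[OF assms] by (auto simp: S_def)
    finally show ?thesis .
  qed
  ultimately have bij: "bij_betw (necklace_orbit d) (necklaces k d) S"
    by (simp add: bij_betw_def)
  have "finite (bead_sets k d)"
    by (rule finite_subset[of _ "Pow {..<d}"]) (auto simp: bead_sets_def)
  then have "finite S"
    using bij_betw_finite[OF bij] by (simp add: neck)
  moreover have "{corner_ideal k d, corner_ideal d k} \<in> T_graph_edges (d * k)"
  proof -
    \<comment> \<open>Any bead set witnesses the edge; the first k positions are a convenient
      one.\<close>
    have "{..<k} \<in> bead_sets k d"
      using assms by (auto simp: bead_sets_def)
    then have "torus_orbit (bead_ideal d {..<k}) \<in> S"
      using bead_orbit_between[OF assms] by (simp add: S_def)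
    then show ?thesis
      unfolding S_def orbits_between_def T_graph_edges_def by blast
  qed
  ultimately show ?thesis
    using bij by (simp add: S_def corner_ideal_def)
qed

end
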